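(* Let $p\ge 2$ and $N\ge1$ be integers, $\rho_{\min}\in(0,1]$, $\delta\in(0,1)$ and $B\ge 1$. Let $\mathbf{x}[n]$ be a process in the class $\mathcal{M}(p,d_{\max}=1,\rho_{\min})$ (with eigenvalue bound constant $B$) generated as $$\mathbf{x}[n]=\sum_{m=0}^{K-1}h[m]\,\mathbf{w}[n-m],$$ where $h$ is a real scalar filter of length $K<N/4$ with $\sum_m h^2[m]=1$, and $\mathbf{w}[n]$ is an i.i.d. process with $\mathbf{w}[n]\sim\mathcal{N}(\mathbf{0},\mathbf{C})$, the precision matrix $\mathbf{C}^{-1}$ having at most one non-zero off-diagonal entry in each row. If $$N>\frac{32B^4}{\rho_{\min}^2}\log\left(\frac{2p^2}{\delta}\right),$$ then the neighborhood selection scheme $\widehat{\mathcal{N}}$ described in the context, applied to the observations $\mathbf{x}[1],\dots,\mathbf{x}[N+1]$ with threshold $\eta=N\rho_{\min}/B$, has probability of incorrect selection at most $\delta$: $$\Pr\left\{\exists\, r\in[p]:\ \widehat{\mathcal{N}}(r)\neq\mathcal{N}(r)\right\}\le\delta .$$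
   Context: Write $[p]=\{1,\dots,p\}$; $\log$ is the natural logarithm. Processes. A process $\mathbf{x}[n]=(x_1[n],\dots,x_p[n])^T$, $n\in\mathbb{Z}$, is a real, zero-mean, stationary $p$-variate Gaussian time series with summable autocorrelation function $\mathbf{R}_x[m]=\mathrm{E}\{\mathbf{x}[m]\mathbf{x}^T[0]\}$. Its spectral density matrix (SDM) is $\mathbf{S}_x(\theta)=\sum_{m\in\mathbb{Z}}\mathbf{R}_x[m]e^{-j2\pi\theta m}$, $\theta\in[0,1)$. (For the filtered processes in the claim, $\mathbf{R}_x[m]=0$ for $|m|\ge N/2$ and $\mathbf{R}_x[-m]=\mathbf{R}_x[m]$.) CIG. The conditional independence graph (CIG) of $\mathbf{x}[n]$ is the simple undirected graph $\mathcal{G}=(V,E)$ with $V=[p]$ in which, for $r\ne r'$, $(r,r')\notin E$ if and only if the component processes $x_r[n]$ and $x_{r'}[n]$ are conditionally independent given the remaining component processes; for Gaussian processes with SDM eigenvalues bounded between positive constants this is equivalent to $(\mathbf{S}_x^{-1}(\theta))_{rr'}=0$ for all $\theta\in[0,1)$. The neighborhood of $r$ is $\mathcal{N}(r)=\{r' : (r,r')\in E\}$ and its degree is $d_r=|\mathcal{N}(r)|$. Minimum partial spectral coherence. $$\rho_x=\min_{(r,r')\in E}\left(\int_0^1\frac{|(\mathbf{S}_x^{-1}(\theta))_{rr'}|^2}{(\mathbf{S}_x^{-1}(\theta))_{rr}(\mathbf{S}_x^{-1}(\theta))_{r'r'}}\,d\theta\right)^{1/2},$$ with the requirement $\rho_x\ge\rho_{\min}$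 regarded as vacuous if $E=\emptyset$. Class. $\mathcal{M}(p,d_{\max},\rho_{\min})$ with eigenvalue bound constant $B$ is the class of real, zero-mean, stationary $p$-variate Gaussian time series $\mathbf{x}[n]$, $n\in\mathbb{Z}$, with summable autocorrelation function $\mathbf{R}_x[m]$, such that $1\le\lambda_{\min}(\mathbf{S}_x(\theta))\le\lambda_{\max}(\mathbf{S}_x(\theta))\le B<\infty$ for all $\theta$ (smallest and largest eigenvalues), $d_r\le d_{\max}$ for all $r\in[p]$, and $\rho_x\ge\rho_{\min}$. Selection scheme. From $\mathbf{x}[1],\dots,\mathbf{x}[N+1]$ form the enlarged observations $\tilde{\mathbf{x}}[n]=\mathbf{x}[n]$ for $n\in[N+1]$ and $\tilde{\mathbf{x}}[n]=\mathbf{x}[2N-n+2]$ for $n\in[2N]\setminus[N+1]$. Their DFT is $$\hat{\mathbf{x}}[f]=\frac{1}{\sqrt{2N}}\sum_{n=1}^{2N}\tilde{\mathbf{x}}[n]\exp\left(-j2\pi\frac{(f-1)(n-1)}{2N}\right),\qquad f\in[2N].$$ Let $\hat{\mathbf{x}}_r$ be the vector of length $2N$ given by the $r$th row of the $p\times 2N$ matrix $(\hat{\mathbf{x}}[1],\dots,\hat{\mathbf{x}}[2N])$. For every $r\in[p]$: for all $r'\in[p]\setminus\{r\}$ compute $Z(r')=\hat{\mathbf{x}}_r^T\hat{\mathbf{x}}_{r'}$; determine $\hat r=\mathrm{argmax}_{r'\in[p]\setminus\{r\}}|Z(r')|$; and set $\widehat{\mathcal{N}}(r)=\{\hat r\}$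 if $|Z(\hat r)|\ge\eta$ and $\widehat{\mathcal{N}}(r)=\emptyset$ otherwise, where $\eta>0$ is the threshold. *)

theory Defs
  imports "HOL-Probability.Probability"
begin

section \<open>Gaussian random variables and vectors\<close>

text \<open>Univariate normal distributions; point masses (variance zero) are included, as is usual
  in the definition of a Gaussian process.\<close>

definition gaussian_rv :: "'a measure \<Rightarrow> ('a \<Rightarrow> real) \<Rightarrow> bool" where
  "gaussian_rv M Y \<longleftrightarrow> Y \<in> borel_measurable M \<and>
     ((\<exists>\<mu>. AE \<omega> in M. Y \<omega> = \<mu>) \<or>
      (\<exists>\<mu> \<sigma>. \<sigma> > 0 \<and> distributed M lborel Y (\<lambda>y. ennreal (normal_density \<mu> \<sigma> y))))"

definition pos_def :: "real^'n^'n \<Rightarrow> bool" where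
  "pos_def C \<longleftrightarrow> transpose C = C \<and> (\<forall>v. v \<noteq> 0 \<longrightarrow> v \<bullet> (C *v v) > 0)"

definition mv_normal_density :: "real^'n \<Rightarrow> real^'n^'n \<Rightarrow> real^'n \<Rightarrow> real" where
  "mv_normal_density \<mu> C v =
     exp (- ((v - \<mu>) \<bullet> (matrix_inv C *v (v - \<mu>))) / 2) / sqrt ((2 * pi) ^ CARD('n) * det C)"

text \<open>The nondegenerate multivariate normal distribution with covariance matrix \<open>C\<close>: the
  precision matrix is required to exist.\<close>

definition mv_normal :: "'a measure \<Rightarrow> ('a \<Rightarrow> real^'n) \<Rightarrow> real^'n \<Rightarrow> real^'n^'n \<Rightarrow> bool" where
  "mv_normal M W \<mu> C \<longleftrightarrow>
     pos_def C \<and> distributed M lborel W (\<lambda>v. ennreal (mv_normal_density \<mu> C v))"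


section \<open>Stationary Gaussian time series\<close>

definition gaussian_process :: "'a measure \<Rightarrow> (int \<Rightarrow> 'a \<Rightarrow> real^'p) \<Rightarrow> bool" where
  "gaussian_process M x \<longleftrightarrow>
     (\<forall>n. x n \<in> borel_measurable M) \<and>
     (\<forall>J a. finite J \<longrightarrow> gaussian_rv M (\<lambda>\<omega>. \<Sum>n\<in>J. a n \<bullet> x n \<omega>))"

definition zero_mean :: "'a measure \<Rightarrow> (int \<Rightarrow> 'a \<Rightarrow> real^'p) \<Rightarrow> bool" where
  "zero_mean M x \<longleftrightarrow> (\<forall>n. integrable M (x n) \<and> (LINT \<omega>|M. x n \<omega>) = 0)"

definition stationary :: "'a measure \<Rightarrow> (int \<Rightarrow> 'a \<Rightarrow> real^'p) \<Rightarrow> bool" where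
  "stationary M x \<longleftrightarrow>
     (\<forall>k. distr M (Pi\<^sub>M UNIV (\<lambda>_. borel)) (\<lambda>\<omega> n. x (n + k) \<omega>) =
          distr M (Pi\<^sub>M UNIV (\<lambda>_. borel)) (\<lambda>\<omega> n. x n \<omega>))"

definition acf :: "'a measure \<Rightarrow> (int \<Rightarrow> 'a \<Rightarrow> real^'p) \<Rightarrow> int \<Rightarrow> real^'p^'p" where
  "acf M x m = (\<chi> r s. LINT \<omega>|M. x m \<omega> $ r * x 0 \<omega> $ s)"

definition summable_acf :: "'a measure \<Rightarrow> (int \<Rightarrow> 'a \<Rightarrow> real^'p) \<Rightarrow> bool" where
  "summable_acf M x \<longleftrightarrow> (\<lambda>m. norm (acf M x m)) summable_on UNIV"

definition sdm :: "'a measure \<Rightarrow> (int \<Rightarrow> 'a \<Rightarrow> real^'p) \<Rightarrow> real \<Rightarrow> complex^'p^'p" where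
  "sdm M x \<theta> = (\<chi> r s. \<Sum>\<^sub>\<infinity>m\<in>(UNIV :: int set).
     complex_of_real (acf M x m $ r $ s) * exp (- \<i> * complex_of_real (2 * pi * \<theta> * of_int m)))"

text \<open>Spectral density matrices are Hermitian, so restricting to real eigenvalues loses nothing.\<close>

definition real_eigenvalues :: "complex^'n^'n \<Rightarrow> real set" where
  "real_eigenvalues A = {l. \<exists>v. v \<noteq> 0 \<and> A *v v = complex_of_real l *s v}"

definition lambda_min :: "complex^'n^'n \<Rightarrow> real" where
  "lambda_min A = Min (real_eigenvalues A)"

definition lambda_max :: "complex^'n^'n \<Rightarrow> real" where
  "lambda_max A = Max (real_eigenvalues A)"


section \<open>Conditional independence graph\<close>

definition generated_algebra :: "'a measure \<Rightarrow> 'i set \<Rightarrow> ('i \<Rightarrow> 'a \<Rightarrow> real) \<Rightarrow> 'a measure" where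
  "generated_algebra M I X =
     sigma (space M) {X i -` S \<inter> space M | i S. i \<in> I \<and> S \<in> sets borel}"

definition cond_indep :: "'a measure \<Rightarrow> 'a measure \<Rightarrow> 'a measure \<Rightarrow> 'a measure \<Rightarrow> bool" where
  "cond_indep M F A1 A2 \<longleftrightarrow>
     (\<forall>a\<in>sets A1. \<forall>b\<in>sets A2. AE \<omega> in M.
        real_cond_exp M F (indicator (a \<inter> b)) \<omega> =
        real_cond_exp M F (indicator a) \<omega> * real_cond_exp M F (indicator b) \<omega>)"

text \<open>The sub-sigma-algebra generated by the component processes with index in \<open>R\<close>, over all
  time instants.\<close>

definition components :: "'a measure \<Rightarrow> (int \<Rightarrow> 'a \<Rightarrow> real^'p) \<Rightarrow> 'p set \<Rightarrow> 'a measure" where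
  "components M x R = generated_algebra M (UNIV \<times> R) (\<lambda>(n, r) \<omega>. x n \<omega> $ r)"

definition cig_edges :: "'a measure \<Rightarrow> (int \<Rightarrow> 'a \<Rightarrow> real^'p) \<Rightarrow> ('p \<times> 'p) set" where
  "cig_edges M x = {(r, s). r \<noteq> s \<and>
     \<not> cond_indep M (components M x (- {r, s})) (components M x {r}) (components M x {s})}"

lemma cond_indep_sym:
  assumes "cond_indep M F A1 A2"
  shows "cond_indep M F A2 A1"
  unfolding cond_indep_def
proof (intro ballI)
  fix a b assume "a \<in> sets A2" "b \<in> sets A1"
  with assms have "AE \<omega> in M. real_cond_exp M F (indicator (b \<inter> a)) \<omega> =
      real_cond_exp M F (indicator b) \<omega> * real_cond_exp M F (indicator a) \<omega>"
    unfolding cond_indep_def by blast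
  then show "AE \<omega> in M. real_cond_exp M F (indicator (a \<inter> b)) \<omega> =
      real_cond_exp M F (indicator a) \<omega> * real_cond_exp M F (indicator b) \<omega>"
    by (simp add: Int_commute mult.commute)
qed

lemma cig_edges_sym: "(r, s) \<in> cig_edges M x \<longleftrightarrow> (s, r) \<in> cig_edges M x"
  unfolding cig_edges_def by (auto simp: insert_commute dest: cond_indep_sym)

definition neighborhood :: "'a measure \<Rightarrow> (int \<Rightarrow> 'a \<Rightarrow> real^'p) \<Rightarrow> 'p \<Rightarrow> 'p set" where
  "neighborhood M x r = {s. (r, s) \<in> cig_edges M x}"

text \<open>Diagonal entries of the inverse of a positive definite Hermitian matrix are real and
  positive, hence the real parts in the denominator.\<close>

definition spectral_coherence :: "'a measure \<Rightarrow> (int \<Rightarrow> 'a \<Rightarrow> real^'p) \<Rightarrow> 'p \<Rightarrow> 'p \<Rightarrow> real" where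
  "spectral_coherence M x r s = sqrt (set_lebesgue_integral lborel {0..1} (\<lambda>\<theta>.
     let T = matrix_inv (sdm M x \<theta>)
     in (cmod (T $ r $ s))\<^sup>2 / (Re (T $ r $ r) * Re (T $ s $ s))))"

definition min_coherence :: "'a measure \<Rightarrow> (int \<Rightarrow> 'a \<Rightarrow> real^'p) \<Rightarrow> real" where
  "min_coherence M x = Min ((\<lambda>(r, s). spectral_coherence M x r s) ` cig_edges M x)"

definition process_class ::
    "'a measure \<Rightarrow> nat \<Rightarrow> real \<Rightarrow> real \<Rightarrow> (int \<Rightarrow> 'a \<Rightarrow> real^'p) \<Rightarrow> bool" where
  "process_class M d_max \<rho>_min B x \<longleftrightarrow>
     gaussian_process M x \<and> zero_mean M x \<and> stationary M x \<and> summable_acf M x \<and>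
     (\<forall>\<theta>\<in>{0..<1}. 1 \<le> lambda_min (sdm M x \<theta>) \<and>
                   lambda_min (sdm M x \<theta>) \<le> lambda_max (sdm M x \<theta>) \<and>
                   lambda_max (sdm M x \<theta>) \<le> B) \<and>
     (\<forall>r. card (neighborhood M x r) \<le> d_max) \<and>
     (cig_edges M x \<noteq> {} \<longrightarrow> \<rho>_min \<le> min_coherence M x)"


section \<open>Neighborhood selection scheme\<close>

text \<open>The observations are given as \<open>y\<close>, of which only \<open>y 1, \<dots>, y (N + 1)\<close> are used.\<close>

definition enlarged :: "nat \<Rightarrow> (int \<Rightarrow> real^'p) \<Rightarrow> int \<Rightarrow> real^'p" where
  "enlarged N y n = (if n \<le> int N + 1 then y n else y (2 * int N - n + 2))"

definition dft :: "nat \<Rightarrow> (int \<Rightarrow> real^'p) \<Rightarrow> int \<Rightarrow> complex^'p" where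
  "dft N y f = (\<chi> r. complex_of_real (1 / sqrt (2 * real N)) *
     (\<Sum>n = 1..2 * int N. complex_of_real (enlarged N y n $ r) *
        exp (- \<i> * complex_of_real
          (2 * pi * (of_int (f - 1) * of_int (n - 1)) / (2 * real N)))))"

text \<open>The product is bilinear, without complex conjugation.\<close>

definition Z_stat :: "nat \<Rightarrow> (int \<Rightarrow> real^'p) \<Rightarrow> 'p \<Rightarrow> 'p \<Rightarrow> complex" where
  "Z_stat N y r s = (\<Sum>f = 1..2 * int N. dft N y f $ r * dft N y f $ s)"

text \<open>Ties among the maximizers are broken by the choice operator behind \<open>arg_max\<close>; the
  maximizer chosen depends on the data only through the set of maximizers.\<close>

definition r_hat :: "nat \<Rightarrow> (int \<Rightarrow> real^'p) \<Rightarrow> 'p \<Rightarrow> 'p" where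
  "r_hat N y r = arg_max (\<lambda>s. cmod (Z_stat N y r s)) (\<lambda>s. s \<noteq> r)"

definition selected_neighborhood :: "nat \<Rightarrow> real \<Rightarrow> (int \<Rightarrow> real^'p) \<Rightarrow> 'p \<Rightarrow> 'p set" where
  "selected_neighborhood N \<eta> y r =
     (if cmod (Z_stat N y r (r_hat N y r)) \<ge> \<eta> then {r_hat N y r} else {})"

end

theory Submission
  imports Defs
begin

text \<open>By the symmetry of the enlarged observations, \<open>Z(s)\<close> is a weighted empirical correlation of the
  components \<open>r\<close> and \<open>s\<close>. Polarization writes it as
  \<open>\<kappa> ((1 + c) P - (1 - c) Q)\<close>, where \<open>\<kappa> = sqrt (C_rr C_ss)\<close>, \<open>c = C_rs / \<kappa>\<close>, and \<open>P\<close>, \<open>Q\<close> are the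
  energies of the normalized sum and difference of the two standardized components, both of mean
  \<open>N\<close>. Each of these is the sum of squares of a Gaussian vector whose covariance is a weighted
  Toeplitz matrix with symbol \<open>|H|^2 \<le> B / \<kappa>\<close>, so
  \<open>sqrt P\<close> leaves \<open>((1 - k) sqrt N, (1 + k) sqrt N)\<close> with probability at most
  \<open>2 exp (- N k^2 \<kappa> / (2 B))\<close>. With \<open>k = \<rho>_min / (4 B \<kappa>)\<close> these windows force
  \<open>|Z(s)|\<close> below the threshold if \<open>c = 0\<close> and above it if \<open>|c| \<ge> \<rho>_min\<close>. Since the precision
  matrix splits into blocks of size at most two, these are the only two cases, and they correspond to
  the non-edges and the edges of the conditional independence graph.\<close>

section \<open>Exponential moments of Gaussian quadratic forms\<close>

text \<open>The correlation is traded for two energies because an energy is a positive semidefinite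
  form: a single bound on the norm of its matrix controls both tails, and this spectral condition
  survives the elimination of one variable after another. The law of the observations enters through
  linear combinations. The Gaussian property makes each of them normal, the moment generating
  function computed from the independent noise fixes its mean and variance, and averaging over
  random coefficients leads from there to the sum of squares. A condition on precision entries can
  bound the correlation \<open>c\<close> because the inverse spectral density is the precision
  matrix divided by |H|^2. The coherence of a pair is therefore the same at all frequencies, and in
  a block of size two it equals |c|. The width \<open>k\<close> solves 4 \<open>k\<close> \<kappa> N
  = N \<rho>_min / B: the spread of the windows is exactly the threshold, while an edge has a signal
  of at least twice the threshold. The exponent becomes N \<rho>_min^2 / (32 B^3 \<kappa>), and
  \<kappa> \<le> B turns B^3 \<kappa> into B^4. One window for each of at most p^2 ordered pairs,
  with two tails each, gives the 2 p^2 inside the logarithm.\<close>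

lemma std_normal_quadratic_exp:
  fixes a s :: real
  assumes "a < 1"
  shows "(\<integral>\<^sup>+ y. ennreal (exp ((a * y\<^sup>2 + 2 * y * s) / 2)) \<partial>std_normal_distribution)
    = ennreal (exp (s\<^sup>2 / (2 * (1 - a))) / sqrt (1 - a))"
proof -
  have pos: "1 - a > 0" using assms by simp
  have eq: "std_normal_density y * exp ((a * y\<^sup>2 + 2 * y * s) / 2) =
     exp (s\<^sup>2 / (2 * (1 - a))) / sqrt (1 - a) * normal_density (s / (1 - a)) (1 / sqrt (1 - a)) y" for y
  proof -
    have "- y\<^sup>2 / 2 + (a * y\<^sup>2 + 2 * y * s) / 2
      = s\<^sup>2 / (2 * (1 - a)) - (y - s / (1 - a))\<^sup>2 / (2 * (1 / sqrt (1 - a))\<^sup>2)"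
    proof -
      obtain b where "b > 0" and a: "a = 1 - b" using pos by (intro that[of "1 - a"]) auto
      then show ?thesis unfolding a by (simp add: power_divide field_simps power2_eq_square)
    qed
    then have *: "exp (- y\<^sup>2 / 2) * exp ((a * y\<^sup>2 + 2 * y * s) / 2)
      = exp (s\<^sup>2 / (2 * (1 - a))) * exp (- (y - s / (1 - a))\<^sup>2 / (2 * (1 / sqrt (1 - a))\<^sup>2))"
      by (simp flip: exp_add)
    have "1 / sqrt (2 * pi) = 1 / sqrt (1 - a) * (1 / sqrt (2 * pi * (1 / sqrt (1 - a))\<^sup>2))"
      using pos by (simp add: power_divide real_sqrt_divide real_sqrt_mult)
    then show ?thesis
      unfolding std_normal_density_def normal_density_def using *
      by (simp only: mult_ac times_divide_eq_left times_divide_eq_right) (simp add: mult_ac)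
  qed
  have "(\<integral>\<^sup>+ y. ennreal (exp ((a * y\<^sup>2 + 2 * y * s) / 2)) \<partial>std_normal_distribution)
    = (\<integral>\<^sup>+ y. ennreal (std_normal_density y * exp ((a * y\<^sup>2 + 2 * y * s) / 2)) \<partial>lborel)"
    by (subst nn_integral_density) (auto simp: ennreal_mult)
  also have "\<dots> = (\<integral>\<^sup>+ y. ennreal (exp (s\<^sup>2 / (2 * (1 - a))) / sqrt (1 - a)) *
     ennreal (normal_density (s / (1 - a)) (1 / sqrt (1 - a)) y) \<partial>lborel)"
    unfolding eq using pos by (intro nn_integral_cong ennreal_mult) simp_all
  also have "\<dots> = ennreal (exp (s\<^sup>2 / (2 * (1 - a))) / sqrt (1 - a))"
    using pos by (subst nn_integral_cmult) (auto simp: nn_integral_eq_integral)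
  finally show ?thesis .
qed

text \<open>The hypothesis says that every eigenvalue of \<open>M\<close> lies between \<open>0\<close> and \<open>\<beta>\<close>, for either sign of
  \<open>\<beta>\<close>; in this form it is inherited by the Schur complement that remains after
  one variable has been integrated out.\<close>

lemma gaussian_quadratic_exp_le:
  fixes M :: "'i \<Rightarrow> 'i \<Rightarrow> real" and \<beta> :: real
  assumes "finite I" and "\<And>i j. M i j = M j i" and "\<beta> < 1"
    and "\<And>g. (\<Sum>i\<in>I. (\<Sum>j\<in>I. M i j * g j)\<^sup>2) \<le> \<beta> * (\<Sum>i\<in>I. \<Sum>j\<in>I. g i * M i j * g j)"
  shows "(\<integral>\<^sup>+ g. ennreal (exp ((\<Sum>i\<in>I. \<Sum>j\<in>I. g i * M i j * g j) / 2)) \<partial>Pi\<^sub>M I (\<lambda>_. std_normal_distribution))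
    \<le> ennreal (exp ((\<Sum>i\<in>I. M i i) / (2 * (1 - \<beta>))))"
  using assms(1,2,4)
proof (induction I arbitrary: M rule: finite_induct)
  case empty
  then show ?case by (simp add: PiM_empty nn_integral_count_space_finite)
next
  case (insert k I)
  interpret std: prob_space "std_normal_distribution"
    by (rule prob_space_normal_density) simp
  interpret product_sigma_finite "\<lambda>_::'i. std_normal_distribution"
    by standard
  define a where "a = M k k"
  define v where "v i = M k i" for i
  have sym: "M i j = M j i" for i j by (rule insert.prems(1))
  have vk: "M i k = v i" for i by (simp add: v_def sym)
  have fin: "finite I" and k: "k \<notin> I" by fact+
  have split: "(\<Sum>i\<in>insert k I. \<Sum>j\<in>insert k I. g i * M i j * g j) =
      a * (g k)\<^sup>2 + 2 * g k * (\<Sum>i\<in>I. v i * g i) + (\<Sum>i\<in>I. \<Sum>j\<in>I. g i * M i j * g j)" for g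
    using fin k by (simp add: sum.distrib sum_distrib_left vk a_def power2_eq_square
        mult_ac flip: v_def)
  \<comment> \<open>The spectral hypothesis tested on the unit vector of index \<open>k\<close>. It
    yields \<open>a\<close> < 1 and, in the last estimate, the bound on the square sum of
    \<open>v\<close>.\<close>
  have e1: "a\<^sup>2 + (\<Sum>i\<in>I. (v i)\<^sup>2) \<le> \<beta> * a"
  proof -
    define d :: "'i \<Rightarrow> real" where "d j = (if j = k then 1 else 0)" for j
    have d0: "(\<Sum>j\<in>I. c j * d j) = 0" "(\<Sum>i\<in>I. \<Sum>j\<in>I. d i * M i j * d j) = 0" for c
      using k by (auto intro!: sum.neutral simp: d_def)
    have "(\<Sum>j\<in>insert k I. M i j * d j) = M i k" for i
      using fin k by (simp add: d0) (simp add: d_def)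
    moreover have "(\<Sum>i\<in>insert k I. \<Sum>j\<in>insert k I. d i * M i j * d j) = a"
      unfolding split d0 by (simp add: d_def)
    ultimately show ?thesis
      using insert.prems(2)[of d] fin k by (simp add: a_def vk)
  qed
  have a1: "a < 1"
  proof (rule ccontr)
    assume "\<not> a < 1"
    then have "\<beta> * a < a" "a \<le> a\<^sup>2" using assms(3) by (auto simp: power2_eq_square)
    moreover have "0 \<le> (\<Sum>i\<in>I. (v i)\<^sup>2)" by (rule sum_nonneg) simp
    ultimately show False using e1 by linarith
  qed
  \<comment> \<open>1 - \<open>M'\<close> is the Schur complement of the entry 1 - \<open>a\<close>
    in 1 - \<open>M\<close>. The added rank-one term is what the integral over the eliminated
    variable contributes to the exponent.\<close>
  define M' where "M' i j = M i j + v i * v j / (1 - a)" for i j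
  have M': "(\<Sum>j\<in>I. M' i j * g j) = (\<Sum>j\<in>I. M i j * g j) + v i * ((\<Sum>j\<in>I. v j * g j) / (1 - a))" for i g
    by (simp add: M'_def distrib_left sum.distrib distrib_right sum_distrib_left sum_divide_distrib mult_ac)
  have Q': "(\<Sum>i\<in>I. \<Sum>j\<in>I. g i * M' i j * g j) =
      (\<Sum>j\<in>I. v j * g j)\<^sup>2 / (1 - a) + (\<Sum>i\<in>I. \<Sum>j\<in>I. g i * M i j * g j)" for g
  proof -
    have "(\<Sum>i\<in>I. \<Sum>j\<in>I. g i * M' i j * g j) = (\<Sum>i\<in>I. g i * (\<Sum>j\<in>I. M' i j * g j))"
      by (simp add: sum_distrib_left mult_ac)
    also have "\<dots> = (\<Sum>i\<in>I. g i * (\<Sum>j\<in>I. M i j * g j)) + (\<Sum>i\<in>I. v i * g i) * ((\<Sum>j\<in>I. v j * g j) / (1 - a))"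
      unfolding M' by (simp add: distrib_left sum.distrib sum_distrib_right mult_ac sum_divide_distrib)
    finally show ?thesis by (simp add: sum_distrib_left mult_ac power2_eq_square)
  qed
  have sym': "M' i j = M' j i" for i j by (simp add: M'_def sym mult_ac)
  have bd': "(\<Sum>i\<in>I. (\<Sum>j\<in>I. M' i j * g j)\<^sup>2) \<le> \<beta> * (\<Sum>i\<in>I. \<Sum>j\<in>I. g i * M' i j * g j)" for g
  proof -
    define S where "S = (\<Sum>j\<in>I. v j * g j)"
    \<comment> \<open>The missing coordinate is chosen such that row \<open>k\<close> of
      \<open>M\<close> reproduces it. Then \<open>M\<close> applied to \<open>z\<close> agrees on
      \<open>I\<close> with \<open>M'\<close> applied to \<open>g\<close>, and the form at
      \<open>z\<close> exceeds that of \<open>M'\<close> at \<open>g\<close> by \<open>g1\<close>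
      squared. What is left over is (1 - \<beta>) times the square of \<open>g1\<close>, which has
      the right sign.\<close>
    define g1 where "g1 = S / (1 - a)"
    define z where "z = g(k := g1)"
    have zI: "(\<Sum>j\<in>I. c j * z j) = (\<Sum>j\<in>I. c j * g j)" for c
      using k by (intro sum.cong) (auto simp: z_def)
    have zQ: "(\<Sum>i\<in>I. \<Sum>j\<in>I. z i * M i j * z j) = (\<Sum>i\<in>I. \<Sum>j\<in>I. g i * M i j * g j)"
      using k by (intro sum.cong) (auto simp: z_def)
    have g1: "a * g1 + S = g1"
      unfolding g1_def using a1 by (simp add: field_simps)
    have row: "(\<Sum>j\<in>insert k I. M i j * z j) = v i * g1 + (\<Sum>j\<in>I. M i j * g j)" if "i \<in> I" for i
      using fin k zI by (simp add: vk) (simp add: z_def)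
    have rowk: "(\<Sum>j\<in>insert k I. M k j * z j) = g1"
      using fin k zI[of v] g1 by (simp add: S_def a_def v_def) (simp add: z_def)
    have "(\<Sum>i\<in>insert k I. (\<Sum>j\<in>insert k I. M i j * z j)\<^sup>2) =
       (\<Sum>j\<in>insert k I. M k j * z j)\<^sup>2 + (\<Sum>i\<in>I. (\<Sum>j\<in>insert k I. M i j * z j)\<^sup>2)"
      using fin k by (rule sum.insert)
    also have "\<dots> = g1\<^sup>2 + (\<Sum>i\<in>I. (\<Sum>j\<in>I. M' i j * g j)\<^sup>2)"
      unfolding rowk M' using row by (simp add: S_def[symmetric] g1_def[symmetric] add.commute)
    finally have l: "(\<Sum>i\<in>insert k I. (\<Sum>j\<in>insert k I. M i j * z j)\<^sup>2) = \<dots>" .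
    have "a * g1\<^sup>2 + 2 * g1 * S = g1\<^sup>2 + S\<^sup>2 / (1 - a)"
    proof -
      obtain b where b: "b > 0" and ab: "a = 1 - b" using a1 by (intro that[of "1 - a"]) auto
      show ?thesis unfolding g1_def ab using b by (simp add: field_simps power2_eq_square)
    qed
    then have r: "(\<Sum>i\<in>insert k I. \<Sum>j\<in>insert k I. z i * M i j * z j) = g1\<^sup>2 + (\<Sum>i\<in>I. \<Sum>j\<in>I. g i * M' i j * g j)"
      unfolding split Q' zQ zI[of v] by (simp add: S_def[symmetric] z_def)
    have "0 \<le> (1 - \<beta>) * g1\<^sup>2" using assms(3) by simp
    then show ?thesis
      using insert.prems(2)[of z] unfolding l r by (simp add: algebra_simps)
  qed
  have tr: "(\<Sum>i\<in>I. M' i i) = (\<Sum>i\<in>I. M i i) + (\<Sum>i\<in>I. (v i)\<^sup>2) / (1 - a)"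
    by (simp add: M'_def sum.distrib sum_divide_distrib power2_eq_square)
  have "(\<integral>\<^sup>+ g. ennreal (exp ((\<Sum>i\<in>insert k I. \<Sum>j\<in>insert k I. g i * M i j * g j) / 2)) \<partial>Pi\<^sub>M (insert k I) (\<lambda>_. std_normal_distribution))
    = (\<integral>\<^sup>+ g. (\<integral>\<^sup>+ y. ennreal (exp ((\<Sum>i\<in>insert k I. \<Sum>j\<in>insert k I. (g(k:=y)) i * M i j * (g(k:=y)) j) / 2)) \<partial>std_normal_distribution) \<partial>Pi\<^sub>M I (\<lambda>_. std_normal_distribution))"
    by (rule product_nn_integral_insert[OF fin k]) measurable
  also have "\<dots> = (\<integral>\<^sup>+ g. ennreal (1 / sqrt (1 - a)) * ennreal (exp ((\<Sum>i\<in>I. \<Sum>j\<in>I. g i * M' i j * g j) / 2)) \<partial>Pi\<^sub>M I (\<lambda>_. std_normal_distribution))"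
  proof (rule nn_integral_cong)
    fix g :: "'i \<Rightarrow> real"
    define S where "S = (\<Sum>j\<in>I. v j * g j)"
    define Q where "Q = (\<Sum>i\<in>I. \<Sum>j\<in>I. g i * M i j * g j)"
    have "(\<Sum>i\<in>insert k I. \<Sum>j\<in>insert k I. (g(k:=y)) i * M i j * (g(k:=y)) j) = a * y\<^sup>2 + 2 * y * S + Q" for y
    proof -
      have "(\<Sum>i\<in>I. v i * (g(k := y)) i) = S"
        unfolding S_def using k by (intro sum.cong) auto
      moreover have "(\<Sum>i\<in>I. \<Sum>j\<in>I. (g(k := y)) i * M i j * (g(k := y)) j) = Q"
        unfolding Q_def using k by (intro sum.cong) auto
      ultimately show ?thesis unfolding split by simp
    qed
    then have "(\<integral>\<^sup>+ y. ennreal (exp ((\<Sum>i\<in>insert k I. \<Sum>j\<in>insert k I. (g(k:=y)) i * M i j * (g(k:=y)) j) / 2)) \<partial>std_normal_distribution)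
      = (\<integral>\<^sup>+ y. ennreal (exp (Q / 2)) * ennreal (exp ((a * y\<^sup>2 + 2 * y * S) / 2)) \<partial>std_normal_distribution)"
      by (simp add: add_divide_distrib exp_add ennreal_mult mult_ac)
    also have "\<dots> = ennreal (exp (Q / 2)) * ennreal (exp (S\<^sup>2 / (2 * (1 - a))) / sqrt (1 - a))"
      by (simp add: nn_integral_cmult std_normal_quadratic_exp[OF a1])
    also have "\<dots> = ennreal (1 / sqrt (1 - a)) * ennreal (exp ((S\<^sup>2 / (1 - a) + Q) / 2))"
      using a1 by (simp add: add_divide_distrib exp_add mult_ac flip: ennreal_mult)
    finally show "(\<integral>\<^sup>+ y. ennreal (exp ((\<Sum>i\<in>insert k I. \<Sum>j\<in>insert k I. (g(k:=y)) i * M i j * (g(k:=y)) j) / 2)) \<partial>std_normal_distribution)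
      = ennreal (1 / sqrt (1 - a)) * ennreal (exp ((\<Sum>i\<in>I. \<Sum>j\<in>I. g i * M' i j * g j) / 2))"
      unfolding Q' S_def Q_def .
  qed
  also have "\<dots> = ennreal (1 / sqrt (1 - a)) * (\<integral>\<^sup>+ g. ennreal (exp ((\<Sum>i\<in>I. \<Sum>j\<in>I. g i * M' i j * g j) / 2)) \<partial>Pi\<^sub>M I (\<lambda>_. std_normal_distribution))"
    by (rule nn_integral_cmult) measurable
  also have "\<dots> \<le> ennreal (1 / sqrt (1 - a)) * ennreal (exp ((\<Sum>i\<in>I. M' i i) / (2 * (1 - \<beta>))))"
    using sym' bd' by (intro mult_left_mono insert.IH) auto
  also have "\<dots> = ennreal (exp (- ln (1 - a) / 2 + (\<Sum>i\<in>I. M' i i) / (2 * (1 - \<beta>))))"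
  proof -
    have "1 / sqrt (1 - a) = exp (- ln (1 - a) / 2)"
      using a1 by (simp add: ln_sqrt[symmetric] exp_minus inverse_eq_divide)
    then show ?thesis by (simp only: exp_add ennreal_mult exp_ge_zero)
  qed
  also have "\<dots> \<le> ennreal (exp ((\<Sum>i\<in>insert k I. M i i) / (2 * (1 - \<beta>))))"
  proof -
    define V where "V = (\<Sum>i\<in>I. (v i)\<^sup>2)"
    \<comment> \<open>The inequality ln y \<le> y - 1 at y = 1 / (1 - \<open>a\<close>). Together
      with \<open>V\<close> \<le> \<open>a\<close> (\<beta> - \<open>a\<close>), the two fractions
      add up exactly to \<open>a\<close> / (1 - \<beta>), the share of the entry \<open>k\<close> in
      the claimed trace.\<close>
    have "- ln (1 - a) \<le> a / (1 - a)"
      using ln_le_minus_one[of "1 / (1 - a)"] a1 by (simp add: ln_div field_simps)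
    moreover have "V / ((1 - a) * (1 - \<beta>)) \<le> a * (\<beta> - a) / ((1 - a) * (1 - \<beta>))"
    proof (rule divide_right_mono)
      show "V \<le> a * (\<beta> - a)" using e1 by (simp add: V_def algebra_simps power2_eq_square)
      show "0 \<le> (1 - a) * (1 - \<beta>)" using a1 assms(3) by (intro mult_nonneg_nonneg) auto
    qed
    moreover have "a / (1 - a) + a * (\<beta> - a) / ((1 - a) * (1 - \<beta>)) = a / (1 - \<beta>)"
      using a1 assms(3) by (simp add: divide_simps) (simp add: algebra_simps)
    ultimately have l1: "- ln (1 - a) + V / ((1 - a) * (1 - \<beta>)) \<le> a / (1 - \<beta>)" by linarith
    have l2: "(\<Sum>i\<in>I. M' i i) / (1 - \<beta>) = (\<Sum>i\<in>I. M i i) / (1 - \<beta>) + V / ((1 - a) * (1 - \<beta>))"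
      unfolding tr V_def by (simp add: add_divide_distrib)
    have l3: "(\<Sum>i\<in>insert k I. M i i) / (1 - \<beta>) = a / (1 - \<beta>) + (\<Sum>i\<in>I. M i i) / (1 - \<beta>)"
      using fin k by (simp add: a_def add_divide_distrib)
    have "- ln (1 - a) / 2 + (\<Sum>i\<in>I. M' i i) / (1 - \<beta>) / 2 \<le> (\<Sum>i\<in>insert k I. M i i) / (1 - \<beta>) / 2"
    proof -
      have "- l / 2 + x / 2 \<le> z / 2" if "- l + w \<le> c" "x = y + w" "z = c + y" for l w c x y z :: real
        using that by linarith
      from this[OF l1 l2 l3] show ?thesis .
    qed
    then show ?thesis by (intro ennreal_leI) (simp only: exp_le_cancel_iff divide_divide_eq_left mult.commute[of 2])
  qed
  finally show ?case .
qed

section \<open>Centered normal variables, point mass included\<close>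

text \<open>The last argument is the variance. Variance zero stands for the point mass at 0, since
  the coefficients of the linear combinations range over all vectors, the zero vector
  included.\<close>

definition centered_normal :: "'a measure \<Rightarrow> ('a \<Rightarrow> real) \<Rightarrow> real \<Rightarrow> bool" where
  "centered_normal M Y V \<longleftrightarrow> Y \<in> borel_measurable M \<and>
     (V = 0 \<and> (AE \<omega> in M. Y \<omega> = 0) \<or>
      V > 0 \<and> distributed M lborel Y (\<lambda>y. ennreal (normal_density 0 (sqrt V) y)))"

context prob_space
begin

lemma normal_mgf:
  assumes "\<sigma> > 0" and D: "distributed M lborel Y (\<lambda>y. ennreal (normal_density \<mu> \<sigma> y))"
  shows "(\<integral>\<^sup>+ \<omega>. ennreal (exp (t * Y \<omega>)) \<partial>M) = ennreal (exp (t * \<mu> + t\<^sup>2 * \<sigma>\<^sup>2 / 2))"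
proof -
  have D': "distributed M lborel (\<lambda>\<omega>. (Y \<omega> - \<mu>) / \<sigma>) (\<lambda>y. ennreal (std_normal_density y))"
    using D normal_standard_normal_convert[OF assms(1)] by blast
  have "t * Y \<omega> = t * \<mu> + (t * \<sigma>) * ((Y \<omega> - \<mu>) / \<sigma>)" for \<omega>
    using assms(1) by (simp add: field_simps)
  then have "(\<integral>\<^sup>+ \<omega>. ennreal (exp (t * Y \<omega>)) \<partial>M)
    = (\<integral>\<^sup>+ \<omega>. ennreal (exp (t * \<mu>)) * ennreal (exp ((t * \<sigma>) * ((Y \<omega> - \<mu>) / \<sigma>))) \<partial>M)"
    by (simp only: exp_add ennreal_mult exp_ge_zero)
  also have "\<dots> = ennreal (exp (t * \<mu>)) * (\<integral>\<^sup>+ \<omega>. ennreal (exp ((t * \<sigma>) * ((Y \<omega> - \<mu>) / \<sigma>))) \<partial>M)"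
    using distributed_measurable[OF D] by (intro nn_integral_cmult) simp
  also have "(\<integral>\<^sup>+ \<omega>. ennreal (exp ((t * \<sigma>) * ((Y \<omega> - \<mu>) / \<sigma>))) \<partial>M)
     = (\<integral>\<^sup>+ y. ennreal (std_normal_density y) * ennreal (exp (t * \<sigma> * y)) \<partial>lborel)"
    using distributed_nn_integral[OF D', of "\<lambda>y. ennreal (exp (t * \<sigma> * y))"] by simp
  also have "\<dots> = (\<integral>\<^sup>+ y. ennreal (exp ((0 * y\<^sup>2 + 2 * y * (t * \<sigma>)) / 2)) \<partial>std_normal_distribution)"
    by (subst nn_integral_density) (auto simp: mult_ac)
  also have "\<dots> = ennreal (exp (t\<^sup>2 * \<sigma>\<^sup>2 / 2))"
    by (subst std_normal_quadratic_exp) (auto simp: power_mult_distrib)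
  finally show ?thesis
    by (simp add: exp_add ennreal_mult)
qed

lemma centered_normal_mgf:
  assumes "centered_normal M Y V"
  shows "(\<integral>\<^sup>+ \<omega>. ennreal (exp (Y \<omega>)) \<partial>M) = ennreal (exp (V / 2))"
proof (cases "V = 0")
  case True
  then have "AE \<omega> in M. Y \<omega> = 0" using assms by (auto simp: centered_normal_def)
  then have "(\<integral>\<^sup>+ \<omega>. ennreal (exp (Y \<omega>)) \<partial>M) = (\<integral>\<^sup>+ \<omega>. 1 \<partial>M)"
    by (intro nn_integral_cong_AE) auto
  then show ?thesis using True by (simp add: emeasure_space_1)
next
  case False
  then show ?thesis using assms normal_mgf[of "sqrt V" Y 0 1] by (auto simp: centered_normal_def)
qed

lemma centered_normal_char:
  assumes "centered_normal M Y V"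
  shows "expectation (\<lambda>\<omega>. iexp (Y \<omega>)) = complex_of_real (exp (- V / 2))"
proof (cases "V = 0")
  case True
  then have "AE \<omega> in M. Y \<omega> = 0" and "Y \<in> borel_measurable M"
    using assms by (auto simp: centered_normal_def)
  then have "expectation (\<lambda>\<omega>. iexp (Y \<omega>)) = expectation (\<lambda>\<omega>. 1)"
    by (intro integral_cong_AE) auto
  then show ?thesis using True by (simp add: prob_space)
next
  case False
  then have V: "V > 0" and D: "distributed M lborel Y (\<lambda>y. ennreal (normal_density 0 (sqrt V) y))"
    using assms by (auto simp: centered_normal_def)
  then have D': "distributed M lborel (\<lambda>\<omega>. (Y \<omega> - 0) / sqrt V) (\<lambda>y. ennreal (std_normal_density y))"
    using normal_standard_normal_convert[of "sqrt V" Y 0] by simp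
  have "distr M lborel (\<lambda>\<omega>. (Y \<omega> - 0) / sqrt V) = std_normal_distribution"
    using D' by (simp add: distributed_def)
  then have "complex_of_real (exp (- V / 2)) = char (distr M lborel (\<lambda>\<omega>. (Y \<omega> - 0) / sqrt V)) (sqrt V)"
    using V by (simp add: char_std_normal_distribution)
  also have "\<dots> = expectation (\<lambda>\<omega>. iexp (sqrt V * ((Y \<omega> - 0) / sqrt V)))"
    unfolding char_def using distributed_measurable[OF D']
    by (subst integral_distr) auto
  finally show ?thesis using V by simp
qed

lemma centered_normal_second_moment:
  assumes "centered_normal M Y V"
  shows "integrable M (\<lambda>\<omega>. (Y \<omega>)\<^sup>2)" and "expectation (\<lambda>\<omega>. (Y \<omega>)\<^sup>2) = V"
proof -
  have "integrable M (\<lambda>\<omega>. (Y \<omega>)\<^sup>2) \<and> expectation (\<lambda>\<omega>. (Y \<omega>)\<^sup>2) = V"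
  proof (cases "V = 0")
    case True
    then have ae: "AE \<omega> in M. (Y \<omega>)\<^sup>2 = 0" and [measurable]: "Y \<in> borel_measurable M"
      using assms by (auto simp: centered_normal_def)
    have "integrable M (\<lambda>\<omega>. (Y \<omega>)\<^sup>2) \<longleftrightarrow> integrable M (\<lambda>\<omega>. 0::real)"
      using ae by (intro integrable_cong_AE) auto
    moreover have "expectation (\<lambda>\<omega>. (Y \<omega>)\<^sup>2) = expectation (\<lambda>\<omega>. 0)"
      using ae by (intro integral_cong_AE) auto
    ultimately show ?thesis using True by simp
  next
    case False
    then have V: "V > 0" and D: "distributed M lborel Y (\<lambda>y. ennreal (normal_density 0 (sqrt V) y))"
      using assms by (auto simp: centered_normal_def)
    have "integrable lborel (\<lambda>y. normal_density 0 (sqrt V) y * (y - 0)^2)"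
      using V by (intro integrable_normal_moment) simp
    then have "integrable M (\<lambda>\<omega>. (Y \<omega>)\<^sup>2)"
      using distributed_integrable[OF D, of "\<lambda>y. y\<^sup>2"] by simp
    moreover have "expectation (\<lambda>\<omega>. (Y \<omega>)\<^sup>2) = V"
      using V normal_distributed_variance[OF _ D] normal_distributed_expectation[OF _ D] by simp
    ultimately show ?thesis by simp
  qed
  then show "integrable M (\<lambda>\<omega>. (Y \<omega>)\<^sup>2)" and "expectation (\<lambda>\<omega>. (Y \<omega>)\<^sup>2) = V" by auto
qed

text \<open>The Gaussian property leaves only the mean and the variance open. Comparing the moment
  generating function at t = 1 and t = -1 determines both.\<close>

lemma gaussian_rv_centered_normal:
  assumes "gaussian_rv M Y"
    and mgf: "\<And>t. (\<integral>\<^sup>+ \<omega>. ennreal (exp (t * Y \<omega>)) \<partial>M) = ennreal (exp (t\<^sup>2 * V / 2))"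
  shows "centered_normal M Y V"
proof -
  have Y: "Y \<in> borel_measurable M" using assms(1) by (simp add: gaussian_rv_def)
  consider \<mu> where "AE \<omega> in M. Y \<omega> = \<mu>" | \<mu> \<sigma> where "\<sigma> > 0"
    "distributed M lborel Y (\<lambda>y. ennreal (normal_density \<mu> \<sigma> y))"
    using assms(1) by (auto simp: gaussian_rv_def)
  then show ?thesis
  proof cases
    case 1
    have "ennreal (exp (t\<^sup>2 * V / 2)) = ennreal (exp (t * \<mu>))" for t
    proof -
      have "(\<integral>\<^sup>+ \<omega>. ennreal (exp (t * Y \<omega>)) \<partial>M) = (\<integral>\<^sup>+ \<omega>. ennreal (exp (t * \<mu>)) \<partial>M)"
        using 1 by (intro nn_integral_cong_AE) auto
      then show ?thesis by (simp add: mgf emeasure_space_1)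
    qed
    from this[of 1] this[of "-1"] have "V = 0" "\<mu> = 0" by auto
    then show ?thesis using 1 Y by (simp add: centered_normal_def)
  next
    case 2
    have "t\<^sup>2 * V / 2 = t * \<mu> + t\<^sup>2 * \<sigma>\<^sup>2 / 2" for t
      using normal_mgf[OF 2, of t] mgf[of t] by simp
    from this[of 1] this[of "-1"] have "\<mu> = 0" "V = \<sigma>\<^sup>2" by auto
    then show ?thesis using 2 Y by (simp add: centered_normal_def)
  qed
qed

end

lemma exp_linear_gaussian_integral:
  fixes c :: "'i \<Rightarrow> real"
  assumes "finite I"
  shows "(\<integral>\<^sup>+ g. ennreal (exp (\<Sum>i\<in>I. g i * c i)) \<partial>Pi\<^sub>M I (\<lambda>_. std_normal_distribution))
      = ennreal (exp ((\<Sum>i\<in>I. (c i)\<^sup>2) / 2))"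
    and "(\<integral> g. iexp (\<Sum>i\<in>I. g i * c i) \<partial>Pi\<^sub>M I (\<lambda>_. std_normal_distribution))
      = complex_of_real (exp (- (\<Sum>i\<in>I. (c i)\<^sup>2) / 2))"
proof -
  interpret std: prob_space "std_normal_distribution"
    by (rule prob_space_normal_density) simp
  interpret product_sigma_finite "\<lambda>_::'i. std_normal_distribution"
    by standard
  have "(\<integral>\<^sup>+ g. ennreal (exp (\<Sum>i\<in>I. g i * c i)) \<partial>Pi\<^sub>M I (\<lambda>_. std_normal_distribution))
     = (\<integral>\<^sup>+ g. (\<Prod>i\<in>I. ennreal (exp (g i * c i))) \<partial>Pi\<^sub>M I (\<lambda>_. std_normal_distribution))"
    using assms by (simp add: exp_sum prod_ennreal)
  also have "\<dots> = (\<Prod>i\<in>I. \<integral>\<^sup>+ y. ennreal (exp (y * c i)) \<partial>std_normal_distribution)"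
    using assms by (intro product_nn_integral_prod) auto
  also have "\<dots> = (\<Prod>i\<in>I. ennreal (exp ((c i)\<^sup>2 / 2)))"
  proof (rule prod.cong)
    fix i
    show "(\<integral>\<^sup>+ y. ennreal (exp (y * c i)) \<partial>std_normal_distribution) = ennreal (exp ((c i)\<^sup>2 / 2))"
      using std_normal_quadratic_exp[of 0 "c i"] by simp
  qed simp
  also have "\<dots> = ennreal (exp ((\<Sum>i\<in>I. (c i)\<^sup>2) / 2))"
    using assms by (simp add: prod_ennreal sum_divide_distrib exp_sum)
  finally show "(\<integral>\<^sup>+ g. ennreal (exp (\<Sum>i\<in>I. g i * c i)) \<partial>Pi\<^sub>M I (\<lambda>_. std_normal_distribution))
      = ennreal (exp ((\<Sum>i\<in>I. (c i)\<^sup>2) / 2))" .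
  have "(\<integral> g. iexp (\<Sum>i\<in>I. g i * c i) \<partial>Pi\<^sub>M I (\<lambda>_. std_normal_distribution))
     = (\<integral> g. (\<Prod>i\<in>I. iexp (c i * g i)) \<partial>Pi\<^sub>M I (\<lambda>_. std_normal_distribution))"
    using assms by (simp add: exp_sum[symmetric] sum_distrib_left mult_ac)
  also have "\<dots> = (\<Prod>i\<in>I. \<integral> y. iexp (c i * y) \<partial>std_normal_distribution)"
    using assms by (intro product_integral_prod std.integrable_const_bound[where B=1]) auto
  also have "\<dots> = (\<Prod>i\<in>I. complex_of_real (exp (- (c i)\<^sup>2 / 2)))"
    using char_std_normal_distribution by (simp add: char_def fun_eq_iff)
  also have "\<dots> = complex_of_real (exp (- (\<Sum>i\<in>I. (c i)\<^sup>2) / 2))"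
    using assms by (simp add: exp_sum sum_divide_distrib sum_negf[symmetric] del: of_real_exp)
  finally show "(\<integral> g. iexp (\<Sum>i\<in>I. g i * c i) \<partial>Pi\<^sub>M I (\<lambda>_. std_normal_distribution))
      = complex_of_real (exp (- (\<Sum>i\<in>I. (c i)\<^sup>2) / 2))" .
qed

section \<open>Chernoff bounds for the sum of squares of a Gaussian vector\<close>

context prob_space
begin

text \<open>Markov's inequality for the exponential. The Chernoff multiplier is absorbed into
  \<open>Q\<close> and \<open>a\<close>, so that upper and lower tails, with multipliers of opposite
  sign, are both instances.\<close>

lemma exponential_tail_bound:
  assumes [measurable]: "Q \<in> borel_measurable M"
    and "(\<integral>\<^sup>+ \<omega>. ennreal (exp (Q \<omega>)) \<partial>M) \<le> ennreal (exp b)"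
  shows "prob {\<omega> \<in> space M. a \<le> Q \<omega>} \<le> exp (b - a)"
proof -
  have "emeasure M {\<omega> \<in> space M. a \<le> Q \<omega>} = (\<integral>\<^sup>+ \<omega>. indicator {\<omega> \<in> space M. a \<le> Q \<omega>} \<omega> \<partial>M)"
    by simp
  also have "\<dots> \<le> (\<integral>\<^sup>+ \<omega>. ennreal (exp (- a)) * ennreal (exp (Q \<omega>)) \<partial>M)"
    by (intro nn_integral_mono) (auto simp: indicator_def simp flip: ennreal_mult exp_add)
  also have "\<dots> = ennreal (exp (- a)) * (\<integral>\<^sup>+ \<omega>. ennreal (exp (Q \<omega>)) \<partial>M)"
    by (intro nn_integral_cmult) simp
  also have "\<dots> \<le> ennreal (exp (- a)) * ennreal (exp b)"
    by (intro mult_left_mono assms) simp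
  also have "\<dots> = ennreal (exp (b - a))"
    by (simp add: exp_diff exp_minus divide_inverse mult.commute flip: ennreal_mult)
  finally show ?thesis by (simp add: emeasure_eq_measure)
qed

text \<open>\<open>A\<close> is the covariance matrix of \<open>Y\<close>, as \<open>normal\<close>
  expresses through all linear combinations. The condition \<open>bd\<close> says, without
  mentioning eigenvalues, that \<open>A\<close> is positive semidefinite with norm at most
  \<open>g\<close>.\<close>

context
  fixes I :: "'i set" and Y :: "'i \<Rightarrow> 'a \<Rightarrow> real" and A :: "'i \<Rightarrow> 'i \<Rightarrow> real" and g :: real
  assumes fin: "finite I" and sym: "\<And>i j. A i j = A j i" and g: "0 < g"
    and bd: "\<And>c. (\<Sum>i\<in>I. (\<Sum>j\<in>I. A i j * c j)\<^sup>2) \<le> g * (\<Sum>i\<in>I. \<Sum>j\<in>I. c i * A i j * c j)"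
    and meas [measurable]: "\<And>i. i \<in> I \<Longrightarrow> Y i \<in> borel_measurable M"
    and normal: "\<And>c. centered_normal M (\<lambda>\<omega>. \<Sum>i\<in>I. c i * Y i \<omega>) (\<Sum>i\<in>I. \<Sum>j\<in>I. c i * A i j * c j)"
begin

lemma pair_gaussian: "pair_sigma_finite M (Pi\<^sub>M I (\<lambda>_. std_normal_distribution))"
proof -
  interpret std: prob_space "std_normal_distribution"
    by (rule prob_space_normal_density) simp
  interpret product_prob_space "\<lambda>_::'i. std_normal_distribution" I
    by standard
  show ?thesis by standard
qed

text \<open>Linearization: \<open>exp (s\<^sup>2 / 2)\<close> is the average of \<open>exp (\<gamma> * s)\<close>, and \<open>exp (- s\<^sup>2 / 2)\<close> that of
  \<open>exp (\<i> * \<gamma> * s)\<close>, over a standard normal \<open>\<gamma>\<close>. This reduces exponential moments of the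
  sum of squares to those of a quadratic form in independent normal variables.\<close>

lemma square_sum_exp_moment_pos:
  assumes "\<mu> \<ge> 0"
  shows "(\<integral>\<^sup>+ \<omega>. ennreal (exp (\<mu> * (\<Sum>i\<in>I. (Y i \<omega>)\<^sup>2))) \<partial>M) =
    (\<integral>\<^sup>+ c. ennreal (exp ((\<Sum>i\<in>I. \<Sum>j\<in>I. c i * (2 * \<mu> * A i j) * c j) / 2)) \<partial>Pi\<^sub>M I (\<lambda>_. std_normal_distribution))"
proof -
  interpret P: pair_sigma_finite M "Pi\<^sub>M I (\<lambda>_. std_normal_distribution)" by (rule pair_gaussian)
  define r where "r = sqrt (2 * \<mu>)"
  have r: "r\<^sup>2 = 2 * \<mu>" using assms by (simp add: r_def)
  have "(\<integral>\<^sup>+ \<omega>. ennreal (exp (\<mu> * (\<Sum>i\<in>I. (Y i \<omega>)\<^sup>2))) \<partial>M) =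
     (\<integral>\<^sup>+ \<omega>. \<integral>\<^sup>+ c. ennreal (exp (\<Sum>i\<in>I. c i * (r * Y i \<omega>))) \<partial>Pi\<^sub>M I (\<lambda>_. std_normal_distribution) \<partial>M)"
    by (simp add: exp_linear_gaussian_integral(1)[OF fin] power_mult_distrib r sum_distrib_left sum_divide_distrib)
  also have "\<dots> = (\<integral>\<^sup>+ c. \<integral>\<^sup>+ \<omega>. ennreal (exp (\<Sum>i\<in>I. c i * (r * Y i \<omega>))) \<partial>M \<partial>Pi\<^sub>M I (\<lambda>_. std_normal_distribution))"
    by (rule P.Fubini'[symmetric]) (use fin in measurable)
  also have "\<dots> = (\<integral>\<^sup>+ c. ennreal (exp ((\<Sum>i\<in>I. \<Sum>j\<in>I. c i * (2 * \<mu> * A i j) * c j) / 2)) \<partial>Pi\<^sub>M I (\<lambda>_. std_normal_distribution))"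
  proof (rule nn_integral_cong)
    fix c
    have "(\<Sum>i\<in>I. \<Sum>j\<in>I. (r * c i) * A i j * (r * c j)) = (\<Sum>i\<in>I. \<Sum>j\<in>I. c i * (2 * \<mu> * A i j) * c j)"
    proof -
      have "(r * c i) * A i j * (r * c j) = c i * (2 * \<mu> * A i j) * c j" for i j
        unfolding r[symmetric] by (simp add: power2_eq_square mult_ac)
      then show ?thesis by (simp only:)
    qed
    then show "(\<integral>\<^sup>+ \<omega>. ennreal (exp (\<Sum>i\<in>I. c i * (r * Y i \<omega>))) \<partial>M)
        = ennreal (exp ((\<Sum>i\<in>I. \<Sum>j\<in>I. c i * (2 * \<mu> * A i j) * c j) / 2))"
      using centered_normal_mgf[OF normal[of "\<lambda>i. r * c i"]] by (simp add: mult_ac)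
  qed
  finally show ?thesis .
qed

lemma square_sum_exp_moment_neg:
  assumes "\<mu> \<ge> 0"
  shows "(\<integral>\<^sup>+ \<omega>. ennreal (exp (- \<mu> * (\<Sum>i\<in>I. (Y i \<omega>)\<^sup>2))) \<partial>M) =
    (\<integral>\<^sup>+ c. ennreal (exp ((\<Sum>i\<in>I. \<Sum>j\<in>I. c i * (- 2 * \<mu> * A i j) * c j) / 2)) \<partial>Pi\<^sub>M I (\<lambda>_. std_normal_distribution))"
proof -
  interpret P: pair_sigma_finite M "Pi\<^sub>M I (\<lambda>_. std_normal_distribution)" by (rule pair_gaussian)
  interpret std: prob_space "std_normal_distribution"
    by (rule prob_space_normal_density) simp
  interpret G: product_prob_space "\<lambda>_::'i. std_normal_distribution" I
    by standard
  interpret MG: pair_prob_space M "Pi\<^sub>M I (\<lambda>_. std_normal_distribution)"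
    by standard
  define r where "r = sqrt (2 * \<mu>)"
  have r: "r\<^sup>2 = 2 * \<mu>" using assms by (simp add: r_def)
  have nonneg: "0 \<le> (\<Sum>i\<in>I. \<Sum>j\<in>I. c i * A i j * c j)" for c
  proof -
    have "0 \<le> (\<Sum>i\<in>I. (\<Sum>j\<in>I. A i j * c j)\<^sup>2)" by (intro sum_nonneg) simp
    then have "0 \<le> g * (\<Sum>i\<in>I. \<Sum>j\<in>I. c i * A i j * c j)" using bd[of c] by linarith
    then show ?thesis using g by (simp add: zero_le_mult_iff)
  qed
  have Q: "(\<Sum>i\<in>I. \<Sum>j\<in>I. (r * c i) * A i j * (r * c j)) = - (\<Sum>i\<in>I. \<Sum>j\<in>I. c i * (- 2 * \<mu> * A i j) * c j)" for c
  proof -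
    have "(r * c i) * A i j * (r * c j) = - (c i * (- 2 * \<mu> * A i j) * c j)" for i j
    proof -
      have "(r * c i) * A i j * (r * c j) = r\<^sup>2 * (c i * A i j * c j)"
        by (simp add: power2_eq_square mult_ac)
      then show ?thesis by (simp add: r mult_ac)
    qed
    then show ?thesis by (simp only: sum_negf)
  qed
  have le: "(\<Sum>i\<in>I. \<Sum>j\<in>I. c i * (- 2 * \<mu> * A i j) * c j) \<le> 0" for c
    using nonneg[of "\<lambda>i. r * c i"] unfolding Q by simp
  have int1: "integrable M (\<lambda>\<omega>. exp (- \<mu> * (\<Sum>i\<in>I. (Y i \<omega>)\<^sup>2)))"
    using assms by (intro integrable_const_bound[where B=1]) (auto intro!: AE_I2 sum_nonneg mult_nonneg_nonneg)
  have int2: "integrable (Pi\<^sub>M I (\<lambda>_. std_normal_distribution)) (\<lambda>c. exp ((\<Sum>i\<in>I. \<Sum>j\<in>I. c i * (- 2 * \<mu> * A i j) * c j) / 2))"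
    using le by (intro G.integrable_const_bound[where B=1]) auto
  \<comment> \<open>The kernel is complex valued here, so the exchange of integrals runs through
    Bochner integrals. Integrability is clear, as all integrands have modulus at most 1 on
    probability spaces; for the quadratic form this uses its sign, shown in
    \<open>le\<close>.\<close>
  have "complex_of_real (expectation (\<lambda>\<omega>. exp (- \<mu> * (\<Sum>i\<in>I. (Y i \<omega>)\<^sup>2)))) =
     expectation (\<lambda>\<omega>. complex_of_real (exp (- \<mu> * (\<Sum>i\<in>I. (Y i \<omega>)\<^sup>2))))"
    by (rule integral_complex_of_real[symmetric])
  also have "\<dots> = (\<integral> \<omega>. \<integral> c. iexp (\<Sum>i\<in>I. c i * (r * Y i \<omega>)) \<partial>Pi\<^sub>M I (\<lambda>_. std_normal_distribution) \<partial>M)"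
    unfolding exp_linear_gaussian_integral(2)[OF fin]
    by (simp add: power_mult_distrib r sum_distrib_left sum_negf sum_divide_distrib)
  also have "\<dots> = (\<integral> c. \<integral> \<omega>. iexp (\<Sum>i\<in>I. c i * (r * Y i \<omega>)) \<partial>M \<partial>Pi\<^sub>M I (\<lambda>_. std_normal_distribution))"
  proof (rule P.Fubini_integral[symmetric], rule MG.integrable_const_bound[where B=1])
    show "(\<lambda>(\<omega>, c). iexp (\<Sum>i\<in>I. c i * (r * Y i \<omega>))) \<in> borel_measurable (M \<Otimes>\<^sub>M Pi\<^sub>M I (\<lambda>_. std_normal_distribution))"
      using fin by measurable
  qed auto
  also have "\<dots> = (\<integral> c. complex_of_real (exp ((\<Sum>i\<in>I. \<Sum>j\<in>I. c i * (- 2 * \<mu> * A i j) * c j) / 2)) \<partial>Pi\<^sub>M I (\<lambda>_. std_normal_distribution))"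
  proof (rule Bochner_Integration.integral_cong)
    fix c
    have "(\<Sum>i\<in>I. (r * c i) * Y i \<omega>) = (\<Sum>i\<in>I. c i * (r * Y i \<omega>))" for \<omega>
      by (simp add: mult_ac)
    then show "(\<integral> \<omega>. iexp (\<Sum>i\<in>I. c i * (r * Y i \<omega>)) \<partial>M)
        = complex_of_real (exp ((\<Sum>i\<in>I. \<Sum>j\<in>I. c i * (- 2 * \<mu> * A i j) * c j) / 2))"
      using centered_normal_char[OF normal[of "\<lambda>i. r * c i"]] unfolding Q by simp
  qed simp
  also have "\<dots> = complex_of_real (\<integral> c. exp ((\<Sum>i\<in>I. \<Sum>j\<in>I. c i * (- 2 * \<mu> * A i j) * c j) / 2) \<partial>Pi\<^sub>M I (\<lambda>_. std_normal_distribution))"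
    by (rule integral_complex_of_real)
  finally have "expectation (\<lambda>\<omega>. exp (- \<mu> * (\<Sum>i\<in>I. (Y i \<omega>)\<^sup>2))) =
    (\<integral> c. exp ((\<Sum>i\<in>I. \<Sum>j\<in>I. c i * (- 2 * \<mu> * A i j) * c j) / 2) \<partial>Pi\<^sub>M I (\<lambda>_. std_normal_distribution))"
    by (simp only: of_real_eq_iff)
  then show ?thesis
    using int1 int2 by (simp add: nn_integral_eq_integral)
qed

text \<open>At level t the Chernoff exponent \<mu> \<open>T\<close> / (1 - 2 \<mu> \<open>g\<close>)
  - \<mu> t is minimal where 1 - 2 \<mu> \<open>g\<close> is the square root of \<open>T\<close> /
  t. Writing t as the square of 1 + \<open>k\<close> or 1 - \<open>k\<close> times \<open>T\<close>
  makes the optimal multiplier rational in \<open>k\<close>, and the minimum is the same on both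
  sides.\<close>

lemma square_sum_tails:
  assumes k: "0 < k" "k < 1"
  defines "T \<equiv> (\<Sum>i\<in>I. A i i)"
  shows "prob {\<omega> \<in> space M. (1 + k)\<^sup>2 * T \<le> (\<Sum>i\<in>I. (Y i \<omega>)\<^sup>2)} \<le> exp (- (T * k\<^sup>2 / (2 * g)))"
    and "prob {\<omega> \<in> space M. (\<Sum>i\<in>I. (Y i \<omega>)\<^sup>2) \<le> (1 - k)\<^sup>2 * T} \<le> exp (- (T * k\<^sup>2 / (2 * g)))"
proof -
  \<comment> \<open>The factor \<open>z\<close> may have either sign. For the lower tail it is
    negative, and the eigenvalues then lie between \<open>z * g\<close> and 0.\<close>
  have scale: "(\<Sum>i\<in>I. (\<Sum>j\<in>I. (z * A i j) * c j)\<^sup>2) \<le> z * g * (\<Sum>i\<in>I. \<Sum>j\<in>I. c i * (z * A i j) * c j)" for z c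
  proof -
    have "(\<Sum>i\<in>I. (\<Sum>j\<in>I. (z * A i j) * c j)\<^sup>2) = z\<^sup>2 * (\<Sum>i\<in>I. (\<Sum>j\<in>I. A i j * c j)\<^sup>2)"
      by (simp add: mult.assoc power_mult_distrib flip: sum_distrib_left)
    also have "\<dots> \<le> z\<^sup>2 * (g * (\<Sum>i\<in>I. \<Sum>j\<in>I. c i * A i j * c j))"
      by (intro mult_left_mono bd) simp
    also have "\<dots> = z * g * (z * (\<Sum>i\<in>I. \<Sum>j\<in>I. c i * A i j * c j))"
      by (simp add: power2_eq_square mult_ac)
    also have "z * (\<Sum>i\<in>I. \<Sum>j\<in>I. c i * A i j * c j) = (\<Sum>i\<in>I. \<Sum>j\<in>I. c i * (z * A i j) * c j)"
      by (simp add: sum_distrib_left mult_ac)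
    finally show ?thesis .
  qed
  have elim: "(\<integral>\<^sup>+ c. ennreal (exp ((\<Sum>i\<in>I. \<Sum>j\<in>I. c i * (z * A i j) * c j) / 2)) \<partial>Pi\<^sub>M I (\<lambda>_. std_normal_distribution))
     \<le> ennreal (exp (z * T / (2 * (1 - z * g))))" if "z * g < 1" for z
    using gaussian_quadratic_exp_le[OF fin, of "\<lambda>i j. z * A i j" "z * g"] that scale[of z] sym
    by (simp add: T_def sum_distrib_left)
  define \<mu> where "\<mu> = k / (1 + k) / (2 * g)"
  have mu: "\<mu> \<ge> 0" "2 * \<mu> * g < 1" "1 - 2 * \<mu> * g = 1 / (1 + k)"
  proof -
    have *: "2 * \<mu> * g = k / (1 + k)" using g by (simp add: \<mu>_def)
    show "2 * \<mu> * g < 1" "1 - 2 * \<mu> * g = 1 / (1 + k)" unfolding * using k by (auto simp: field_simps)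
  qed (use k g in \<open>simp add: \<mu>_def\<close>)
  have "prob {\<omega> \<in> space M. \<mu> * ((1 + k)\<^sup>2 * T) \<le> \<mu> * (\<Sum>i\<in>I. (Y i \<omega>)\<^sup>2)}
     \<le> exp (2 * \<mu> * T / (2 * (1 - 2 * \<mu> * g)) - \<mu> * ((1 + k)\<^sup>2 * T))"
    using elim[OF mu(2)] by (intro exponential_tail_bound) (auto simp: square_sum_exp_moment_pos[OF mu(1)])
  also have "2 * \<mu> * T / (2 * (1 - 2 * \<mu> * g)) - \<mu> * ((1 + k)\<^sup>2 * T) = - (T * k\<^sup>2 / (2 * g))"
  proof -
    have "2 * \<mu> * T / (2 * (1 / (1 + k))) - \<mu> * ((1 + k)\<^sup>2 * T) = - (\<mu> * (1 + k)) * k * T"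
      by (simp add: power2_eq_square algebra_simps)
    moreover have "\<mu> * (1 + k) = k / (2 * g)" using k by (simp add: \<mu>_def)
    ultimately show ?thesis unfolding mu(3) by (simp add: power2_eq_square)
  qed
  also have "\<mu> > 0" using k g by (simp add: \<mu>_def)
  then have "{\<omega> \<in> space M. \<mu> * ((1 + k)\<^sup>2 * T) \<le> \<mu> * (\<Sum>i\<in>I. (Y i \<omega>)\<^sup>2)} = {\<omega> \<in> space M. (1 + k)\<^sup>2 * T \<le> (\<Sum>i\<in>I. (Y i \<omega>)\<^sup>2)}"
    by simp
  finally show "prob {\<omega> \<in> space M. (1 + k)\<^sup>2 * T \<le> (\<Sum>i\<in>I. (Y i \<omega>)\<^sup>2)} \<le> exp (- (T * k\<^sup>2 / (2 * g)))" .
  define \<nu> where "\<nu> = k / (1 - k) / (2 * g)"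
  have nu: "\<nu> \<ge> 0" "- 2 * \<nu> * g < 1" "1 - - 2 * \<nu> * g = 1 / (1 - k)" "\<nu> > 0"
  proof -
    have *: "2 * \<nu> * g = k / (1 - k)" using g by (simp add: \<nu>_def)
    have "1 + k / (1 - k) = 1 / (1 - k)" using k by (auto simp: field_simps)
    then show "1 - - 2 * \<nu> * g = 1 / (1 - k)" using * by simp
    have "0 < k / (1 - k)" using k by simp
    then show "- 2 * \<nu> * g < 1" using * by simp
  qed (use k g in \<open>auto simp: \<nu>_def\<close>)
  have "prob {\<omega> \<in> space M. - \<nu> * ((1 - k)\<^sup>2 * T) \<le> - \<nu> * (\<Sum>i\<in>I. (Y i \<omega>)\<^sup>2)}
     \<le> exp (- 2 * \<nu> * T / (2 * (1 - - 2 * \<nu> * g)) - - \<nu> * ((1 - k)\<^sup>2 * T))"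
    using elim[OF nu(2)] unfolding square_sum_exp_moment_neg[OF nu(1), symmetric]
    by (intro exponential_tail_bound) auto
  also have "- 2 * \<nu> * T / (2 * (1 - - 2 * \<nu> * g)) - - \<nu> * ((1 - k)\<^sup>2 * T) = - (T * k\<^sup>2 / (2 * g))"
  proof -
    have "- 2 * \<nu> * T / (2 * (1 / (1 - k))) - - \<nu> * ((1 - k)\<^sup>2 * T) = - (\<nu> * (1 - k)) * k * T"
      by (simp add: power2_eq_square field_simps)
    moreover have "\<nu> * (1 - k) = k / (2 * g)" using k by (simp add: \<nu>_def)
    ultimately show ?thesis unfolding nu(3) by (simp add: power2_eq_square)
  qed
  also have "{\<omega> \<in> space M. - \<nu> * ((1 - k)\<^sup>2 * T) \<le> - \<nu> * (\<Sum>i\<in>I. (Y i \<omega>)\<^sup>2)} = {\<omega> \<in> space M. (\<Sum>i\<in>I. (Y i \<omega>)\<^sup>2) \<le> (1 - k)\<^sup>2 * T}"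
    using nu(4) by simp
  finally show "prob {\<omega> \<in> space M. (\<Sum>i\<in>I. (Y i \<omega>)\<^sup>2) \<le> (1 - k)\<^sup>2 * T} \<le> exp (- (T * k\<^sup>2 / (2 * g)))" .
qed

end

end

section \<open>The multivariate normal distribution\<close>

lemma symmetric_component:
  assumes "transpose A = A"
  shows "A $ r $ s = A $ s $ r"
proof -
  have "transpose A $ r $ s = A $ r $ s" using assms by simp
  then show ?thesis by (simp add: transpose_def)
qed

lemma symmetric_inner:
  fixes A :: "real^'n^'n"
  assumes "transpose A = A"
  shows "u \<bullet> (A *v v) = v \<bullet> (A *v u)"
  by (metis assms dot_lmul_matrix inner_commute transpose_matrix_vector)

lemma axis_bilinear:
  fixes A :: "real^'n^'n"
  shows "axis r 1 \<bullet> (A *v axis s 1) = A $ r $ s"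
  by (simp add: inner_axis' matrix_vector_mul_component inner_axis)

lemma pos_def_invertible:
  assumes "pos_def C"
  shows "invertible C"
proof -
  have "C *v v \<noteq> 0" if "v \<noteq> 0" for v
    using assms that by (force simp: pos_def_def)
  then show ?thesis
    by (simp add: invertible_left_inverse matrix_left_invertible_ker) blast
qed

lemma matrix_inv_unique:
  fixes A :: "'a::comm_ring_1^'n^'n"
  assumes "A ** A' = mat 1" "A' ** A = mat 1"
  shows "matrix_inv A = A'"
proof -
  have "A ** matrix_inv A = mat 1 \<and> matrix_inv A ** A = mat 1"
    unfolding matrix_inv_def by (rule someI[of _ A']) (use assms in simp)
  then show ?thesis using assms by (metis matrix_mul_assoc matrix_mul_lid matrix_mul_rid)
qed

lemma matrix_inv_pos_def:
  fixes C :: "real^'n^'n"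
  assumes "pos_def C"
  shows "C ** matrix_inv C = mat 1" "matrix_inv C ** C = mat 1"
    "transpose (matrix_inv C) = matrix_inv C" "pos_def (matrix_inv C)"
proof -
  note inv = pos_def_invertible[OF assms]
  show 1: "C ** matrix_inv C = mat 1" and 2: "matrix_inv C ** C = mat 1"
    using inv matrix_inv_unique unfolding invertible_def by metis+
  have "transpose (matrix_inv C) ** C = mat 1"
  proof -
    have "transpose (C ** matrix_inv C) = transpose (matrix_inv C) ** transpose C"
      by (rule matrix_transpose_mul)
    then show ?thesis using assms by (simp add: 1 pos_def_def transpose_mat)
  qed
  then have "transpose (matrix_inv C) ** C ** matrix_inv C = matrix_inv C" by simp
  then show 3: "transpose (matrix_inv C) = matrix_inv C"
    by (simp add: 1 flip: matrix_mul_assoc)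
  show "pos_def (matrix_inv C)"
    unfolding pos_def_def
  proof (intro conjI allI impI 3)
    fix v :: "real^'n" assume "v \<noteq> 0"
    define u where "u = matrix_inv C *v v"
    have v: "v = C *v u" by (simp add: u_def matrix_vector_mul_assoc 1)
    then have "u \<noteq> 0" using \<open>v \<noteq> 0\<close> by auto
    then have "u \<bullet> (C *v u) > 0" using assms by (simp add: pos_def_def)
    then show "v \<bullet> (matrix_inv C *v v) > 0"
      by (simp add: v[symmetric] u_def[symmetric] inner_commute)
  qed
qed

text \<open>Completing the square turns the exponential weight into a translation of the density, so
  translation invariance of Lebesgue measure replaces the computation of the Gaussian integral.\<close>

lemma (in prob_space) mv_normal_mgf:
  assumes W: "mv_normal M W 0 C"
  shows "(\<integral>\<^sup>+ \<omega>. ennreal (exp (a \<bullet> W \<omega>)) \<partial>M) = ennreal (exp (a \<bullet> (C *v a) / 2))"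
proof -
  have C: "pos_def C" and D: "distributed M lborel W (\<lambda>v. ennreal (mv_normal_density 0 C v))"
    using W by (auto simp: mv_normal_def)
  note inv = matrix_inv_pos_def[OF C]
  let ?T = "matrix_inv C"
  note Tsym = symmetric_inner[OF inv(3)]
  \<comment> \<open>\<open>sqrt\<close> of a negative number is negative, so the sign of the density
    depends on that of the determinant. A negative sign is impossible: \<open>ennreal\<close> would
    cut the density down to 0, against its total mass 1.\<close>
  have nn: "0 \<le> mv_normal_density 0 C v" for v
  proof (cases "0 \<le> (2 * pi) ^ CARD('b) * det C")
    case True then show ?thesis by (auto simp: mv_normal_density_def)
  next
    case False
    have "AE v in lborel. ennreal (mv_normal_density 0 C v) = 0"
      using False by (intro AE_I2 ennreal_neg) (auto simp: mv_normal_density_def divide_le_0_iff)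
    then have "(\<integral>\<^sup>+ v. ennreal (mv_normal_density 0 C v) \<partial>lborel) = 0"
      using distributed_borel_measurable[OF D] by (subst nn_integral_0_iff_AE) auto
    moreover have "(\<integral>\<^sup>+ v. ennreal (mv_normal_density 0 C v) \<partial>lborel) = 1"
      using distributed_nn_integral[OF D, of "\<lambda>_. 1"] by (simp add: emeasure_space_1)
    ultimately show ?thesis by simp
  qed
  have one: "(\<integral>\<^sup>+ v. ennreal (mv_normal_density 0 C v) \<partial>lborel) = 1"
    using distributed_nn_integral[OF D, of "\<lambda>_. 1"] by (simp add: emeasure_space_1)
  have shift: "mv_normal_density 0 C v * exp (a \<bullet> v) = exp (a \<bullet> (C *v a) / 2) * mv_normal_density 0 C (- (C *v a) + v)" for v
  proof -
    have TC: "?T *v (C *v a) = a" by (simp add: matrix_vector_mul_assoc inv)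
    have "(- (C *v a) + v) \<bullet> (?T *v (- (C *v a) + v)) = v \<bullet> (?T *v v) - 2 * (a \<bullet> v) + a \<bullet> (C *v a)"
      using Tsym[of "C *v a" v] TC
      by (simp add: matrix_vector_mult_diff_distrib matrix_vector_right_distrib inner_add inner_diff
          inner_commute algebra_simps minus_add[symmetric])
    then have "- (v \<bullet> (?T *v v)) / 2 + a \<bullet> v = a \<bullet> (C *v a) / 2 + (- ((- (C *v a) + v) \<bullet> (?T *v (- (C *v a) + v))) / 2)"
      by (simp add: field_simps)
    then have "exp (- (v \<bullet> (?T *v v)) / 2) * exp (a \<bullet> v) = exp (a \<bullet> (C *v a) / 2) * exp (- ((- (C *v a) + v) \<bullet> (?T *v (- (C *v a) + v))) / 2)"
      by (simp only: exp_add[symmetric])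
    then show ?thesis by (simp add: mv_normal_density_def)
  qed
  have m [measurable]: "(\<lambda>v. ennreal (mv_normal_density 0 C v)) \<in> borel_measurable borel"
    using distributed_borel_measurable[OF D] by simp
  have "(\<integral>\<^sup>+ \<omega>. ennreal (exp (a \<bullet> W \<omega>)) \<partial>M) = (\<integral>\<^sup>+ v. ennreal (mv_normal_density 0 C v) * ennreal (exp (a \<bullet> v)) \<partial>lborel)"
    using distributed_nn_integral[OF D, of "\<lambda>v. ennreal (exp (a \<bullet> v))"] by simp
  also have "\<dots> = (\<integral>\<^sup>+ v. ennreal (exp (a \<bullet> (C *v a) / 2)) * ennreal (mv_normal_density 0 C (- (C *v a) + v)) \<partial>lborel)"
    by (simp add: shift nn flip: ennreal_mult)
  also have "\<dots> = ennreal (exp (a \<bullet> (C *v a) / 2)) * (\<integral>\<^sup>+ v. ennreal (mv_normal_density 0 C (- (C *v a) + v)) \<partial>lborel)"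
    by (intro nn_integral_cmult) measurable
  also have "(\<integral>\<^sup>+ v. ennreal (mv_normal_density 0 C (- (C *v a) + v)) \<partial>lborel) = (\<integral>\<^sup>+ v. ennreal (mv_normal_density 0 C v) \<partial>distr lborel borel ((+) (- (C *v a))))"
    by (subst nn_integral_distr) auto
  also have "\<dots> = 1"
    by (simp add: one lborel_distr_plus)
  finally show ?thesis by simp
qed

section \<open>Filtered white noise\<close>

text \<open>With the filter extended by zero to all integers, the outputs at different times can be
  written as sums over one common finite window of noise indices.\<close>

definition zero_ext :: "nat \<Rightarrow> (nat \<Rightarrow> real) \<Rightarrow> int \<Rightarrow> real" where
  "zero_ext K h j = (if 0 \<le> j \<and> j < int K then h (nat j) else 0)"

lemma sum_filter_window:
  fixes v :: "int \<Rightarrow> 'b::real_vector"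
  assumes "finite W" and "{n - int K<..n} \<subseteq> W"
  shows "(\<Sum>m<K. h m *\<^sub>R v (n - int m)) = (\<Sum>k\<in>W. zero_ext K h (n - k) *\<^sub>R v k)"
proof -
  have "(\<Sum>m<K. h m *\<^sub>R v (n - int m)) = (\<Sum>k\<in>{n - int K<..n}. zero_ext K h (n - k) *\<^sub>R v k)"
    by (rule sum.reindex_bij_witness[where j = "\<lambda>m. n - int m" and i = "\<lambda>k. nat (n - k)"])
      (auto simp: zero_ext_def)
  also have "\<dots> = (\<Sum>k\<in>W. zero_ext K h (n - k) *\<^sub>R v k)"
    using assms by (intro sum.mono_neutral_left) (auto simp: zero_ext_def)
  finally show ?thesis .
qed

locale filtered_noise = prob_space M
  for M :: "'a measure" +
  fixes x w :: "int \<Rightarrow> 'a \<Rightarrow> real^'p" and C :: "real^'p^'p" and h :: "nat \<Rightarrow> real" and K :: nat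
  assumes gaussian: "gaussian_process M x"
    and filter: "\<And>n \<omega>. \<omega> \<in> space M \<Longrightarrow> x n \<omega> = (\<Sum>m<K. h m *\<^sub>R w (n - int m) \<omega>)"
    and unit: "(\<Sum>m<K. (h m)\<^sup>2) = 1"
    and indep: "indep_vars (\<lambda>_. borel) w UNIV"
    and noise: "\<And>n. mv_normal M (w n) 0 C"
begin

abbreviation "hz \<equiv> zero_ext K h"

text \<open>That the law is normal is part of the Gaussian process. Its variance is read off from
  the moment generating function, which factorizes over the independent noise vectors;
  \<open>b k\<close> collects the total coefficient of \<open>w k\<close>.\<close>

lemma linear_combination_normal:
  fixes a :: "int \<Rightarrow> real^'p"
  assumes J: "finite J" and W: "finite W" "\<And>n. n \<in> J \<Longrightarrow> {n - int K<..n} \<subseteq> W"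
  defines "b \<equiv> \<lambda>k. \<Sum>n\<in>J. hz (n - k) *\<^sub>R a n"
  shows "centered_normal M (\<lambda>\<omega>. \<Sum>n\<in>J. a n \<bullet> x n \<omega>) (\<Sum>k\<in>W. b k \<bullet> (C *v b k))"
proof (rule gaussian_rv_centered_normal)
  show "gaussian_rv M (\<lambda>\<omega>. \<Sum>n\<in>J. a n \<bullet> x n \<omega>)"
    using gaussian J by (simp add: gaussian_process_def)
next
  fix t :: real
  have lin: "(\<Sum>n\<in>J. a n \<bullet> x n \<omega>) = (\<Sum>k\<in>W. b k \<bullet> w k \<omega>)" if "\<omega> \<in> space M" for \<omega>
  proof -
    have "(\<Sum>n\<in>J. a n \<bullet> x n \<omega>) = (\<Sum>n\<in>J. \<Sum>k\<in>W. (hz (n - k) *\<^sub>R a n) \<bullet> w k \<omega>)"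
    proof (rule sum.cong)
      fix n assume "n \<in> J"
      then have "x n \<omega> = (\<Sum>k\<in>W. hz (n - k) *\<^sub>R w k \<omega>)"
        using filter[OF that] sum_filter_window[OF W(1) W(2)] by simp
      then show "a n \<bullet> x n \<omega> = (\<Sum>k\<in>W. (hz (n - k) *\<^sub>R a n) \<bullet> w k \<omega>)"
        by (simp add: inner_sum_right)
    qed simp
    also have "\<dots> = (\<Sum>k\<in>W. b k \<bullet> w k \<omega>)"
      by (subst sum.swap) (simp add: b_def inner_sum_left)
    finally show ?thesis .
  qed
  have "(\<integral>\<^sup>+ \<omega>. ennreal (exp (t * (\<Sum>n\<in>J. a n \<bullet> x n \<omega>))) \<partial>M)
      = (\<integral>\<^sup>+ \<omega>. (\<Prod>k\<in>W. ennreal (exp ((t *\<^sub>R b k) \<bullet> w k \<omega>))) \<partial>M)"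
    using W(1) by (intro nn_integral_cong) (simp add: lin prod_ennreal exp_sum sum_distrib_left)
  also have "\<dots> = (\<Prod>k\<in>W. \<integral>\<^sup>+ \<omega>. ennreal (exp ((t *\<^sub>R b k) \<bullet> w k \<omega>)) \<partial>M)"
    using W(1) by (intro indep_vars_nn_integral indep_vars_compose2[OF indep_vars_subset[OF indep]]) auto
  also have "\<dots> = (\<Prod>k\<in>W. ennreal (exp (t\<^sup>2 * (b k \<bullet> (C *v b k)) / 2)))"
  proof (rule prod.cong[OF refl])
    fix k
    have "(t *\<^sub>R b k) \<bullet> (C *v (t *\<^sub>R b k)) = t\<^sup>2 * (b k \<bullet> (C *v b k))"
      by (simp add: matrix_vector_mult_scaleR power2_eq_square)
    then show "(\<integral>\<^sup>+ \<omega>. ennreal (exp ((t *\<^sub>R b k) \<bullet> w k \<omega>)) \<partial>M) = ennreal (exp (t\<^sup>2 * (b k \<bullet> (C *v b k)) / 2))"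
      using mv_normal_mgf[OF noise, of "t *\<^sub>R b k"] by simp
  qed
  also have "\<dots> = ennreal (exp (t\<^sup>2 * (\<Sum>k\<in>W. b k \<bullet> (C *v b k)) / 2))"
    using W(1) by (simp add: prod_ennreal exp_sum sum_distrib_left sum_divide_distrib)
  finally show "(\<integral>\<^sup>+ \<omega>. ennreal (exp (t * (\<Sum>n\<in>J. a n \<bullet> x n \<omega>))) \<partial>M)
      = ennreal (exp (t\<^sup>2 * (\<Sum>k\<in>W. b k \<bullet> (C *v b k)) / 2))" .
qed

lemma pos_def_C: "pos_def C"
  using noise by (auto simp: mv_normal_def)

lemma C_sym: "C $ r $ s = C $ s $ r"
  using pos_def_C by (intro symmetric_component) (simp add: pos_def_def)

lemma x_measurable [measurable]: "x n \<in> borel_measurable M"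
  using gaussian by (simp add: gaussian_process_def)

lemma x_component_measurable [measurable]: "(\<lambda>\<omega>. x n \<omega> $ r) \<in> borel_measurable M"
  using borel_measurable_inner[OF x_measurable, of "\<lambda>_. axis r 1" n] by (simp add: inner_axis)

text \<open>Polarization: the product is a quarter of the difference of the squares of sum and
  difference, and both of these are centered normal with known variance. Integrability comes
  along.\<close>

lemma x_moments:
  assumes W: "finite W" "{m - int K<..m} \<subseteq> W" "{n - int K<..n} \<subseteq> W"
  shows "integrable M (\<lambda>\<omega>. x m \<omega> $ r * x n \<omega> $ s)"
    and "expectation (\<lambda>\<omega>. x m \<omega> $ r * x n \<omega> $ s) = C $ r $ s * (\<Sum>k\<in>W. hz (m - k) * hz (n - k))"
proof -
  define u where "u k = hz (m - k)" for k
  define v where "v k = hz (n - k)" for k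
  have cn: "centered_normal M (\<lambda>\<omega>. \<alpha> * x m \<omega> $ r + \<beta> * x n \<omega> $ s)
     (\<alpha>\<^sup>2 * C $ r $ r * (\<Sum>k\<in>W. (u k)\<^sup>2) + 2 * \<alpha> * \<beta> * C $ r $ s * (\<Sum>k\<in>W. u k * v k) + \<beta>\<^sup>2 * C $ s $ s * (\<Sum>k\<in>W. (v k)\<^sup>2))" for \<alpha> \<beta>
  proof -
    \<comment> \<open>The two contributions are added rather than given by cases, so the weights
      stay correct when \<open>m = n\<close> and the index set collapses to one point.\<close>
    define a where "a l = (if l = m then \<alpha> *\<^sub>R axis r 1 else 0) + (if l = n then \<beta> *\<^sub>R axis s 1 else (0::real^'p))" for l
    have "(\<Sum>l\<in>{m, n}. a l \<bullet> x l \<omega>) = \<alpha> * x m \<omega> $ r + \<beta> * x n \<omega> $ s" for \<omega>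
      by (cases "m = n") (auto simp: a_def inner_add_left inner_axis')
    moreover have "(\<Sum>l\<in>{m, n}. hz (l - k) *\<^sub>R a l) = (\<alpha> * u k) *\<^sub>R axis r 1 + (\<beta> * v k) *\<^sub>R axis s 1" for k
      by (cases "m = n") (auto simp: a_def u_def v_def scaleR_add_right mult.commute)
    moreover have "((\<alpha> * u k) *\<^sub>R axis r 1 + (\<beta> * v k) *\<^sub>R axis s 1) \<bullet> (C *v ((\<alpha> * u k) *\<^sub>R axis r 1 + (\<beta> * v k) *\<^sub>R axis s 1))
       = \<alpha>\<^sup>2 * C $ r $ r * (u k)\<^sup>2 + 2 * \<alpha> * \<beta> * C $ r $ s * (u k * v k) + \<beta>\<^sup>2 * C $ s $ s * (v k)\<^sup>2" for k
      unfolding matrix_vector_right_distrib matrix_vector_mult_scaleR inner_add_left inner_add_right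
        inner_scaleR_left inner_scaleR_right axis_bilinear C_sym[of s r]
      by (simp add: power2_eq_square algebra_simps)
    moreover have "{l - int K<..l} \<subseteq> W" if "l \<in> {m, n}" for l
      using that W by auto
    ultimately show ?thesis
      using linear_combination_normal[of "{m, n}" W a] W(1) by (simp add: sum.distrib sum_distrib_left)
  qed
  have i1: "integrable M (\<lambda>\<omega>. (x m \<omega> $ r + x n \<omega> $ s)\<^sup>2)" "expectation (\<lambda>\<omega>. (x m \<omega> $ r + x n \<omega> $ s)\<^sup>2) =
      C $ r $ r * (\<Sum>k\<in>W. (u k)\<^sup>2) + 2 * C $ r $ s * (\<Sum>k\<in>W. u k * v k) + C $ s $ s * (\<Sum>k\<in>W. (v k)\<^sup>2)"
    using centered_normal_second_moment[OF cn[of 1 1]] by simp_all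
  have i2: "integrable M (\<lambda>\<omega>. (x m \<omega> $ r - x n \<omega> $ s)\<^sup>2)" "expectation (\<lambda>\<omega>. (x m \<omega> $ r - x n \<omega> $ s)\<^sup>2) =
      C $ r $ r * (\<Sum>k\<in>W. (u k)\<^sup>2) - 2 * C $ r $ s * (\<Sum>k\<in>W. u k * v k) + C $ s $ s * (\<Sum>k\<in>W. (v k)\<^sup>2)"
    using centered_normal_second_moment[OF cn[of 1 "-1"]] by simp_all
  have eq: "x m \<omega> $ r * x n \<omega> $ s = ((x m \<omega> $ r + x n \<omega> $ s)\<^sup>2 - (x m \<omega> $ r - x n \<omega> $ s)\<^sup>2) / 4" for \<omega>
    by (simp add: power2_eq_square algebra_simps)
  show "integrable M (\<lambda>\<omega>. x m \<omega> $ r * x n \<omega> $ s)"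
    unfolding eq using i1 i2 by simp
  show "expectation (\<lambda>\<omega>. x m \<omega> $ r * x n \<omega> $ s) = C $ r $ s * (\<Sum>k\<in>W. hz (m - k) * hz (n - k))"
    unfolding eq using i1 i2 by (simp add: u_def v_def)
qed

end

section \<open>Discrete Fourier analysis\<close>

lemma cis_grid_sum:
  fixes d :: int and L :: nat
  assumes "L > 0"
  shows "(\<Sum>j<L. cis (2 * pi * (real j / real L) * of_int d)) = (if int L dvd d then of_nat L else 0)"
proof -
  define z where "z = cis (2 * pi * of_int d / real L)"
  have pow: "cis (2 * pi * (real j / real L) * of_int d) = z ^ j" for j

  proof -
    have "z ^ j = cis (real j * (2 * pi * of_int d / real L))" by (simp only: z_def Complex.DeMoivre)
    then show ?thesis by (simp add: mult_ac)
  qed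
  have z1: "z = 1 \<longleftrightarrow> int L dvd d"
  proof
    assume "z = 1"
    then obtain n :: int where "2 * pi * of_int d / real L = of_int (2 * n) * pi"
      by (auto simp: z_def cis_conv_exp exp_eq_1)
    then have "of_int d = (of_int (n * int L) :: real)"
      using assms by (simp add: field_simps)
    then show "int L dvd d" by (simp only: of_int_eq_iff) simp
  next
    assume "int L dvd d"
    then obtain k where "d = int L * k" by auto
    then have "2 * pi * of_int d / real L = 2 * pi * of_int k" using assms by simp
    then show "z = 1" by (simp only: z_def cis_multiple_2pi[OF Ints_of_int])
  qed
  have "z ^ L = cis (2 * pi * of_int d)"
    using assms by (simp only: z_def Complex.DeMoivre) simp
  also have "\<dots> = 1" by (simp add: cis_multiple_2pi)
  finally have "z ^ L = 1" .
  then show ?thesis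
    unfolding pow using z1 by (auto simp: sum_gp_strict)
qed

text \<open>The summation range is one full period, so two of its indices are congruent modulo
  \<open>L\<close> only if they are equal. Orthogonality of the exponentials then leaves the
  diagonal terms.\<close>

lemma parseval_grid:
  fixes a :: "int \<Rightarrow> real" and l :: int and L :: nat
  assumes "L > 0"
  shows "(\<Sum>j<L. (cmod (\<Sum>n\<in>{l..<l + int L}. of_real (a n) * cis (- (2 * pi * (real j / real L) * of_int n))))\<^sup>2)
     = real L * (\<Sum>n\<in>{l..<l + int L}. (a n)\<^sup>2)"
proof -
  define R where "R = {l..<l + int L}"
  define e where "e j n = cis (- (2 * pi * (real j / real L) * of_int n))" for j :: nat and n :: int
  have fin: "finite R" by (simp add: R_def)
  have e: "e j n * cnj (e j m) = cis (2 * pi * (real j / real L) * of_int (m - n))" for j n m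
    by (simp add: e_def cis_cnj cis_mult algebra_simps diff_divide_distrib)
  have "complex_of_real (\<Sum>j<L. (cmod (\<Sum>n\<in>R. of_real (a n) * e j n))\<^sup>2)
     = (\<Sum>j<L. \<Sum>n\<in>R. \<Sum>m\<in>R. of_real (a n * a m) * cis (2 * pi * (real j / real L) * of_int (m - n)))"
    unfolding of_real_sum complex_norm_square cnj_sum sum_product
  proof (intro sum.cong refl)
    fix j n m
    show "(of_real (a n) * e j n) * cnj (of_real (a m) * e j m) =
      of_real (a n * a m) * cis (2 * pi * (real j / real L) * of_int (m - n))"
      unfolding e[symmetric] by simp
  qed
  also have "\<dots> = (\<Sum>n\<in>R. \<Sum>m\<in>R. of_real (a n * a m) * (\<Sum>j<L. cis (2 * pi * (real j / real L) * of_int (m - n))))"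
    by (subst sum.swap, rule sum.cong[OF refl], subst sum.swap) (simp add: sum_distrib_left)
  also have "\<dots> = (\<Sum>n\<in>R. \<Sum>m\<in>R. if m = n then of_real (real L * (a n)\<^sup>2) else 0)"
  proof (intro sum.cong refl)
    fix n m assume "n \<in> R" "m \<in> R"
    then have "int L dvd m - n \<longleftrightarrow> m = n"
      using dvd_imp_le_int[of "m - n" "int L"] by (force simp: R_def)
    then show "of_real (a n * a m) * (\<Sum>j<L. cis (2 * pi * (real j / real L) * of_int (m - n)))
      = (if m = n then complex_of_real (real L * (a n)\<^sup>2) else 0)"
      by (simp only: cis_grid_sum[OF assms]) (simp add: power2_eq_square)
  qed
  also have "\<dots> = complex_of_real (real L * (\<Sum>n\<in>R. (a n)\<^sup>2))"
    using fin by (simp add: sum_distrib_left)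
  finally show ?thesis unfolding R_def e_def by (simp only: of_real_eq_iff)
qed

text \<open>The squared modulus of the frequency response of the filter. It is the scalar by which
  filtering multiplies the covariance of the noise at frequency \<theta>.\<close>

definition gain :: "nat \<Rightarrow> (nat \<Rightarrow> real) \<Rightarrow> real \<Rightarrow> real" where
  "gain K h \<theta> = (cmod (\<Sum>m<K. of_real (h m) * cis (- (2 * pi * \<theta> * real m))))\<^sup>2"

text \<open>Parseval on a grid at least as long as the filter. The mean of the gain over the grid
  takes the place of its integral over all frequencies.\<close>

lemma gain_grid_sum:
  assumes "0 < L" "K \<le> L"
  shows "(\<Sum>j<L. gain K h (real j / real L)) = real L * (\<Sum>m<K. (h m)\<^sup>2)"
proof -
  have sub: "(\<Sum>m<K. f m) = (\<Sum>n\<in>{0..<0 + int L}. if n < int K then f (nat n) else 0)" for f :: "nat \<Rightarrow> 'b::comm_monoid_add"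
  proof -
    have "(\<Sum>m<K. f m) = (\<Sum>n\<in>{0..<int K}. f (nat n))"
      by (rule sum.reindex_bij_witness[where i = nat and j = int]) auto
    also have "\<dots> = (\<Sum>n\<in>{0..<0 + int L}. if n < int K then f (nat n) else 0)"
      using assms by (intro sum.mono_neutral_cong_left) auto
    finally show ?thesis .
  qed
  have "gain K h \<theta> = (cmod (\<Sum>n\<in>{0..<0 + int L}. of_real (zero_ext K h n) * cis (- (2 * pi * \<theta> * of_int n))))\<^sup>2" for \<theta>
    unfolding gain_def sub by (intro arg_cong[where f="\<lambda>z. (cmod z)\<^sup>2"] sum.cong) (auto simp: zero_ext_def)
  then show ?thesis
    unfolding sub by (simp only: parseval_grid[OF assms(1)])
      (auto simp: zero_ext_def intro!: arg_cong2[where f="(*)"] sum.cong)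
qed

text \<open>A convolution has norm at most the supremum of its symbol. For finitely supported data
  this follows from the discrete Fourier transform on a sufficiently long period, where convolution
  becomes multiplication by the frequency response.\<close>

lemma filter_l2_bound:
  fixes v :: "int \<Rightarrow> real"
  assumes "finite W" "finite R" and gain: "\<And>\<theta>. 0 \<le> \<theta> \<Longrightarrow> \<theta> < 1 \<Longrightarrow> gain K h \<theta> \<le> g"
  shows "(\<Sum>n\<in>R. (\<Sum>k\<in>W. zero_ext K h (n - k) * v k)\<^sup>2) \<le> g * (\<Sum>k\<in>W. (v k)\<^sup>2)"
proof -
  define v' where "v' k = (if k \<in> W then v k else 0)" for k
  define y where "y n = (\<Sum>k\<in>W. zero_ext K h (n - k) * v k)" for n
  obtain B where B: "\<And>n. n \<in> W \<union> R \<Longrightarrow> \<bar>n\<bar> \<le> B" "B \<ge> 0"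
  proof
    show "\<bar>n\<bar> \<le> (\<Sum>n\<in>W \<union> R. \<bar>n\<bar>)" if "n \<in> W \<union> R" for n
      using assms that by (intro member_le_sum) auto
    show "0 \<le> (\<Sum>n\<in>W \<union> R. \<bar>n\<bar>)" by (intro sum_nonneg) auto
  qed
  \<comment> \<open>The period covers {-\<open>B\<close>..\<open>B\<close> + \<open>K\<close>}: it
    contains \<open>W\<close>, \<open>R\<close> and every shift of \<open>W\<close> by less than
    \<open>K\<close>, so nothing wraps around.\<close>
  define l where "l = - B"
  define L where "L = nat (2 * B + int K + 1)"
  define S where "S = {l..<l + int L}"
  have L: "L > 0" and S: "S = {- B..B + int K}" using B by (auto simp: L_def S_def l_def)
  have finS: "finite S" and WS: "W \<subseteq> S" and RS: "R \<subseteq> S" using B by (force simp: S)+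
  have y: "y n = (\<Sum>m<K. h m * v' (n - int m))" for n
  proof -
    have "(\<Sum>m<K. h m * v' (n - int m)) = (\<Sum>k\<in>W \<union> {n - int K<..n}. zero_ext K h (n - k) * v' k)"
      using sum_filter_window[of "W \<union> {n - int K<..n}" n K h v'] assms(1) by simp
    also have "\<dots> = y n"
      unfolding y_def using assms(1) by (intro sum.mono_neutral_cong_right) (auto simp: v'_def)
    finally show ?thesis by simp
  qed
  define e where "e \<theta> n = cis (- (2 * pi * \<theta> * of_int n))" for \<theta> :: real and n :: int
  have e: "e \<theta> n = e \<theta> (int m) * e \<theta> (n - int m)" for \<theta> n m
    by (simp add: e_def cis_mult algebra_simps)
  have conv: "(\<Sum>n\<in>S. of_real (y n) * e \<theta> n) = (\<Sum>m<K. of_real (h m) * e \<theta> (int m)) * (\<Sum>n\<in>S. of_real (v' n) * e \<theta> n)" for \<theta>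
  proof -
    have shift: "(\<Sum>n\<in>S. of_real (v' (n - int m)) * e \<theta> (n - int m)) = (\<Sum>n\<in>S. of_real (v' n) * e \<theta> n)" if "m < K" for m
    proof -
      have "(\<Sum>n\<in>S. of_real (v' (n - int m)) * e \<theta> (n - int m)) = (\<Sum>n\<in>(\<lambda>k. k + int m) ` W. of_real (v' (n - int m)) * e \<theta> (n - int m))"
        using finS B that by (intro sum.mono_neutral_right) (force simp: v'_def S)+
      also have "\<dots> = (\<Sum>n\<in>W. of_real (v' n) * e \<theta> n)"
        by (subst sum.reindex) (auto simp: inj_on_def)
      also have "\<dots> = (\<Sum>n\<in>S. of_real (v' n) * e \<theta> n)"
        using finS WS by (intro sum.mono_neutral_left) (auto simp: v'_def)
      finally show ?thesis .
    qed
    have "(\<Sum>n\<in>S. of_real (y n) * e \<theta> n) = (\<Sum>n\<in>S. \<Sum>m<K. (of_real (h m) * e \<theta> (int m)) * (of_real (v' (n - int m)) * e \<theta> (n - int m)))"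
      unfolding y of_real_sum sum_distrib_right
    proof (intro sum.cong refl)
      fix n m
      show "complex_of_real (h m * v' (n - int m)) * e \<theta> n
        = of_real (h m) * e \<theta> (int m) * (of_real (v' (n - int m)) * e \<theta> (n - int m))"
        unfolding e[of \<theta> n m] by simp
    qed
    also have "\<dots> = (\<Sum>m<K. (of_real (h m) * e \<theta> (int m)) * (\<Sum>n\<in>S. of_real (v' (n - int m)) * e \<theta> (n - int m)))"
      by (subst sum.swap) (simp add: sum_distrib_left)
    finally show ?thesis using shift by (simp add: sum_distrib_right)
  qed
  have "real L * (\<Sum>n\<in>S. (y n)\<^sup>2) = (\<Sum>j<L. (cmod (\<Sum>n\<in>S. of_real (y n) * e (real j / real L) n))\<^sup>2)"
    unfolding e_def S_def by (rule parseval_grid[OF L, symmetric])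
  also have "\<dots> = (\<Sum>j<L. gain K h (real j / real L) * (cmod (\<Sum>n\<in>S. of_real (v' n) * e (real j / real L) n))\<^sup>2)"
    unfolding conv by (simp add: norm_mult power_mult_distrib gain_def e_def)
  also have "\<dots> \<le> (\<Sum>j<L. g * (cmod (\<Sum>n\<in>S. of_real (v' n) * e (real j / real L) n))\<^sup>2)"
    using L by (intro sum_mono mult_right_mono gain) auto
  also have "\<dots> = g * (real L * (\<Sum>n\<in>S. (v' n)\<^sup>2))"
    unfolding e_def S_def by (simp only: sum_distrib_left[symmetric] parseval_grid[OF L])
  finally have "(\<Sum>n\<in>S. (y n)\<^sup>2) \<le> g * (\<Sum>n\<in>S. (v' n)\<^sup>2)"
    using L by (simp add: mult_ac)
  moreover have "(\<Sum>n\<in>R. (y n)\<^sup>2) \<le> (\<Sum>n\<in>S. (y n)\<^sup>2)"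
    using finS RS by (intro sum_mono2) auto
  moreover have "(\<Sum>n\<in>S. (v' n)\<^sup>2) = (\<Sum>k\<in>W. (v k)\<^sup>2)"
    using finS WS by (intro sum.mono_neutral_cong_right) (auto simp: v'_def)
  ultimately show ?thesis by (simp add: y_def)
qed

text \<open>Half the multiplicity of an observation in the enlarged sequence: the reflection repeats
  the times 2 to N, whereas 1 and N + 1 are its fixed points.\<close>

definition end_weight :: "nat \<Rightarrow> int \<Rightarrow> real" where
  "end_weight N n = (if n = 1 \<or> n = int N + 1 then 1 / 2 else 1)"

lemma sum_end_weight:
  assumes "N \<ge> 1"
  shows "(\<Sum>n = 1..int N + 1. end_weight N n) = real N"
proof -
  have "(\<Sum>n = 1..int N + 1. end_weight N n) = (\<Sum>n\<in>{1..int N + 1}. 1 - (if n \<in> {1, int N + 1} then 1 / 2 else 0))"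
    by (intro sum.cong) (auto simp: end_weight_def)
  also have "\<dots> = real N + 1 - (\<Sum>n\<in>{1..int N + 1}. if n \<in> {1, int N + 1} then 1 / 2 else 0)"
    by (subst sum_subtractf) simp
  also have "(\<Sum>n\<in>{1..int N + 1}. if n \<in> {1, int N + 1} then 1 / 2 else 0) = (\<Sum>n\<in>{1, int N + 1}. 1 / 2 :: real)"
    by (intro sum.mono_neutral_cong_right) auto
  also have "\<dots> = 1" using assms by simp
  finally show ?thesis by simp
qed

text \<open>The enlarged observations are symmetric under \<open>n - 1 \<mapsto> 2 N - (n - 1)\<close>, so the bilinear
  (not sesquilinear) DFT pairing returns the ordinary empirical correlation.\<close>

lemma Z_stat_eq:
  assumes "N \<ge> 1"
  shows "Z_stat N y r s = of_real (2 * (\<Sum>n = 1..int N + 1. end_weight N n * y n $ r * y n $ s))"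
proof -
  define L where "L = 2 * N"
  have L: "L > 0" "2 * int N = int L" "2 * real N = real L" using assms by (auto simp: L_def)
  define u where "u n = enlarged N y n $ r" for n
  define v where "v n = enlarged N y n $ s" for n
  define e where "e j n = cis (2 * pi * (real j / real L) * of_int n)" for j :: nat and n :: int
  have dft: "dft N y f $ q = of_real (1 / sqrt (real L)) * (\<Sum>n = 1..int L. of_real (enlarged N y n $ q) * e (nat (f - 1)) (1 - n))" if "f \<ge> 1" for f q
  proof -
    have "exp (- \<i> * complex_of_real (2 * pi * (of_int (f - 1) * of_int (n - 1)) / (2 * real N))) = e (nat (f - 1)) (1 - n)" for n
    proof -
      have "2 * pi * (real (nat (f - 1)) / real L) * of_int (1 - n) = - (2 * pi * (of_int (f - 1) * of_int (n - 1)) / (2 * real N))"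
        using that L by (simp add: algebra_simps add_divide_distrib diff_divide_distrib)
      then show ?thesis unfolding e_def by (simp only: cis_conv_exp of_real_minus mult_minus_left mult_minus_right)
    qed
    then show ?thesis by (simp add: dft_def L)
  qed
  have "Z_stat N y r s = (\<Sum>f = 1..int L. (of_real (1 / sqrt (real L)) * (\<Sum>n = 1..int L. of_real (u n) * e (nat (f - 1)) (1 - n))) *
      (of_real (1 / sqrt (real L)) * (\<Sum>n = 1..int L. of_real (v n) * e (nat (f - 1)) (1 - n))))"
    unfolding Z_stat_def L u_def v_def by (intro sum.cong) (auto simp: dft)
  also have "\<dots> = (\<Sum>j<L. (of_real (1 / sqrt (real L)) * (\<Sum>n = 1..int L. of_real (u n) * e j (1 - n))) *
      (of_real (1 / sqrt (real L)) * (\<Sum>n = 1..int L. of_real (v n) * e j (1 - n))))"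
    by (rule sum.reindex_bij_witness[where i = "\<lambda>j. int j + 1" and j = "\<lambda>f. nat (f - 1)"]) auto
  also have "\<dots> = (\<Sum>j<L. of_real (1 / real L) * (\<Sum>n = 1..int L. \<Sum>m = 1..int L. of_real (u n * v m) * e j (2 - n - m)))"
  proof (rule sum.cong[OF refl])
    fix j
    have "complex_of_real (1 / sqrt (real L)) * of_real (1 / sqrt (real L)) = of_real (1 / real L)"
      by (simp flip: of_real_mult)
    moreover have "e j (1 - n) * e j (1 - m) = e j (2 - n - m)" for n m
      by (simp add: e_def cis_mult algebra_simps diff_divide_distrib add_divide_distrib)
    then have "(\<Sum>n = 1..int L. of_real (u n) * e j (1 - n)) * (\<Sum>n = 1..int L. of_real (v n) * e j (1 - n))
      = (\<Sum>n = 1..int L. \<Sum>m = 1..int L. of_real (u n * v m) * e j (2 - n - m))"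
      unfolding sum_product by (intro sum.cong refl) (metis (no_types, lifting) mult.assoc mult.left_commute of_real_mult)
    moreover have "(c * A) * (c * B) = (c * c) * (A * B)" for c A B :: complex by simp
    ultimately show "(of_real (1 / sqrt (real L)) * (\<Sum>n = 1..int L. of_real (u n) * e j (1 - n))) *
      (of_real (1 / sqrt (real L)) * (\<Sum>n = 1..int L. of_real (v n) * e j (1 - n)))
      = of_real (1 / real L) * (\<Sum>n = 1..int L. \<Sum>m = 1..int L. of_real (u n * v m) * e j (2 - n - m))"
      by metis
  qed
  also have "\<dots> = of_real (1 / real L) * (\<Sum>n = 1..int L. \<Sum>m = 1..int L. of_real (u n * v m) * (\<Sum>j<L. e j (2 - n - m)))"
    unfolding sum_distrib_left[symmetric]
    by (subst sum.swap, rule arg_cong[where f="(*) _"], rule sum.cong[OF refl], subst sum.swap) (simp add: sum_distrib_left)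
  also have "\<dots> = of_real (1 / real L) * (\<Sum>n = 1..int L. of_real (u n * v n) * of_nat L)"
  proof (intro arg_cong[where f="(*) _"] sum.cong refl)
    fix n assume n: "n \<in> {1..int L}"
    \<comment> \<open>Orthogonality selects the index congruent to 2 - \<open>n\<close> modulo
      \<open>L\<close>. For \<open>n = 1\<close> the general formula would give \<open>L\<close> +
      1, just outside the range, and the partner is 1 itself.\<close>
    define m0 where "m0 = (if n = 1 then 1 else int L + 2 - n)"
    have dvd: "int L dvd 2 - n - m \<longleftrightarrow> m = m0" if "m \<in> {1..int L}" for m
    proof
      assume "int L dvd 2 - n - m"
      then obtain k where k: "2 - n - m = int L * k" by auto
      have "int L * (-2) < int L * k" "int L * k < int L * 1"
        unfolding k[symmetric] using n that L by auto
      then have "- 2 < k" "k < 1" using L by (simp_all only: mult_less_cancel_left_pos of_nat_0_less_iff)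
      then have "k = 0 \<or> k = -1" by auto
      then show "m = m0" using k n that by (auto simp: m0_def)
    next
      assume "m = m0" then show "int L dvd 2 - n - m" by (auto simp: m0_def)
    qed
    have "(\<Sum>m = 1..int L. of_real (u n * v m) * (\<Sum>j<L. e j (2 - n - m))) = (\<Sum>m = 1..int L. if m = m0 then of_real (u n * v m) * of_nat L else 0)"
      unfolding e_def cis_grid_sum[OF L(1)] using dvd by (intro sum.cong) auto
    also have "\<dots> = of_real (u n * v m0) * of_nat L"
      using n by (simp add: m0_def)
    also have "v m0 = v n"
    proof -
      have iL: "int L = 2 * int N" by (simp add: L_def)
      consider "n = 1" | "1 < n" "n \<le> int N" | "n = int N + 1" | "int N + 1 < n" "n \<le> 2 * int N"
        using n iL by fastforce
      then show ?thesis
        by cases (auto simp: v_def m0_def enlarged_def iL algebra_simps)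
    qed
    finally show "(\<Sum>m = 1..int L. of_real (u n * v m) * (\<Sum>j<L. e j (2 - n - m))) = of_real (u n * v n) * of_nat L" .
  qed
  also have "\<dots> = of_real (\<Sum>n = 1..int L. u n * v n)"
    using L by (simp add: sum_distrib_right[symmetric])
  also have "(\<Sum>n = 1..int L. u n * v n) = 2 * (\<Sum>n = 1..int N + 1. end_weight N n * y n $ r * y n $ s)"
  proof -
    define q where "q n = y n $ r * y n $ s" for n
    have "(\<Sum>n = 1..int L. u n * v n) = (\<Sum>n\<in>{1..int N + 1} \<union> {int N + 2..int L}. u n * v n)"
      using assms L by (intro sum.cong) auto
    also have "\<dots> = (\<Sum>n = 1..int N + 1. u n * v n) + (\<Sum>n = int N + 2..int L. u n * v n)"
      by (intro sum.union_disjoint) auto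
    also have "(\<Sum>n = 1..int N + 1. u n * v n) = (\<Sum>n = 1..int N + 1. q n)"
      by (intro sum.cong) (auto simp: u_def v_def q_def enlarged_def)
    also have "(\<Sum>n = int N + 2..int L. u n * v n) = (\<Sum>n = 2..int N. q n)"
      by (rule sum.reindex_bij_witness[where i = "\<lambda>n. int L + 2 - n" and j = "\<lambda>n. int L + 2 - n"])
        (auto simp: u_def v_def q_def enlarged_def L_def algebra_simps)
    also have "(\<Sum>n = 2..int N. q n) = (\<Sum>n = 1..int N + 1. (if n = 1 \<or> n = int N + 1 then 0 else q n))"
      by (intro sum.mono_neutral_cong_left) auto
    also have "(\<Sum>n = 1..int N + 1. q n) + \<dots> = 2 * (\<Sum>n = 1..int N + 1. end_weight N n * q n)"
      unfolding sum_distrib_left sum.distrib[symmetric] by (intro sum.cong) (auto simp: end_weight_def)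
    finally show ?thesis by (simp add: q_def mult.assoc)
  qed
  finally show ?thesis .
qed

section \<open>Spectral density and precision matrix\<close>

definition complexify :: "real^'n^'m \<Rightarrow> complex^'n^'m" where
  "complexify A = (\<chi> r s. complex_of_real (A $ r $ s))"

lemma complexify_component [simp]: "complexify A $ r $ s = complex_of_real (A $ r $ s)"
  by (simp add: complexify_def)

lemma complexify_mult: "complexify (A ** B) = complexify A ** complexify B"
  by (simp add: vec_eq_iff matrix_matrix_mult_def)

lemma complexify_mat_1: "complexify (mat 1) = mat 1"
  by (simp add: vec_eq_iff mat_def)

lemma scaleR_matrix_mult:
  fixes A :: "real^'n^'m" and B :: "real^'k^'n"
  shows "(a *\<^sub>R A) ** (b *\<^sub>R B) = (a * b) *\<^sub>R (A ** B)"
  by (simp add: vec_eq_iff matrix_matrix_mult_def sum_distrib_left mult_ac)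

text \<open>For a real matrix and a real eigenvalue, the real and the imaginary part of a complex
  eigenvector satisfy the same equation, and one of them is nonzero.\<close>

lemma real_eigenvalues_complexify:
  fixes A :: "real^'n^'n"
  shows "real_eigenvalues (complexify A) = {l. \<exists>v. v \<noteq> 0 \<and> A *v v = l *\<^sub>R v}"
proof (intro equalityI subsetI)
  fix l assume "l \<in> real_eigenvalues (complexify A)"
  then obtain v where v: "v \<noteq> 0" and ev: "complexify A *v v = complex_of_real l *s v"
    by (auto simp: real_eigenvalues_def)
  define a where "a = (\<chi> i. Re (v $ i))"
  define b where "b = (\<chi> i. Im (v $ i))"
  have *: "(\<Sum>j\<in>UNIV. complex_of_real (A $ i $ j) * v $ j) = complex_of_real l * v $ i" for i
    using ev by (simp add: vec_eq_iff matrix_vector_mult_def)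
  have "A *v a = l *\<^sub>R a"
    using arg_cong[OF *, of Re] by (simp add: vec_eq_iff matrix_vector_mult_def a_def)
  moreover have "A *v b = l *\<^sub>R b"
    using arg_cong[OF *, of Im] by (simp add: vec_eq_iff matrix_vector_mult_def b_def)
  moreover have "a \<noteq> 0 \<or> b \<noteq> 0"
    using v by (auto simp: vec_eq_iff a_def b_def complex_eq_iff)
  ultimately show "l \<in> {l. \<exists>v. v \<noteq> 0 \<and> A *v v = l *\<^sub>R v}" by blast
next
  fix l assume "l \<in> {l. \<exists>v. v \<noteq> 0 \<and> A *v v = l *\<^sub>R v}"
  then obtain v where v: "v \<noteq> 0" "A *v v = l *\<^sub>R v" by auto
  define u where "u = (\<chi> i. complex_of_real (v $ i))"
  have "u \<noteq> 0" using v by (auto simp: vec_eq_iff u_def)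
  moreover have "complexify A *v u = complex_of_real l *s u"
    using v(2) by (simp add: vec_eq_iff matrix_vector_mult_def u_def flip: of_real_mult of_real_sum)
  ultimately show "l \<in> real_eigenvalues (complexify A)" by (auto simp: real_eigenvalues_def)
qed

text \<open>Eigenvectors of distinct eigenvalues are orthogonal, hence independent, hence finite in
  number. Finiteness gives \<open>Min\<close> and \<open>Max\<close> in \<open>lambda_min\<close>
  and \<open>lambda_max\<close> their meaning.\<close>

lemma finite_eigenvalues_symmetric:
  fixes A :: "real^'n^'n"
  assumes "transpose A = A"
  shows "finite {l. \<exists>v. v \<noteq> 0 \<and> A *v v = l *\<^sub>R v}" (is "finite ?E")
proof -
  define f where "f l = (SOME v. v \<noteq> 0 \<and> A *v v = l *\<^sub>R v)" for l
  have f: "f l \<noteq> 0" "A *v f l = l *\<^sub>R f l" if "l \<in> ?E" for l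
    using someI_ex[of "\<lambda>v. v \<noteq> 0 \<and> A *v v = l *\<^sub>R v"] that by (auto simp: f_def)
  have orth: "f l \<bullet> f m = 0" if "l \<in> ?E" "m \<in> ?E" "l \<noteq> m" for l m
  proof -
    have "m * (f l \<bullet> f m) = l * (f l \<bullet> f m)"
      using symmetric_inner[OF assms, of "f l" "f m"] f(2)[OF that(1)] f(2)[OF that(2)]
      by (simp add: inner_commute)
    then show ?thesis using that(3) by simp
  qed
  have inj: "inj_on f ?E"
  proof (rule inj_onI, rule ccontr)
    fix l m assume "l \<in> ?E" "m \<in> ?E" "f l = f m" "l \<noteq> m"
    then show False using orth[of l m] f(1)[of m] by simp
  qed
  have "independent (f ` ?E)"
  proof (rule pairwise_orthogonal_independent)
    show "pairwise orthogonal (f ` ?E)"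
      by (auto simp: pairwise_def orthogonal_def intro!: orth)
    show "0 \<notin> f ` ?E" using f(1) by force
  qed
  then have "finite (f ` ?E)" by (rule finiteI_independent)
  then show ?thesis using inj by (rule finite_imageD)
qed

text \<open>A maximizer of the quadratic form on the unit sphere is an eigenvector, by the
  first-order condition at the maximum.\<close>

lemma symmetric_max_eigenvalue:
  fixes A :: "real^'n^'n"
  assumes "transpose A = A"
  obtains l v where "v \<noteq> 0" "A *v v = l *\<^sub>R v" "\<And>u. u \<bullet> (A *v u) \<le> l * (u \<bullet> u)"
proof -
  have "compact (sphere (0::real^'n) 1)" "sphere (0::real^'n) 1 \<noteq> {}"
    by (auto simp: sphere_eq_empty)
  moreover have "continuous_on (sphere 0 1) (\<lambda>u. u \<bullet> (A *v u))"
    by (intro continuous_intros linear_continuous_on linear_conv_bounded_linear[THEN iffD1] matrix_vector_mul_linear)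
  ultimately obtain v where v: "norm v = 1" and max: "\<And>u. norm u = 1 \<Longrightarrow> u \<bullet> (A *v u) \<le> v \<bullet> (A *v v)"
    using continuous_attains_sup[of "sphere (0::real^'n) 1" "\<lambda>u. u \<bullet> (A *v u)"] by auto
  define l where "l = v \<bullet> (A *v v)"
  have le: "u \<bullet> (A *v u) \<le> l * (u \<bullet> u)" for u
  proof (cases "u = 0")
    case False
    have "((1 / norm u) *\<^sub>R u) \<bullet> (A *v ((1 / norm u) *\<^sub>R u)) \<le> l"
      using max[of "(1 / norm u) *\<^sub>R u"] False by (simp add: l_def)
    then have "(u \<bullet> (A *v u)) / (norm u)\<^sup>2 \<le> l"
      by (simp add: matrix_vector_mult_scaleR power2_eq_square)
    then show ?thesis using False by (simp add: divide_le_eq power2_norm_eq_inner)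
  qed simp
  \<comment> \<open>The residual of the eigenvector equation serves as the direction of variation.
    The inequality \<open>expand\<close> for all \<open>t\<close> then forces its linear
    coefficient, twice the squared norm of \<open>d\<close>, to vanish.\<close>
  define d where "d = l *\<^sub>R v - A *v v"
  define D where "D = d \<bullet> d"
  define Q where "Q = l * (d \<bullet> d) - d \<bullet> (A *v d)"
  have vv: "v \<bullet> v = 1" using v by (simp add: dot_square_norm)
  have expand: "0 \<le> 2 * t * D + t\<^sup>2 * Q" for t
  proof -
    have "l * ((v + t *\<^sub>R d) \<bullet> (v + t *\<^sub>R d)) - (v + t *\<^sub>R d) \<bullet> (A *v (v + t *\<^sub>R d))
      = l * (v \<bullet> v) - v \<bullet> (A *v v) + 2 * t * (l * (v \<bullet> d) - d \<bullet> (A *v v)) + t\<^sup>2 * Q"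
      using symmetric_inner[OF assms, of v d]
      by (simp add: matrix_vector_right_distrib matrix_vector_mult_scaleR inner_add inner_commute Q_def
          power2_eq_square algebra_simps)
    moreover have "l * (v \<bullet> d) - d \<bullet> (A *v v) = D"
      by (simp add: D_def d_def inner_diff inner_commute algebra_simps)
    ultimately show ?thesis using le[of "v + t *\<^sub>R d"] vv by (simp add: l_def)
  qed
  have "Q \<ge> 0" using le[of d] by (simp add: Q_def)
  have "D = 0"
  proof (cases "Q = 0")
    case True
    then have "D \<le> 0" using expand[of "-1"] by simp
    then show ?thesis using inner_ge_zero[of d] unfolding D_def by linarith
  next
    case False
    have "2 * (- D / Q) * D + (- D / Q)\<^sup>2 * Q = - D\<^sup>2 / Q"
      using False by (simp add: field_simps power2_eq_square)
    then have "D\<^sup>2 / Q \<le> 0" using expand[of "- D / Q"] by simp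
    then show ?thesis using False \<open>Q \<ge> 0\<close> by (simp add: divide_le_0_iff)
  qed
  then have "A *v v = l *\<^sub>R v" by (simp add: D_def d_def)
  moreover have "v \<noteq> 0" using v by auto
  ultimately show thesis using le that by blast
qed

text \<open>The maximum of the Rayleigh quotient is an eigenvalue, hence at most the largest one.
  The lower bound is the same argument for -\<open>A\<close>.\<close>

lemma lambda_bounds_symmetric:
  fixes A :: "real^'n^'n"
  assumes "transpose A = A"
  shows "u \<bullet> (A *v u) \<le> lambda_max (complexify A) * (u \<bullet> u)"
    and "lambda_min (complexify A) * (u \<bullet> u) \<le> u \<bullet> (A *v u)"
proof -
  note fin = finite_eigenvalues_symmetric[OF assms]
  obtain l v where lv: "v \<noteq> 0" "A *v v = l *\<^sub>R v" and le: "\<And>u. u \<bullet> (A *v u) \<le> l * (u \<bullet> u)"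
    using symmetric_max_eigenvalue[OF assms] by metis
  have "l \<le> lambda_max (complexify A)"
    unfolding lambda_max_def real_eigenvalues_complexify using fin lv by (intro Max_ge) auto
  then show "u \<bullet> (A *v u) \<le> lambda_max (complexify A) * (u \<bullet> u)"
    using le[of u] mult_right_mono[of l _ "u \<bullet> u"] by (meson inner_ge_zero order_trans)
  have "transpose (- A) = - A"
    using assms by (simp add: transpose_def vec_eq_iff)
  then obtain l' v' where lv': "v' \<noteq> 0" "(- A) *v v' = l' *\<^sub>R v'" and ge: "\<And>u. u \<bullet> ((- A) *v u) \<le> l' * (u \<bullet> u)"
    using symmetric_max_eigenvalue by metis
  have neg: "(- A) *v u = - (A *v u)" for u
    by (simp add: matrix_vector_mult_def vec_eq_iff sum_negf)
  have "A *v v' = (- l') *\<^sub>R v'" using lv'(2) by (simp add: neg) (metis minus_minus)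
  then have "lambda_min (complexify A) \<le> - l'"
    unfolding lambda_min_def real_eigenvalues_complexify using fin lv'(1) by (intro Min_le) auto
  then have "lambda_min (complexify A) * (u \<bullet> u) \<le> - l' * (u \<bullet> u)"
    by (intro mult_right_mono) auto
  then show "lambda_min (complexify A) * (u \<bullet> u) \<le> u \<bullet> (A *v u)"
    using ge[of u] by (simp add: neg)
qed

lemma pos_def_quadratic_pair:
  fixes C :: "real^'n^'n"
  assumes "pos_def C"
  shows "r \<noteq> s \<Longrightarrow> (\<alpha>, \<beta>) \<noteq> (0, 0) \<Longrightarrow> 0 < \<alpha>\<^sup>2 * C $ r $ r + 2 * \<alpha> * \<beta> * C $ r $ s + \<beta>\<^sup>2 * C $ s $ s"
    and "0 < C $ r $ r" and "r \<noteq> s \<Longrightarrow> (C $ r $ s)\<^sup>2 < C $ r $ r * C $ s $ s"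
proof -
  have C: "transpose C = C" "\<And>v. v \<noteq> 0 \<Longrightarrow> 0 < v \<bullet> (C *v v)"
    using assms by (auto simp: pos_def_def)
  note sym = symmetric_component[OF C(1)]
  show diag: "0 < C $ r $ r" for r
    using C(2)[of "axis r 1"] by (simp add: axis_bilinear)
  have pair: "0 < \<alpha>\<^sup>2 * C $ r $ r + 2 * \<alpha> * \<beta> * C $ r $ s + \<beta>\<^sup>2 * C $ s $ s" if "r \<noteq> s" "(\<alpha>, \<beta>) \<noteq> (0, 0)" for \<alpha> \<beta> r s
  proof -
    have "(\<alpha> *\<^sub>R axis r 1 + \<beta> *\<^sub>R axis s 1 :: real^'n) $ r = \<alpha>" "(\<alpha> *\<^sub>R axis r 1 + \<beta> *\<^sub>R axis s 1 :: real^'n) $ s = \<beta>"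
      using that(1) by (auto simp: axis_def)
    then have "\<alpha> *\<^sub>R axis r 1 + \<beta> *\<^sub>R axis s 1 \<noteq> (0 :: real^'n)"
      using that(2) by (metis zero_index)
    from C(2)[OF this] show ?thesis
      unfolding matrix_vector_right_distrib matrix_vector_mult_scaleR inner_add_left inner_add_right
        inner_scaleR_left inner_scaleR_right axis_bilinear sym[of s r]
      by (simp add: power2_eq_square algebra_simps)
  qed
  show "r \<noteq> s \<Longrightarrow> (\<alpha>, \<beta>) \<noteq> (0, 0) \<Longrightarrow> 0 < \<alpha>\<^sup>2 * C $ r $ r + 2 * \<alpha> * \<beta> * C $ r $ s + \<beta>\<^sup>2 * C $ s $ s"
    by (rule pair)
  show "(C $ r $ s)\<^sup>2 < C $ r $ r * C $ s $ s" if "r \<noteq> s"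
  proof -
    \<comment> \<open>The coefficients (C_ss, -C_rs) turn the form into C_ss times the determinant
      of the 2x2 minor.\<close>
    have "0 < (C $ s $ s)\<^sup>2 * C $ r $ r + 2 * C $ s $ s * (- C $ r $ s) * C $ r $ s + (- C $ r $ s)\<^sup>2 * C $ s $ s"
      using diag[of s] by (intro pair[OF that]) auto
    also have "\<dots> = C $ s $ s * (C $ r $ r * C $ s $ s - (C $ r $ s)\<^sup>2)"
      by (simp add: power2_eq_square algebra_simps)
    finally show ?thesis using diag[of s] by (simp add: zero_less_mult_iff)
  qed
qed

text \<open>By symmetry the nonzero off-diagonal entries of the precision matrix form a matching, so
  this matrix and its inverse split into blocks of size at most two. Inverting such a block swaps
  its diagonal entries, negates the off-diagonal one and divides by the determinant; the normalized
  square of the off-diagonal entry is unchanged.\<close>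

lemma sparse_precision_blocks:
  fixes C :: "real^'n^'n"
  assumes pd: "pos_def C" and sparse: "\<And>r. card {s. s \<noteq> r \<and> matrix_inv C $ r $ s \<noteq> 0} \<le> 1"
    and rs: "r \<noteq> s"
  defines "T \<equiv> matrix_inv C"
  shows "T $ r $ s = 0 \<Longrightarrow> C $ r $ s = 0"
    and "T $ r $ s \<noteq> 0 \<Longrightarrow> C $ r $ s \<noteq> 0"
    and "T $ r $ s \<noteq> 0 \<Longrightarrow> (T $ r $ s)\<^sup>2 / (T $ r $ r * T $ s $ s) = (C $ r $ s)\<^sup>2 / (C $ r $ r * C $ s $ s)"
    and "T $ r $ s \<noteq> 0 \<Longrightarrow> i \<notin> {r, s} \<Longrightarrow> T $ r $ i = 0 \<and> T $ s $ i = 0"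
proof -
  note inv = matrix_inv_pos_def[OF pd, folded T_def]
  note C = pos_def_quadratic_pair[OF pd] and T = pos_def_quadratic_pair[OF inv(4)]
  have Tsym: "T $ r $ s = T $ s $ r" for r s
    using inv(3) by (rule symmetric_component)
  have Csym: "C $ r $ s = C $ s $ r" for r s
    using pd by (intro symmetric_component) (simp add: pos_def_def)
  have partner: "t = t'" if "t \<noteq> r" "T $ r $ t \<noteq> 0" "t' \<noteq> r" "T $ r $ t' \<noteq> 0" for r t t'
  proof (rule ccontr)
    assume "t \<noteq> t'"
    then have "card {t, t'} \<le> card {s. s \<noteq> r \<and> T $ r $ s \<noteq> 0}"
      using that by (intro card_mono) auto
    then show False using sparse[of r] \<open>t \<noteq> t'\<close> by (simp add: T_def)
  qed
  have row: "(\<Sum>k\<in>UNIV. T $ i $ k * C $ k $ j) = (if i = j then 1 else 0)" for i j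
    using inv(2) by (simp add: vec_eq_iff matrix_matrix_mult_def mat_def)
  have iso: "T $ i $ i * C $ i $ j = (if i = j then 1 else 0)" if "\<And>t. t \<noteq> i \<Longrightarrow> T $ i $ t = 0" for i j
  proof -
    have "(\<Sum>k\<in>UNIV. T $ i $ k * C $ k $ j) = (\<Sum>k\<in>{i}. T $ i $ k * C $ k $ j)"
      using that by (intro sum.mono_neutral_right) auto
    then show ?thesis using row[of i j] by simp
  qed
  have two: "T $ i $ i * C $ i $ j + T $ i $ t * C $ t $ j = (if i = j then 1 else 0)" if "t \<noteq> i" "T $ i $ t \<noteq> 0" for i t j
  proof -
    have "(\<Sum>k\<in>UNIV. T $ i $ k * C $ k $ j) = (\<Sum>k\<in>{i, t}. T $ i $ k * C $ k $ j)"
      using partner[OF that] by (intro sum.mono_neutral_right) auto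
    then show ?thesis using row[of i j] that by simp
  qed
  show "C $ r $ s = 0" if "T $ r $ s = 0"
  proof (cases "\<exists>t. t \<noteq> r \<and> T $ r $ t \<noteq> 0")
    case False
    then show ?thesis using iso[of r s] rs T(2)[of r] by auto
  next
    case True
    then obtain t where t: "t \<noteq> r" "T $ r $ t \<noteq> 0" by auto
    have "t \<noteq> s" using that t by auto
    have e1: "T $ r $ r * C $ r $ s + T $ r $ t * C $ t $ s = 0"
      using two[OF t] rs by simp
    have e2: "T $ t $ t * C $ t $ s + T $ t $ r * C $ r $ s = 0"
      using two[of r t s] t Tsym[of r t] \<open>t \<noteq> s\<close> by simp
    \<comment> \<open>Here \<open>r\<close> is matched with some \<open>t\<close> other than
      \<open>s\<close>. Eliminating C_ts from \<open>e1\<close> and \<open>e2\<close> leaves C_rs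
      times the positive determinant of the block of \<open>r\<close> and \<open>t\<close>.\<close>
    have "(T $ r $ r * T $ t $ t - (T $ r $ t)\<^sup>2) * C $ r $ s
       = T $ t $ t * (T $ r $ r * C $ r $ s + T $ r $ t * C $ t $ s) - T $ r $ t * (T $ t $ t * C $ t $ s + T $ t $ r * C $ r $ s)"
      unfolding Tsym[of t r] by (simp add: power2_eq_square algebra_simps)
    then show ?thesis using e1 e2 T(3)[of r t] t by auto
  qed
  assume nz: "T $ r $ s \<noteq> 0"
  have e1: "T $ r $ r * C $ r $ s + T $ r $ s * C $ s $ s = 0"
    using two[of s r s] nz rs by simp
  have e2: "T $ s $ s * C $ r $ s + T $ r $ s * C $ r $ r = 0"
    using two[of r s r] nz rs Tsym[of r s] Csym[of r s] by simp
  show "C $ r $ s \<noteq> 0"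
    using e1 nz C(2)[of s] by auto
  have "(T $ r $ s)\<^sup>2 * (C $ r $ r * C $ s $ s) = (T $ r $ s * C $ r $ r) * (T $ r $ s * C $ s $ s)"
    by (simp add: power2_eq_square)
  also have "\<dots> = (- (T $ s $ s * C $ r $ s)) * (- (T $ r $ r * C $ r $ s))"
  proof -
    have "T $ r $ s * C $ r $ r = - (T $ s $ s * C $ r $ s)" "T $ r $ s * C $ s $ s = - (T $ r $ r * C $ r $ s)"
      using e1 e2 by linarith+
    then show ?thesis by simp
  qed
  also have "\<dots> = (C $ r $ s)\<^sup>2 * (T $ r $ r * T $ s $ s)"
    by (simp add: power2_eq_square)
  finally show "(T $ r $ s)\<^sup>2 / (T $ r $ r * T $ s $ s) = (C $ r $ s)\<^sup>2 / (C $ r $ r * C $ s $ s)"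
    using C(2)[of r] C(2)[of s] T(2)[of r] T(2)[of s] by (simp add: frac_eq_eq)
  show "T $ r $ i = 0 \<and> T $ s $ i = 0" if "i \<notin> {r, s}"
  proof
    show "T $ r $ i = 0" using partner[of s r i] nz that rs by blast
    have "T $ s $ r \<noteq> 0" using nz by (simp only: Tsym[of s r] not_False_eq_True)
    then show "T $ s $ i = 0" using partner[of r s i] that rs by blast
  qed
qed

context filtered_noise
begin

text \<open>The autocovariance is \<open>C\<close> times the autocorrelation \<open>R\<close> of the
  filter, and the Fourier transform of \<open>R\<close> is the product of the frequency response and
  its conjugate.\<close>

lemma sdm_eq: "sdm M x \<theta> = complexify (gain K h \<theta> *\<^sub>R C)"
proof -
  \<comment> \<open>For lags outside \<open>S\<close> the noise windows at times \<open>m\<close>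
    and 0 are disjoint. For lags in \<open>S\<close>, \<open>W\<close> contains both
    windows.\<close>
  define W where "W = {- 2 * int K..int K}"
  define S where "S = {- int K..int K}"
  define e where "e n = cis (- (2 * pi * \<theta> * of_int n))" for n :: int
  have e: "e m = e k * e (m - k)" for m k
    by (simp add: e_def cis_mult algebra_simps)
  define R where "R m = (\<Sum>k\<in>W. hz (m - k) * hz (- k))" for m
  have acfS: "acf M x m $ r $ s = C $ r $ s * R m" if "m \<in> S" for m r s
    using x_moments(2)[of W m 0 r s] that by (simp add: acf_def R_def W_def S_def subset_eq)
  have acf0: "acf M x m $ r $ s = 0" if "m \<notin> S" for m r s
  proof -
    have "(\<Sum>k\<in>{m - int K<..m} \<union> {- int K<..0}. hz (m - k) * hz (0 - k)) = 0"
      using that by (intro sum.neutral) (auto simp: zero_ext_def S_def)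
    then show ?thesis
      using x_moments(2)[of "{m - int K<..m} \<union> {- int K<..0}" m 0 r s] by (simp add: acf_def)
  qed
  define H where "H = (\<Sum>j<K. of_real (h j) * e (int j))"
  have H: "(\<Sum>m\<in>S. of_real (hz (m - k)) * e (m - k)) = H" if "- int K < k" "k \<le> 0" for k
  proof -
    have "H = (\<Sum>m\<in>{k..<k + int K}. of_real (h (nat (m - k))) * e (m - k))"
      unfolding H_def
      by (rule sum.reindex_bij_witness[where j = "\<lambda>j. k + int j" and i = "\<lambda>m. nat (m - k)"]) auto
    also have "\<dots> = (\<Sum>m\<in>S. of_real (hz (m - k)) * e (m - k))"
      using that by (intro sum.mono_neutral_cong_left) (auto simp: S_def zero_ext_def)
    finally show ?thesis by simp
  qed
  have cnjH: "cnj H = (\<Sum>k\<in>W. of_real (hz (- k)) * e k)"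
  proof -
    have "cnj H = (\<Sum>j<K. of_real (h j) * e (- int j))"
      by (simp add: H_def e_def cis_cnj)
    also have "\<dots> = (\<Sum>k\<in>{- int K<..0}. of_real (h (nat (- k))) * e k)"
      by (rule sum.reindex_bij_witness[where j = "\<lambda>j. - int j" and i = "\<lambda>m. nat (- m)"]) auto
    also have "\<dots> = (\<Sum>k\<in>W. of_real (hz (- k)) * e k)"
      by (intro sum.mono_neutral_cong_left) (auto simp: W_def zero_ext_def)
    finally show ?thesis .
  qed
  have "(\<Sum>m\<in>S. of_real (R m) * e m) = (\<Sum>m\<in>S. \<Sum>k\<in>W. (of_real (hz (- k)) * e k) * (of_real (hz (m - k)) * e (m - k)))"
    unfolding R_def of_real_sum sum_distrib_right
  proof (intro sum.cong refl)
    fix m k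
    show "complex_of_real (hz (m - k) * hz (- k)) * e m = (of_real (hz (- k)) * e k) * (of_real (hz (m - k)) * e (m - k))"
      unfolding e[of m k] by simp
  qed
  also have "\<dots> = (\<Sum>k\<in>W. (of_real (hz (- k)) * e k) * (\<Sum>m\<in>S. of_real (hz (m - k)) * e (m - k)))"
    by (subst sum.swap) (simp add: sum_distrib_left)
  also have "\<dots> = (\<Sum>k\<in>W. (of_real (hz (- k)) * e k) * H)"
  proof (intro sum.cong refl)
    fix k
    show "(of_real (hz (- k)) * e k) * (\<Sum>m\<in>S. of_real (hz (m - k)) * e (m - k)) = (of_real (hz (- k)) * e k) * H"
      using H[of k] by (cases "- int K < k \<and> k \<le> 0") (auto simp: zero_ext_def)
  qed
  also have "\<dots> = cnj H * H" by (simp add: cnjH sum_distrib_right)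
  also have "\<dots> = of_real (gain K h \<theta>)"
    by (simp add: gain_def H_def e_def complex_norm_square mult.commute del: of_real_power)
  finally have spec: "(\<Sum>m\<in>S. of_real (R m) * e m) = of_real (gain K h \<theta>)" .
  have "sdm M x \<theta> $ r $ s = complexify (gain K h \<theta> *\<^sub>R C) $ r $ s" for r s
  proof -
    have "sdm M x \<theta> $ r $ s = (\<Sum>\<^sub>\<infinity>m\<in>UNIV. complex_of_real (acf M x m $ r $ s) * e m)"
      by (simp add: sdm_def e_def cis_conv_exp mult_ac)
    also have "\<dots> = (\<Sum>\<^sub>\<infinity>m\<in>S. complex_of_real (acf M x m $ r $ s) * e m)"
      by (intro infsum_cong_neutral) (auto simp: acf0)
    also have "\<dots> = (\<Sum>m\<in>S. of_real (C $ r $ s) * (of_real (R m) * e m))"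
      by (simp add: S_def) (simp add: acfS S_def mult_ac)
    also have "\<dots> = of_real (C $ r $ s) * of_real (gain K h \<theta>)"
      by (simp add: spec flip: sum_distrib_left)
    finally show ?thesis by simp
  qed
  then show ?thesis by (simp add: vec_eq_iff)
qed

end

section \<open>Consequences of the spectral bounds and of the coherence bound\<close>

locale filtered_class = filtered_noise M x w C h K
  for M :: "'a measure" and x w :: "int \<Rightarrow> 'a \<Rightarrow> real^'p" and C :: "real^'p^'p" and h :: "nat \<Rightarrow> real" and K :: nat +
  fixes B \<rho> :: real
  assumes cls: "process_class M 1 \<rho> B x" and sparse: "\<And>r. card {s. s \<noteq> r \<and> matrix_inv C $ r $ s \<noteq> 0} \<le> 1"
    and rho: "0 < \<rho>" and B: "1 \<le> B"
begin

lemma spectral_bounds: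
  assumes "0 \<le> \<theta>" "\<theta> < 1"
  shows "1 \<le> gain K h \<theta> * C $ r $ r" and "gain K h \<theta> * C $ r $ r \<le> B"
proof -
  have t: "transpose (gain K h \<theta> *\<^sub>R C) = gain K h \<theta> *\<^sub>R C"
    using pos_def_C by (simp add: pos_def_def transpose_scalar vec_eq_iff transpose_def C_sym)
  have e: "axis r 1 \<bullet> ((gain K h \<theta> *\<^sub>R C) *v axis r 1) = gain K h \<theta> * C $ r $ r"
    by (simp add: axis_bilinear)
  have "1 \<le> lambda_min (sdm M x \<theta>)" "lambda_max (sdm M x \<theta>) \<le> B"
    using cls assms by (auto simp: process_class_def)
  then show "1 \<le> gain K h \<theta> * C $ r $ r" "gain K h \<theta> * C $ r $ r \<le> B"
    using lambda_bounds_symmetric[OF t, of "axis r 1"] unfolding e sdm_eq by (auto simp: inner_axis)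
qed

text \<open>The spectral bounds at single frequencies are averaged over a grid on which the gain has
  mean 1, by the normalization of the filter. The length \<open>Suc K\<close> is positive and not
  shorter than the filter.\<close>

lemma C_diag_bounds: "1 \<le> C $ r $ r" "C $ r $ r \<le> B"
proof -
  define L where "L = Suc K"
  have L: "0 < L" "K \<le> L" by (auto simp: L_def)
  have avg: "(\<Sum>j<L. gain K h (real j / real L)) = real L"
    using gain_grid_sum[OF L] unit by simp
  have "(\<Sum>j<L. 1) \<le> (\<Sum>j<L. gain K h (real j / real L) * C $ r $ r)"
    by (intro sum_mono spectral_bounds(1)) auto
  then show "1 \<le> C $ r $ r" using L by (simp add: avg flip: sum_distrib_right)
  have "(\<Sum>j<L. gain K h (real j / real L) * C $ r $ r) \<le> (\<Sum>j<L. B)"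
    by (intro sum_mono spectral_bounds(2)) auto
  then show "C $ r $ r \<le> B" using L by (simp add: avg flip: sum_distrib_right)
qed

text \<open>The class bounds the spectrum on [0, 1), but the coherence integrates over the closed
  interval. The endpoint 1 is covered by periodicity.\<close>

lemma gain_pos:
  assumes "0 \<le> \<theta>" "\<theta> \<le> 1"
  shows "0 < gain K h \<theta>"
proof -
  have pos: "0 < gain K h \<theta>" if "0 \<le> \<theta>" "\<theta> < 1" for \<theta>
  proof -
    have "gain K h \<theta> \<noteq> 0" using spectral_bounds(1)[OF that] by auto
    then show ?thesis by (simp add: gain_def)
  qed
  have "cis (- (2 * pi * 1 * real m)) = 1" for m
    using cis_multiple_2pi[of "- real m"] by simp
  then have "gain K h 1 = gain K h 0" by (simp add: gain_def)
  then show ?thesis using pos[of 0] pos[of \<theta>] assms by (cases "\<theta> = 1") auto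
qed

text \<open>The inverse spectral density is \<open>T\<close> divided by the gain. The gain cancels
  in the quotient, so the integrand is constant.\<close>

lemma spectral_coherence_eq:
  defines "T \<equiv> matrix_inv C"
  shows "spectral_coherence M x r s = sqrt ((T $ r $ s)\<^sup>2 / (T $ r $ r * T $ s $ s))"
proof -
  note inv = matrix_inv_pos_def[OF pos_def_C, folded T_def]
  have "(let T' = matrix_inv (sdm M x \<theta>) in (cmod (T' $ r $ s))\<^sup>2 / (Re (T' $ r $ r) * Re (T' $ s $ s)))
      = (T $ r $ s)\<^sup>2 / (T $ r $ r * T $ s $ s)" if "\<theta> \<in> {0..1}" for \<theta>
  proof -
    define g where "g = gain K h \<theta>"
    have g: "g > 0" using gain_pos that by (simp add: g_def)
    have "(g *\<^sub>R C) ** ((1 / g) *\<^sub>R T) = mat 1" "((1 / g) *\<^sub>R T) ** (g *\<^sub>R C) = mat 1"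
      using g inv by (simp_all add: scaleR_matrix_mult)
    then have "matrix_inv (complexify (g *\<^sub>R C)) = complexify ((1 / g) *\<^sub>R T)"
      by (intro matrix_inv_unique) (simp_all add: complexify_mult[symmetric] complexify_mat_1)
    then show ?thesis
      using g by (simp add: sdm_eq g_def[symmetric] Let_def norm_divide power_divide power2_eq_square)
  qed
  then have "(LINT \<theta>:{0..1}|lborel. (let T' = matrix_inv (sdm M x \<theta>) in (cmod (T' $ r $ s))\<^sup>2 / (Re (T' $ r $ r) * Re (T' $ s $ s))))
      = (LINT (\<theta>::real):{0..1}|lborel. (T $ r $ s)\<^sup>2 / (T $ r $ r * T $ s $ s))"
    by (intro set_lebesgue_integral_cong allI impI) auto
  also have "\<dots> = (T $ r $ s)\<^sup>2 / (T $ r $ r * T $ s $ s)"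
    by (simp add: set_integral_const)
  finally show ?thesis by (simp add: spectral_coherence_def)
qed

text \<open>Positivity of \<rho> excludes a vanishing precision entry, and in the remaining block of
  size two the coherence equals the absolute correlation under \<open>C\<close>.\<close>

lemma cig_edge_correlation:
  assumes "(r, s) \<in> cig_edges M x"
  shows "\<rho> * sqrt (C $ r $ r * C $ s $ s) \<le> \<bar>C $ r $ s\<bar>"
proof -
  define T where "T = matrix_inv C"
  have rs: "r \<noteq> s" using assms by (auto simp: cig_edges_def)
  have "min_coherence M x \<le> spectral_coherence M x r s"
    unfolding min_coherence_def using assms by (intro Min_le) force+
  moreover have "\<rho> \<le> min_coherence M x" using cls assms by (auto simp: process_class_def)
  ultimately have le: "\<rho> \<le> sqrt ((T $ r $ s)\<^sup>2 / (T $ r $ r * T $ s $ s))"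
    by (simp add: spectral_coherence_eq T_def)
  then have "T $ r $ s \<noteq> 0" using rho by auto
  then have "\<rho> \<le> sqrt ((C $ r $ s)\<^sup>2 / (C $ r $ r * C $ s $ s))"
    using le sparse_precision_blocks(3)[OF pos_def_C sparse rs] by (simp add: T_def)
  moreover have "0 < C $ r $ r * C $ s $ s"
    using pos_def_quadratic_pair(2)[OF pos_def_C] by simp
  ultimately show ?thesis by (simp add: real_sqrt_divide le_divide_eq)
qed

end

section \<open>Conditional independence\<close>

text \<open>The hypothesis \<open>adj\<close> makes \<open>T\<close> a permutation of coordinates.
  The preimage of a box is then a box with permuted side lengths, hence of equal volume, and boxes
  determine Lebesgue measure.\<close>

lemma lborel_basis_involution:
  fixes T :: "'a::euclidean_space \<Rightarrow> 'a"
  assumes [measurable]: "T \<in> borel_measurable borel"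
    and basis: "\<And>b. b \<in> Basis \<Longrightarrow> T b \<in> Basis" and inv: "\<And>b. b \<in> Basis \<Longrightarrow> T (T b) = b"
    and adj: "\<And>x b. b \<in> Basis \<Longrightarrow> T x \<bullet> b = x \<bullet> T b"
  shows "distr lborel borel T = lborel"
proof (rule lborel_eqI[symmetric])
  have bij: "bij_betw T Basis Basis"
    by (rule bij_betw_byWitness[where f'=T]) (auto simp: basis inv)
  fix l u :: 'a
  assume le: "\<And>b. b \<in> Basis \<Longrightarrow> l \<bullet> b \<le> u \<bullet> b"
  have "T -` box l u = box (T l) (T u)"
  proof (rule set_eqI)
    fix x
    have "x \<in> T -` box l u \<longleftrightarrow> (\<forall>b\<in>Basis. l \<bullet> b < x \<bullet> T b \<and> x \<bullet> T b < u \<bullet> b)"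
      by (simp add: mem_box adj)
    also have "\<dots> \<longleftrightarrow> (\<forall>b\<in>Basis. l \<bullet> T b < x \<bullet> T (T b) \<and> x \<bullet> T (T b) < u \<bullet> T b)"
      by (metis basis inv)
    also have "\<dots> \<longleftrightarrow> x \<in> box (T l) (T u)"
      by (simp add: mem_box adj inv)
    finally show "x \<in> T -` box l u \<longleftrightarrow> x \<in> box (T l) (T u)" .
  qed
  then have "emeasure (distr lborel borel T) (box l u) = emeasure lborel (box (T l) (T u))"
    by (subst emeasure_distr) auto
  also have "\<dots> = ennreal (\<Prod>b\<in>Basis. (T u - T l) \<bullet> b)"
    using le basis by (intro emeasure_lborel_box) (auto simp: adj)
  also have "(\<Prod>b\<in>Basis. (T u - T l) \<bullet> b) = (\<Prod>b\<in>Basis. (u - l) \<bullet> T b)"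
    by (simp add: inner_diff_left adj)
  also have "\<dots> = (\<Prod>b\<in>Basis. (u - l) \<bullet> b)"
    by (rule prod.reindex_bij_betw[OF bij])
  finally show "emeasure (distr lborel borel T) (box l u) = ennreal (\<Prod>b\<in>Basis. (u - l) \<bullet> b)" .
qed simp

text \<open>Coordinates outside \<open>G\<close> are set to zero instead of removed. Complementary
  blocks keep the same type and add up to the original vector.\<close>

definition restrict_vec :: "'n set \<Rightarrow> real^'n \<Rightarrow> real^'n" where
  "restrict_vec G v = (\<chi> i. if i \<in> G then v $ i else 0)"

lemma restrict_vec_component [simp]: "restrict_vec G v $ i = (if i \<in> G then v $ i else 0)"
  by (simp add: restrict_vec_def)

lemma restrict_vec_add [simp]: "restrict_vec G v + restrict_vec (- G) v = v"
  by (simp add: vec_eq_iff)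

lemma restrict_vec_measurable [measurable]: "restrict_vec G \<in> borel_measurable borel"
proof -
  have "linear (restrict_vec G)"
    by (rule linearI) (auto simp: vec_eq_iff)
  then show ?thesis
    by (intro borel_measurable_continuous_onI linear_continuous_on) (simp add: linear_conv_bounded_linear)
qed

text \<open>Exchanging the coordinates outside \<open>G\<close> between two copies preserves Lebesgue measure; a
  density whose product over the two copies is invariant under this exchange makes the two coordinate blocks
  independent.\<close>

lemma lborel_swap_blocks:
  "distr lborel borel (\<lambda>(v, v'). (restrict_vec G v + restrict_vec (- G) v', restrict_vec G v' + restrict_vec (- G) v))
    = (lborel :: ((real^'n) \<times> (real^'n)) measure)" (is "distr _ _ ?T = _")
proof (rule lborel_basis_involution)
  have axis: "restrict_vec G (axis i 1) = (if i \<in> G then axis i 1 else 0)" for G and i :: 'n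
    by (auto simp: vec_eq_iff axis_def)
  have zero: "restrict_vec G (0::real^'n) = 0" for G
    by (simp add: vec_eq_iff)
  have B: "b \<in> Basis \<longleftrightarrow> (\<exists>i::'n. b = (axis i 1, 0) \<or> b = (0, axis i 1))" for b :: "(real^'n) \<times> (real^'n)"
    by (auto simp: Basis_prod_def Basis_vec_def)
  show "?T \<in> borel_measurable borel"
    by (simp add: borel_prod[symmetric])
  fix b :: "(real^'n) \<times> (real^'n)"
  assume "b \<in> Basis"
  then obtain i where b: "b = (axis i 1, 0) \<or> b = (0, axis i 1)" by (auto simp: B)
  show "?T b \<in> Basis" using b by (auto simp: B axis zero)
  show "?T (?T b) = b" using b by (auto simp: axis zero)
  fix x :: "(real^'n) \<times> (real^'n)"
  show "?T x \<bullet> b = x \<bullet> ?T b" using b by (cases x) (auto simp: axis zero inner_axis)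
qed

lemma (in prob_space) mv_normal_blocks_independent:
  fixes C :: "real^'n^'n"
  assumes W: "mv_normal M W 0 C"
    and block: "\<And>i j. i \<in> G \<Longrightarrow> j \<notin> G \<Longrightarrow> matrix_inv C $ i $ j = 0"
    and E [measurable]: "E \<in> sets borel" "E' \<in> sets borel"
  shows "prob {\<omega> \<in> space M. restrict_vec G (W \<omega>) \<in> E \<and> restrict_vec (- G) (W \<omega>) \<in> E'}
    = prob {\<omega> \<in> space M. restrict_vec G (W \<omega>) \<in> E} * prob {\<omega> \<in> space M. restrict_vec (- G) (W \<omega>) \<in> E'}"
proof -
  let ?T = "matrix_inv C"
  define f where "f v = ennreal (mv_normal_density 0 C v)" for v
  have C: "pos_def C" and D: "distributed M lborel W f"
    using W by (auto simp: mv_normal_def f_def[abs_def])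
  have [measurable]: "W \<in> borel_measurable M" using distributed_measurable[OF D] by simp
  have f [measurable]: "f \<in> borel_measurable borel" using distributed_borel_measurable[OF D] by simp
  have Tsym: "transpose ?T = ?T" by (rule matrix_inv_pos_def[OF C])
  define q where "q v = v \<bullet> (?T *v v)" for v
  have cross: "restrict_vec G u \<bullet> (?T *v restrict_vec (- G) v) = 0" for u v
  proof -
    have "(\<Sum>j\<in>UNIV. ?T $ i $ j * restrict_vec (- G) v $ j) = 0" if "i \<in> G" for i
      using block[OF that] by (intro sum.neutral) auto
    then show ?thesis
      by (auto simp: inner_vec_def matrix_vector_mult_def intro!: sum.neutral)
  qed
  have qsplit: "q (restrict_vec G u + restrict_vec (- G) v) = q (restrict_vec G u) + q (restrict_vec (- G) v)" for u v
    using cross[of u v] symmetric_inner[OF Tsym, of "restrict_vec (- G) v" "restrict_vec G u"]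
    by (simp add: q_def matrix_vector_right_distrib inner_add)
  have norm: "f v = ennreal (exp (- q v / 2) * (1 / sqrt ((2 * pi) ^ CARD('n) * det C)))" for v
    by (simp add: f_def mv_normal_density_def q_def)
  define T2 where "T2 = (\<lambda>(v, v'). (restrict_vec G v + restrict_vec (- G) v', restrict_vec G v' + restrict_vec (- G) v))"
  have ff: "f (restrict_vec G v + restrict_vec (- G) v') * f (restrict_vec G v' + restrict_vec (- G) v) = f v * f v'" for v v'
  proof -
    have "q (restrict_vec G v + restrict_vec (- G) v') + q (restrict_vec G v' + restrict_vec (- G) v)
      = q (restrict_vec G v + restrict_vec (- G) v) + q (restrict_vec G v' + restrict_vec (- G) v')"
      unfolding qsplit by simp
    then have q: "q (restrict_vec G v + restrict_vec (- G) v') + q (restrict_vec G v' + restrict_vec (- G) v) = q v + q v'"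
      by simp
    define c where "c = 1 / sqrt ((2 * pi) ^ CARD('n) * det C)"
    \<comment> \<open>The sign of the normalizing constant \<open>c\<close> is left open:
      \<open>ennreal_mult'\<close> splits off the exponential, which is nonnegative in any
      case.\<close>
    have prod: "f u * f u' = ennreal (exp (- (q u + q u') / 2)) * (ennreal c * ennreal c)" for u u'
    proof -
      have "- (q u + q u') / 2 = - q u / 2 + - q u' / 2" by (simp add: field_simps)
      then have "exp (- (q u + q u') / 2) = exp (- q u / 2) * exp (- q u' / 2)" by (simp only: exp_add)
      then show ?thesis
        unfolding norm c_def[symmetric] ennreal_mult'[OF exp_ge_zero]
        by (simp only: ennreal_mult' exp_ge_zero mult_ac)
    qed
    show ?thesis unfolding prod q ..
  qed
  have law: "(\<integral>\<^sup>+ v. f v * k v \<partial>lborel) = (\<integral>\<^sup>+ \<omega>. k (W \<omega>) \<partial>M)" if "k \<in> borel_measurable borel" for k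
    using distributed_nn_integral[OF D, of k] that by simp
  have pair: "(\<integral>\<^sup>+ z. k (fst z) * k' (snd z) \<partial>(lborel :: ((real^'n) \<times> (real^'n)) measure))
     = (\<integral>\<^sup>+ v. k v \<partial>lborel) * (\<integral>\<^sup>+ v. k' v \<partial>lborel)"
    if [measurable]: "k \<in> borel_measurable borel" "k' \<in> borel_measurable borel" for k k' :: "real^'n \<Rightarrow> ennreal"
    by (subst lborel_prod[symmetric], subst lborel.nn_integral_fst[symmetric])
      (auto simp: nn_integral_cmult nn_integral_multc)
  define a where "a v = (indicator E (restrict_vec G v) :: ennreal)" for v
  define b where "b v = (indicator E' (restrict_vec (- G) v) :: ennreal)" for v
  have [measurable]: "a \<in> borel_measurable borel" "b \<in> borel_measurable borel"
    by (auto simp: a_def[abs_def] b_def[abs_def])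
  have ind: "(\<integral>\<^sup>+ \<omega>. k \<omega> \<partial>M) = emeasure M {\<omega> \<in> space M. P \<omega>}"
    if "{\<omega> \<in> space M. P \<omega>} \<in> events" "\<And>\<omega>. k \<omega> = (if P \<omega> then 1 else 0)" for k and P :: "'a \<Rightarrow> bool"
  proof -
    have "(\<integral>\<^sup>+ \<omega>. k \<omega> \<partial>M) = (\<integral>\<^sup>+ \<omega>. indicator {\<omega> \<in> space M. P \<omega>} \<omega> \<partial>M)"
      using that(2) by (intro nn_integral_cong) (simp add: indicator_def)
    then show ?thesis using that(1) by simp
  qed
  have "emeasure M {\<omega> \<in> space M. restrict_vec G (W \<omega>) \<in> E \<and> restrict_vec (- G) (W \<omega>) \<in> E'}
     = (\<integral>\<^sup>+ \<omega>. a (W \<omega>) * b (W \<omega>) \<partial>M)"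
    by (rule ind[symmetric]) (auto simp: a_def b_def indicator_def)
  \<comment> \<open>The factor 1 is the total mass of a second copy. Exchanging the coordinates
    outside \<open>G\<close> between the copies moves \<open>b\<close> to the second one, after
    which the double integral factorizes.\<close>
  also have "\<dots> = (\<integral>\<^sup>+ v. f v * (a v * b v) \<partial>lborel) * (\<integral>\<^sup>+ v. f v \<partial>lborel)"
    using law[of "\<lambda>v. a v * b v"] law[of "\<lambda>_. 1"] by (simp add: emeasure_space_1)
  also have "\<dots> = (\<integral>\<^sup>+ z. (f (fst z) * (a (fst z) * b (fst z))) * f (snd z) \<partial>(lborel :: ((real^'n) \<times> (real^'n)) measure))"
    by (rule pair[symmetric]) measurable
  also have "\<dots> = (\<integral>\<^sup>+ z. (f (fst (T2 z)) * (a (fst (T2 z)) * b (fst (T2 z)))) * f (snd (T2 z)) \<partial>(lborel :: ((real^'n) \<times> (real^'n)) measure))"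
    by (subst lborel_swap_blocks[of G, folded T2_def, symmetric], subst nn_integral_distr)
       (auto simp: T2_def simp flip: borel_prod)
  also have "\<dots> = (\<integral>\<^sup>+ z. (f (fst z) * a (fst z)) * (f (snd z) * b (snd z)) \<partial>(lborel :: ((real^'n) \<times> (real^'n)) measure))"
  proof (rule nn_integral_cong)
    fix z :: "(real^'n) \<times> (real^'n)"
    obtain v v' where z: "z = (v, v')" by (cases z)
    have "restrict_vec G (restrict_vec G v + restrict_vec (- G) v') = restrict_vec G v"
      "restrict_vec (- G) (restrict_vec G v + restrict_vec (- G) v') = restrict_vec (- G) v'"
      by (auto simp: vec_eq_iff)
    then show "(f (fst (T2 z)) * (a (fst (T2 z)) * b (fst (T2 z)))) * f (snd (T2 z)) = (f (fst z) * a (fst z)) * (f (snd z) * b (snd z))"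
      using ff[of v v'] by (simp add: z T2_def a_def b_def mult_ac)
  qed
  also have "\<dots> = (\<integral>\<^sup>+ v. f v * a v \<partial>lborel) * (\<integral>\<^sup>+ v. f v * b v \<partial>lborel)"
    by (rule pair) measurable
  also have "\<dots> = (\<integral>\<^sup>+ \<omega>. a (W \<omega>) \<partial>M) * (\<integral>\<^sup>+ \<omega>. b (W \<omega>) \<partial>M)"
    by (simp add: law)
  also have "(\<integral>\<^sup>+ \<omega>. a (W \<omega>) \<partial>M) = emeasure M {\<omega> \<in> space M. restrict_vec G (W \<omega>) \<in> E}"
    by (rule ind) (auto simp: a_def indicator_def)
  also have "(\<integral>\<^sup>+ \<omega>. b (W \<omega>) \<partial>M) = emeasure M {\<omega> \<in> space M. restrict_vec (- G) (W \<omega>) \<in> E'}"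
    by (rule ind) (auto simp: b_def indicator_def)
  finally show ?thesis
    by (simp add: emeasure_eq_measure flip: ennreal_mult)
qed

context filtered_noise
begin

text \<open>Every noise vector is cut into its blocks \<open>G\<close> (index True) and
  -\<open>G\<close> (index False). Independence over time is assumed, and at a fixed time the two
  blocks are independent as the precision matrix does not couple them.\<close>

lemma noise_blocks_indep_vars:
  assumes block: "\<And>i j. i \<in> G \<Longrightarrow> j \<notin> G \<Longrightarrow> matrix_inv C $ i $ j = 0"
  shows "indep_vars (\<lambda>_. borel) (\<lambda>(n, b) \<omega>. restrict_vec (if b then G else - G) (w n \<omega>)) (UNIV :: (int \<times> bool) set)"
proof -
  have wm [measurable]: "w n \<in> borel_measurable M" for n
    using indep by (auto simp: indep_vars_def)
  define R where "R b = restrict_vec (if b then G else - G)" for b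
  have [measurable]: "R b \<in> borel_measurable borel" for b by (simp add: R_def)
  let ?X = "\<lambda>(n, b) \<omega>. R b (w n \<omega>)"
  have "indep_vars (\<lambda>_. borel) ?X UNIV"
    unfolding indep_vars_def2
  proof (intro conjI ballI)
    fix i :: "int \<times> bool" show "?X i \<in> borel_measurable M" by (cases i) simp
  next
    show "indep_sets (\<lambda>i. {?X i -` A \<inter> space M |A. A \<in> sets borel}) UNIV"
    proof (rule indep_setsI)
      fix i :: "int \<times> bool"
      show "{?X i -` A \<inter> space M |A. A \<in> sets borel} \<subseteq> events"
        by (cases i) (auto intro!: measurable_sets[of _ M borel])
    next
      fix A and J :: "(int \<times> bool) set"
      assume J: "J \<noteq> {}" "finite J" and A: "\<forall>j\<in>J. A j \<in> {?X j -` A \<inter> space M |A. A \<in> sets borel}"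
      then obtain S where S: "\<And>j. j \<in> J \<Longrightarrow> S j \<in> sets borel" "\<And>j. j \<in> J \<Longrightarrow> A j = ?X j -` S j \<inter> space M"
        by (simp add: subset_eq) metis
      \<comment> \<open>Indices missing from \<open>J\<close> get the trivial condition, so every
        time in \<open>N\<close> carries both blocks. The extra factors in the product are
        1.\<close>
      define S' where "S' j = (if j \<in> J then S j else UNIV)" for j
      have S' [measurable]: "S' j \<in> sets borel" for j using S by (simp add: S'_def)
      define N where "N = fst ` J"
      have N: "finite N" "N \<noteq> {}" using J by (auto simp: N_def)
      define Q where "Q n b = {\<omega> \<in> space M. R b (w n \<omega>) \<in> S' (n, b)}" for n b
      have "(\<Inter>j\<in>J. A j) = (\<Inter>n\<in>N. w n -` {v. R True v \<in> S' (n, True) \<and> R False v \<in> S' (n, False)} \<inter> space M)"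
      proof (rule set_eqI)
        fix \<omega>
        have "\<omega> \<in> (\<Inter>j\<in>J. A j) \<longleftrightarrow> \<omega> \<in> space M \<and> (\<forall>(n, b)\<in>J. R b (w n \<omega>) \<in> S' (n, b))"
          using J S by (auto simp: S'_def)
        also have "\<dots> \<longleftrightarrow> \<omega> \<in> space M \<and> (\<forall>n\<in>N. \<forall>b. R b (w n \<omega>) \<in> S' (n, b))"
          by (force simp: N_def S'_def)
        also have "\<dots> \<longleftrightarrow> \<omega> \<in> (\<Inter>n\<in>N. w n -` {v. R True v \<in> S' (n, True) \<and> R False v \<in> S' (n, False)} \<inter> space M)"
          using N(2) by (auto simp: all_bool_eq)
        finally show "\<omega> \<in> (\<Inter>j\<in>J. A j) \<longleftrightarrow> \<dots>" .
      qed
      then have "prob (\<Inter>j\<in>J. A j) = prob (\<Inter>n\<in>N. w n -` {v. R True v \<in> S' (n, True) \<and> R False v \<in> S' (n, False)} \<inter> space M)"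
        by simp
      also have "\<dots> = (\<Prod>n\<in>N. prob (w n -` {v. R True v \<in> S' (n, True) \<and> R False v \<in> S' (n, False)} \<inter> space M))"
        using N by (intro indep_varsD[OF indep]) auto
      also have "\<dots> = (\<Prod>n\<in>N. \<Prod>b\<in>UNIV. prob (Q n b))"
      proof (rule prod.cong[OF refl])
        fix n
        have "w n -` {v. R True v \<in> S' (n, True) \<and> R False v \<in> S' (n, False)} \<inter> space M
          = {\<omega> \<in> space M. restrict_vec G (w n \<omega>) \<in> S' (n, True) \<and> restrict_vec (- G) (w n \<omega>) \<in> S' (n, False)}"
          by (auto simp: R_def)
        then show "prob (w n -` {v. R True v \<in> S' (n, True) \<and> R False v \<in> S' (n, False)} \<inter> space M) = (\<Prod>b\<in>UNIV. prob (Q n b))"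
          using mv_normal_blocks_independent[OF noise[of n] block S' S']
          by (simp add: UNIV_bool Q_def R_def mult.commute)
      qed
      also have "\<dots> = (\<Prod>j\<in>N \<times> UNIV. prob (Q (fst j) (snd j)))"
        by (simp add: prod.cartesian_product case_prod_beta)
      also have "\<dots> = (\<Prod>j\<in>J. prob (Q (fst j) (snd j)))"
      proof (rule prod.mono_neutral_right)
        show "finite (N \<times> (UNIV :: bool set))" "J \<subseteq> N \<times> UNIV" using N by (force simp: N_def)+
        show "\<forall>j\<in>N \<times> UNIV - J. prob (Q (fst j) (snd j)) = 1"
          by (auto simp: Q_def S'_def prob_space)
      qed
      also have "\<dots> = (\<Prod>j\<in>J. prob (A j))"
      proof (rule prod.cong[OF refl])
        fix j assume "j \<in> J"
        then show "prob (Q (fst j) (snd j)) = prob (A j)"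
          using S(2) by (cases j) (auto simp: Q_def S'_def intro!: arg_cong[where f = prob])
      qed
      finally show "prob (\<Inter>j\<in>J. A j) = (\<Prod>j\<in>J. prob (A j))" .
    qed
  qed
  then show ?thesis by (simp add: R_def)
qed

lemma sets_components:
  "sets (components M x R) =
    sigma_sets (space M) {(\<lambda>\<omega>. x n \<omega> $ r) -` S \<inter> space M |n r S. r \<in> R \<and> S \<in> sets borel}"
proof -
  have "{(\<lambda>(n, r) \<omega>. x n \<omega> $ r) i -` S \<inter> space M |i S. i \<in> UNIV \<times> R \<and> S \<in> sets borel}
     = {(\<lambda>\<omega>. x n \<omega> $ r) -` S \<inter> space M |n r S. r \<in> R \<and> S \<in> sets borel}"
    by auto
  then show ?thesis
    unfolding components_def generated_algebra_def by (simp add: sets_measure_of_conv) blast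
qed

text \<open>The filter is scalar, so a component of \<open>x\<close> is a function of the same
  component of the noise. Events about the components in \<open>G\<close> are thus preimages under
  the whole noise path of that block, and the paths of the two blocks are independent.\<close>

lemma component_blocks_independent:
  assumes block: "\<And>i j. i \<in> G \<Longrightarrow> j \<notin> G \<Longrightarrow> matrix_inv C $ i $ j = 0"
    and a: "a \<in> sets (components M x G)" and d: "d \<in> sets (components M x (- G))"
  shows "prob (a \<inter> d) = prob a * prob d"
proof -
  define X where "X = (\<lambda>(n::int, b) \<omega>. restrict_vec (if b then G else - G) (w n \<omega>))"
  define I where "I b = (UNIV :: int set) \<times> {b}" for b :: bool
  define V where "V b \<omega> = restrict (\<lambda>i. X i \<omega>) (I b)" for b \<omega>
  have iv: "indep_var (Pi\<^sub>M (I True) (\<lambda>_. borel)) (V True) (Pi\<^sub>M (I False) (\<lambda>_. borel)) (V False)"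
    unfolding V_def using noise_blocks_indep_vars[OF block]
    by (intro indep_var_restrict) (auto simp: I_def X_def)
  have Vm: "V b \<in> measurable M (Pi\<^sub>M (I b) (\<lambda>_. borel))" for b
    using iv unfolding indep_var_eq by (cases b) auto
  have sub: "\<exists>D. D \<in> sets (Pi\<^sub>M (I b) (\<lambda>_. borel)) \<and> e = V b -` D \<inter> space M"
    if e: "e \<in> sets (components M x (if b then G else - G))" for e b
  proof -
    let ?S = "Pi\<^sub>M (I b) (\<lambda>_. borel :: (real^'p) measure)"
    let ?VA = "vimage_algebra (space M) (V b) ?S"
    have Vs: "V b \<in> space M \<rightarrow> space ?S" using Vm[of b] by (auto simp: measurable_def)
    have Vm': "V b \<in> measurable ?VA ?S" using Vs by (rule measurable_vimage_algebra1)
    have comp: "(\<lambda>\<omega>. x n \<omega> $ i) -` S \<inter> space M \<in> sets ?VA" if i: "i \<in> (if b then G else - G)" and S: "S \<in> sets borel" for n i S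
    proof -
      \<comment> \<open>The filter output of component \<open>i\<close>, written as a function of
        the noise path of block \<open>b\<close>.\<close>
      define g where "g u = (\<Sum>m<K. h m * (u (n - int m, b) \<bullet> axis i 1))" for u :: "int \<times> bool \<Rightarrow> real^'p"
      have "(\<lambda>u. u (k, b)) \<in> borel_measurable ?S" for k
        by (rule measurable_component_singleton) (simp add: I_def)
      then have "g \<in> borel_measurable ?S"
        unfolding g_def by (intro borel_measurable_sum borel_measurable_times borel_measurable_inner) auto
      then have "(\<lambda>\<omega>. g (V b \<omega>)) \<in> borel_measurable ?VA"
        using Vm' by (rule measurable_compose[rotated])
      moreover have "x n \<omega> $ i = g (V b \<omega>)" if "\<omega> \<in> space M" for \<omega>
        using filter[OF that, of n] i by (simp add: g_def V_def I_def X_def inner_axis)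
      ultimately have "(\<lambda>\<omega>. x n \<omega> $ i) \<in> borel_measurable ?VA"
        by (subst measurable_cong[where g = "\<lambda>\<omega>. g (V b \<omega>)"]) simp_all
      from measurable_sets[OF this S] show ?thesis by simp
    qed
    have "sets (components M x (if b then G else - G)) \<subseteq> sets ?VA"
    proof -
      have "{(\<lambda>\<omega>. x n \<omega> $ q) -` S \<inter> space M |n q S. q \<in> (if b then G else - G) \<and> S \<in> sets borel} \<subseteq> sets ?VA"
        (is "?gen \<subseteq> _")
      proof
        fix A assume "A \<in> ?gen"
        then obtain n q S where "A = (\<lambda>\<omega>. x n \<omega> $ q) -` S \<inter> space M" "q \<in> (if b then G else - G)" "S \<in> sets borel"
          by blast
        then show "A \<in> sets ?VA" using comp by (simp only:)
      qed
      from sets.sigma_sets_subset[OF this] show ?thesis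
        by (simp only: sets_components space_vimage_algebra)
    qed
    then have "e \<in> sets ?VA" using e by (rule subsetD)
    then show ?thesis unfolding sets_vimage_algebra2[OF Vs] by blast
  qed
  obtain A where A: "A \<in> sets (Pi\<^sub>M (I True) (\<lambda>_. borel))" "a = V True -` A \<inter> space M"
    using sub[of a True] a by auto
  obtain D where D: "D \<in> sets (Pi\<^sub>M (I False) (\<lambda>_. borel))" "d = V False -` D \<inter> space M"
    using sub[of d False] d by auto
  have "a \<inter> d = (\<lambda>\<omega>. (V True \<omega>, V False \<omega>)) -` (A \<times> D) \<inter> space M" using A D by auto
  then show ?thesis using indep_varD[OF iv A(1) D(1)] A D by simp
qed

lemma components_subalgebra: "subalgebra M (components M x G)"
proof -
  have "sigma_sets (space M) {(\<lambda>\<omega>. x n \<omega> $ r) -` S \<inter> space M |n r S. r \<in> G \<and> S \<in> sets borel} \<subseteq> events"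
    by (rule sets.sigma_sets_subset) (auto intro!: measurable_sets[OF x_component_measurable])
  then show ?thesis
    unfolding subalgebra_def sets_components
    by (simp add: components_def generated_algebra_def space_measure_of_conv)
qed

lemma components_mono:
  assumes "G \<subseteq> G'"
  shows "sets (components M x G) \<subseteq> sets (components M x G')"
  unfolding sets_components using assms by (intro sigma_sets_mono') blast

lemma component_event:
  assumes "S \<in> sets borel"
  shows "(\<lambda>\<omega>. x n \<omega> $ r) -` S \<inter> space M \<in> sets (components M x {r})"
  unfolding sets_components using assms by (intro sigma_sets.Basic) blast

lemma hz_square_sum:
  assumes "finite W" "{n - int K<..n} \<subseteq> W"
  shows "(\<Sum>k\<in>W. hz (n - k) * hz (n - k)) = 1"
proof -
  have "(\<Sum>m<K. (h m)\<^sup>2 *\<^sub>R (1::real)) = (\<Sum>k\<in>W. zero_ext K (\<lambda>m. (h m)\<^sup>2) (n - k) *\<^sub>R 1)"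
    using assms by (rule sum_filter_window)
  also have "\<dots> = (\<Sum>k\<in>W. hz (n - k) * hz (n - k))"
    by (intro sum.cong) (auto simp: zero_ext_def power2_eq_square)
  finally show ?thesis using unit by simp
qed

end

lemma (in prob_space) real_cond_exp_indep_event:
  assumes sub: "subalgebra M F" and a: "a \<in> events"
    and ind: "\<And>d. d \<in> sets F \<Longrightarrow> prob (a \<inter> d) = prob a * prob d"
  shows "AE \<omega> in M. real_cond_exp M F (indicator a) \<omega> = prob a"
proof -
  interpret sigma_finite_subalgebra M F
    by (rule finite_measure_subalgebra_is_sigma_finite) (simp add: finite_measure_subalgebra_def finite_measure_subalgebra_axioms_def sub finite_measure_axioms)
  show ?thesis
  proof (rule real_cond_exp_charact)
    fix d assume d: "d \<in> sets F"
    then have dM: "d \<in> events" using sub by (auto simp: subalgebra_def)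
    have "(LINT \<omega>:d|M. indicator a \<omega>) = prob (a \<inter> d)"
      using a dM by (simp add: set_lebesgue_integral_def indicator_inter_arith[symmetric] Int_commute)
    moreover have "(LINT \<omega>:d|M. prob a) = prob a * prob d"
      using dM by (simp add: set_lebesgue_integral_def mult.commute)
    ultimately show "(LINT \<omega>:d|M. indicator a \<omega>) = (LINT \<omega>:d|M. prob a)"
      using ind[OF d] by simp
  qed (use a in \<open>auto intro!: integrable_real_indicator simp: emeasure_eq_measure\<close>)
qed

context filtered_class
begin

text \<open>Only this direction of the correspondence between edges and precision entries needs
  conditional independence. The converse comes from the lower bound on the coherence of the edges,
  as the coherence of a pair with vanishing precision entry is zero.\<close>

lemma precision_nonzero_edge:
  assumes rs: "r \<noteq> s" and nz: "matrix_inv C $ r $ s \<noteq> 0"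
  shows "(r, s) \<in> cig_edges M x"
proof (rule ccontr)
  assume "(r, s) \<notin> cig_edges M x"
  then have ci: "cond_indep M (components M x (- {r, s})) (components M x {r}) (components M x {s})"
    using rs by (simp add: cig_edges_def)
  let ?F = "components M x (- {r, s})"
  define X where "X q \<omega> = x 0 \<omega> $ q" for q \<omega>
  have [measurable]: "X q \<in> borel_measurable M" for q by (simp add: X_def[abs_def])
  have block: "matrix_inv C $ i $ j = 0" if "i \<in> {r, s}" "j \<notin> {r, s}" for i j
    using sparse_precision_blocks(4)[OF pos_def_C sparse rs nz that(2)] that(1) by auto
  \<comment> \<open>The pair is independent of all other components, so conditioning on them has no
    effect. The assumed conditional independence thereby becomes ordinary independence of the
    pair.\<close>
  have const: "AE \<omega> in M. real_cond_exp M ?F (indicator a) \<omega> = prob a" if "a \<in> sets (components M x {r, s})" for a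
  proof (rule real_cond_exp_indep_event)
    show "subalgebra M ?F" by (rule components_subalgebra)
    show "a \<in> events" using components_subalgebra that by (auto simp: subalgebra_def)
    show "prob (a \<inter> d) = prob a * prob d" if "d \<in> sets ?F" for d
      using component_blocks_independent[OF block \<open>a \<in> sets (components M x {r, s})\<close> that] by simp
  qed
  have prod: "prob ((X r -` S \<inter> space M) \<inter> (X s -` S' \<inter> space M)) = prob (X r -` S \<inter> space M) * prob (X s -` S' \<inter> space M)"
    if S: "S \<in> sets borel" "S' \<in> sets borel" for S S'
  proof -
    define a where "a = X r -` S \<inter> space M"
    define b where "b = X s -` S' \<inter> space M"
    have a: "a \<in> sets (components M x {r})" and b: "b \<in> sets (components M x {s})"
      using component_event S by (simp_all add: a_def b_def X_def[abs_def])
    have a': "a \<in> sets (components M x {r, s})" and b': "b \<in> sets (components M x {r, s})"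
      using a b components_mono[of "{r}" "{r, s}"] components_mono[of "{s}" "{r, s}"] by auto
    then have ab': "a \<inter> b \<in> sets (components M x {r, s})" by auto
    have "AE \<omega> in M. prob (a \<inter> b) = prob a * prob b"
      using ci[unfolded cond_indep_def, rule_format, OF a b] const[OF a'] const[OF b'] const[OF ab']
      by eventually_elim simp
    then show ?thesis by (simp add: a_def b_def)
  qed
  have ind: "indep_var borel (X r) borel (X s)"
    unfolding indep_var_eq
  proof (intro conjI indep_set_sigma_sets indep_setI)
    fix a b assume "a \<in> {X r -` A \<inter> space M |A. A \<in> sets borel}" "b \<in> {X s -` A \<inter> space M |A. A \<in> sets borel}"
    then show "prob (a \<inter> b) = prob a * prob b" using prod by auto
  next
    have "Int_stable {X q -` A \<inter> space M |A. A \<in> sets borel}" for q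
    proof (rule Int_stableI)
      fix a b assume "a \<in> {X q -` A \<inter> space M |A. A \<in> sets borel}" "b \<in> {X q -` A \<inter> space M |A. A \<in> sets borel}"
      then obtain A A' where "A \<in> sets borel" "A' \<in> sets borel" "a = X q -` A \<inter> space M" "b = X q -` A' \<inter> space M" by auto
      then have "A \<inter> A' \<in> sets borel" "a \<inter> b = X q -` (A \<inter> A') \<inter> space M" by auto
      then show "a \<inter> b \<in> {X q -` A \<inter> space M |A. A \<in> sets borel}" by blast
    qed
    then show "Int_stable {X r -` A \<inter> space M |A. A \<in> sets borel}" "Int_stable {X s -` A \<inter> space M |A. A \<in> sets borel}" by auto
  qed auto
  have zm: "integrable M (x 0)" "expectation (x 0) = 0"
    using cls by (auto simp: process_class_def zero_mean_def)
  have X0: "integrable M (X q)" "expectation (X q) = 0" for q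
  proof -
    have "X q = (\<lambda>\<omega>. x 0 \<omega> \<bullet> axis q 1)" by (auto simp: X_def inner_axis)
    then show "integrable M (X q)" "expectation (X q) = 0"
      using zm integral_inner_left[of "axis q 1" M "x 0"] by auto
  qed
  \<comment> \<open>Independence makes the time-0 covariance of the pair vanish, yet it equals C_rs,
    which is nonzero together with the precision entry.\<close>
  have "expectation (\<lambda>\<omega>. X r \<omega> * X s \<omega>) = 0"
    using indep_var_lebesgue_integral[OF ind X0(1) X0(1)] X0(2) by simp
  moreover have "expectation (\<lambda>\<omega>. X r \<omega> * X s \<omega>) = C $ r $ s"
    using x_moments(2)[of "{- int K<..0}" 0 0 r s] hz_square_sum[of "{- int K<..0}" 0] by (simp add: X_def)
  ultimately show False
    using sparse_precision_blocks(2)[OF pos_def_C sparse rs nz] by simp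
qed

end

section \<open>Error probability of the selection scheme\<close>

text \<open>Let G be the matrix of the filter and D the diagonal matrix of the roots of the weights.
  The covariance of \<open>Y\<close> is A = D G G^T D, and y = G^T D c gives c^T A c = |y|^2 and A c
  = D G y. Since D is a contraction and G has squared norm at most \<open>g\<close>, the spectral
  condition follows. The trace is the sum of the weights, N, because the filter and the direction
  are normalized.\<close>

lemma (in filtered_noise) unit_direction_tails:
  assumes "N \<ge> 1" and u: "u \<bullet> (C *v u) = 1"
    and g: "0 < g" "\<And>\<theta>. 0 \<le> \<theta> \<Longrightarrow> \<theta> < 1 \<Longrightarrow> gain K h \<theta> \<le> g" and k: "0 < k" "k < 1"
  defines "P \<equiv> \<lambda>\<omega>. \<Sum>n = 1..int N + 1. end_weight N n * (u \<bullet> x n \<omega>)\<^sup>2"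
  shows "prob {\<omega> \<in> space M. (1 + k)\<^sup>2 * real N \<le> P \<omega>} \<le> exp (- (real N * k\<^sup>2 / (2 * g)))"
    and "prob {\<omega> \<in> space M. P \<omega> \<le> (1 - k)\<^sup>2 * real N} \<le> exp (- (real N * k\<^sup>2 / (2 * g)))"
proof -
  define I where "I = {1..int N + 1}"
  define W where "W = {1 - int K..int N + 1}"
  define D where "D n = sqrt (end_weight N n)" for n
  have D2: "D n * D n = end_weight N n" "0 \<le> D n" "D n \<le> 1" for n
    by (auto simp: D_def end_weight_def)
  have fin: "finite I" "finite W" by (auto simp: I_def W_def)
  have win: "{n - int K<..n} \<subseteq> W" if "n \<in> I" for n using that by (auto simp: I_def W_def)
  define Y where "Y n \<omega> = D n * (u \<bullet> x n \<omega>)" for n \<omega>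
  define A where "A n m = D n * D m * (\<Sum>k\<in>W. hz (n - k) * hz (m - k))" for n m
  define y where "y c k = (\<Sum>n\<in>I. hz (n - k) * (D n * c n))" for c k
  have Ac: "(\<Sum>m\<in>I. A n m * c m) = D n * (\<Sum>k\<in>W. hz (n - k) * y c k)" for n c
  proof -
    have "(\<Sum>k\<in>W. hz (n - k) * y c k) = (\<Sum>m\<in>I. \<Sum>k\<in>W. hz (n - k) * (hz (m - k) * (D m * c m)))"
      unfolding y_def sum_distrib_left by (rule sum.swap)
    then show ?thesis
      by (simp add: A_def sum_distrib_left sum_distrib_right mult_ac)
  qed
  have cAc: "(\<Sum>n\<in>I. \<Sum>m\<in>I. c n * A n m * c m) = (\<Sum>k\<in>W. (y c k)\<^sup>2)" for c
  proof -
    have "(\<Sum>n\<in>I. \<Sum>m\<in>I. c n * A n m * c m) = (\<Sum>n\<in>I. \<Sum>k\<in>W. (hz (n - k) * (D n * c n)) * y c k)"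
      using Ac[of _ c] by (simp add: mult.assoc sum_distrib_left[symmetric]) (simp add: sum_distrib_left mult_ac)
    also have "\<dots> = (\<Sum>k\<in>W. y c k * y c k)"
      by (subst sum.swap) (simp add: y_def sum_distrib_right)
    finally show ?thesis by (simp add: power2_eq_square)
  qed
  have bd: "(\<Sum>n\<in>I. (\<Sum>m\<in>I. A n m * c m)\<^sup>2) \<le> g * (\<Sum>n\<in>I. \<Sum>m\<in>I. c n * A n m * c m)" for c
  proof -
    have "(\<Sum>n\<in>I. (\<Sum>m\<in>I. A n m * c m)\<^sup>2) \<le> (\<Sum>n\<in>I. (\<Sum>k\<in>W. hz (n - k) * y c k)\<^sup>2)"
      unfolding Ac power_mult_distrib using D2
      by (intro sum_mono mult_left_le_one_le) (auto simp: power_le_one)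
    also have "\<dots> \<le> g * (\<Sum>k\<in>W. (y c k)\<^sup>2)"
      using fin g(2) by (intro filter_l2_bound) auto
    finally show ?thesis by (simp only: cAc)
  qed
  have normal: "centered_normal M (\<lambda>\<omega>. \<Sum>n\<in>I. c n * Y n \<omega>) (\<Sum>n\<in>I. \<Sum>m\<in>I. c n * A n m * c m)" for c
  proof -
    have "(\<Sum>n\<in>I. hz (n - k) *\<^sub>R ((c n * D n) *\<^sub>R u)) = y c k *\<^sub>R u" for k
      by (simp add: y_def scaleR_sum_left mult_ac)
    then have "(\<Sum>k\<in>W. (\<Sum>n\<in>I. hz (n - k) *\<^sub>R ((c n * D n) *\<^sub>R u)) \<bullet> (C *v (\<Sum>n\<in>I. hz (n - k) *\<^sub>R ((c n * D n) *\<^sub>R u)))) = (\<Sum>k\<in>W. (y c k)\<^sup>2)"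
      using u by (simp add: matrix_vector_mult_scaleR power2_eq_square)
    moreover have "(\<Sum>n\<in>I. ((c n * D n) *\<^sub>R u) \<bullet> x n \<omega>) = (\<Sum>n\<in>I. c n * Y n \<omega>)" for \<omega>
      by (simp add: Y_def mult.assoc)
    ultimately show ?thesis
      using linear_combination_normal[of I W "\<lambda>n. (c n * D n) *\<^sub>R u"] fin win by (simp add: cAc)
  qed
  have tr: "(\<Sum>n\<in>I. A n n) = real N"
  proof -
    have "(\<Sum>n\<in>I. A n n) = (\<Sum>n\<in>I. end_weight N n)"
      using hz_square_sum[OF fin(2) win] by (intro sum.cong) (auto simp: A_def D2)
    then show ?thesis using sum_end_weight[OF assms(1)] by (simp add: I_def)
  qed
  have PY: "P = (\<lambda>\<omega>. \<Sum>n\<in>I. (Y n \<omega>)\<^sup>2)"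
  proof -
    have "(Y n \<omega>)\<^sup>2 = end_weight N n * (u \<bullet> x n \<omega>)\<^sup>2" for n \<omega>
      unfolding Y_def power_mult_distrib power2_eq_square[of "D n"] D2 ..
    then show ?thesis by (simp add: P_def I_def)
  qed
  have Ym: "Y n \<in> borel_measurable M" for n
    unfolding Y_def[abs_def] by measurable
  have sym: "A n m = A m n" for n m by (simp add: A_def mult_ac)
  show "prob {\<omega> \<in> space M. (1 + k)\<^sup>2 * real N \<le> P \<omega>} \<le> exp (- (real N * k\<^sup>2 / (2 * g)))"
    "prob {\<omega> \<in> space M. P \<omega> \<le> (1 - k)\<^sup>2 * real N} \<le> exp (- (real N * k\<^sup>2 / (2 * g)))"
    using square_sum_tails[OF fin(1) sym g(1) bd Ym normal k] unfolding tr PY by auto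
qed

section \<open>From energy windows to the threshold test\<close>

text \<open>With \<eta> = N \<rho> / B, the signal 2 c \<kappa> N is at least 2 \<eta>, as c \<ge>
  \<rho> and \<kappa> \<ge> 1 \<ge> 1 / B. The window edges cost at most 4 k \<kappa> N =
  \<eta>.\<close>

lemma correlation_window_pos:
  fixes \<kappa> c k P Q B \<rho> N :: real
  assumes "1 \<le> \<kappa>" "1 \<le> B" "0 < \<rho>" "0 < N" and k: "k = \<rho> / (4 * B * \<kappa>)" "k < 1" and c: "\<rho> \<le> c" "c < 1"
    and P: "(1 - k)\<^sup>2 * N < P" and Q: "Q < (1 + k)\<^sup>2 * N"
  shows "N * \<rho> / B \<le> \<kappa> * ((1 + c) * P - (1 - c) * Q)"
proof -
  have k4: "4 * k * \<kappa> = \<rho> / B" using assms by (simp add: field_simps)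
  have "(1 + c) * ((1 - k)\<^sup>2 * N) \<le> (1 + c) * P" "(1 - c) * Q \<le> (1 - c) * ((1 + k)\<^sup>2 * N)"
    using assms by (auto intro!: mult_left_mono)
  moreover have "(1 + c) * ((1 - k)\<^sup>2 * N) - (1 - c) * ((1 + k)\<^sup>2 * N) = N * (2 * c - 4 * k) + N * (2 * c * k\<^sup>2)"
    by (simp add: power2_eq_square algebra_simps)
  moreover have "0 \<le> N * (2 * c * k\<^sup>2)" using assms by simp
  ultimately have l: "N * (2 * c - 4 * k) \<le> (1 + c) * P - (1 - c) * Q" by linarith
  have "N * (2 * \<rho> - 4 * k) \<le> N * (2 * c - 4 * k)"
    using assms by (intro mult_left_mono) auto
  then have "\<kappa> * (N * (2 * \<rho> - 4 * k)) \<le> \<kappa> * ((1 + c) * P - (1 - c) * Q)"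
    using assms(1) l by (intro mult_left_mono; linarith)
  moreover have "\<kappa> * (N * (2 * \<rho> - 4 * k)) = N * (2 * (\<rho> * \<kappa>)) - N * (4 * k * \<kappa>)"
    by (simp add: algebra_simps)
  moreover have "\<rho> / B \<le> \<rho> * \<kappa>"
    using assms by (intro order_trans[of "\<rho> / B" \<rho> "\<rho> * \<kappa>"]) (auto simp: divide_le_eq)
  then have "N * (2 * (\<rho> / B)) \<le> N * (2 * (\<rho> * \<kappa>))" using assms by (intro mult_left_mono) auto
  moreover have "N * (4 * k * \<kappa>) = N * \<rho> / B" "N * (2 * (\<rho> / B)) = 2 * (N * \<rho> / B)"
    unfolding k4 by simp_all
  ultimately show ?thesis by linarith
qed

text \<open>Two values in the same window differ by less than 4 k N, and \<kappa> times this is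
  exactly the threshold. Open windows keep the inequality strict, as it must be because equality
  would pass the test.\<close>

lemma correlation_window_zero:
  fixes \<kappa> k P Q B \<rho> N :: real
  assumes "1 \<le> \<kappa>" "1 \<le> B" and k: "k = \<rho> / (4 * B * \<kappa>)"
    and P: "(1 - k)\<^sup>2 * N < P" "P < (1 + k)\<^sup>2 * N" and Q: "(1 - k)\<^sup>2 * N < Q" "Q < (1 + k)\<^sup>2 * N"
  shows "\<bar>\<kappa> * (P - Q)\<bar> < N * \<rho> / B"
proof -
  have "(1 + k)\<^sup>2 * N - (1 - k)\<^sup>2 * N = 4 * k * N"
    by (simp add: power2_eq_square algebra_simps)
  then have "\<bar>P - Q\<bar> < 4 * k * N" using P Q by linarith
  then have "\<kappa> * \<bar>P - Q\<bar> < \<kappa> * (4 * k * N)" using assms by (intro mult_strict_left_mono) auto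
  also have "\<kappa> * (4 * k * N) = N * \<rho> / B" using assms(1,2) by (simp add: k)
  finally show ?thesis using assms(1) by (simp add: abs_mult)
qed

text \<open>A second index exists, so the maximum is over a nonempty finite set and is attained;
  this makes the choice behind \<open>arg_max\<close> a true maximizer.\<close>

lemma r_hat_maximal:
  fixes y :: "int \<Rightarrow> real^'p"
  assumes "CARD('p) \<ge> 2"
  shows "r_hat N y r \<noteq> r" and "s \<noteq> r \<Longrightarrow> cmod (Z_stat N y r s) \<le> cmod (Z_stat N y r (r_hat N y r))"
proof -
  let ?f = "\<lambda>s. cmod (Z_stat N y r s)"
  have "- {r} \<noteq> {}"
  proof
    assume "- {r} = {}"
    then have "UNIV = {r}" by auto
    then have "CARD('p) = card {r}" by (rule arg_cong)
    then show False using assms by simp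
  qed
  then obtain t where "t \<in> - {r}" "?f t = Max (?f ` (- {r}))"
    using Max_in[of "?f ` (- {r})"] by fastforce
  then have "is_arg_max ?f (\<lambda>s. s \<noteq> r) t"
    by (auto simp: is_arg_max_linorder)
  then have "is_arg_max ?f (\<lambda>s. s \<noteq> r) (r_hat N y r)"
    unfolding r_hat_def arg_max_def by (rule someI)
  then show "r_hat N y r \<noteq> r" "s \<noteq> r \<Longrightarrow> ?f s \<le> ?f (r_hat N y r)"
    by (auto simp: is_arg_max_linorder)
qed

text \<open>It suffices that the threshold test is right for each candidate. If the maximizer
  passes, it is the only element of \<open>A\<close>; if it fails, so do all the others.\<close>

lemma selected_neighborhood_correct:
  fixes y :: "int \<Rightarrow> real^'p"
  assumes "CARD('p) \<ge> 2" and A: "card A \<le> 1" "r \<notin> A"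
    and Z: "\<And>s. s \<noteq> r \<Longrightarrow> \<eta> \<le> cmod (Z_stat N y r s) \<longleftrightarrow> s \<in> A"
  shows "selected_neighborhood N \<eta> y r = A"
proof (cases "\<eta> \<le> cmod (Z_stat N y r (r_hat N y r))")
  case True
  then have "r_hat N y r \<in> A" using Z r_hat_maximal(1)[OF assms(1)] by blast
  moreover have "finite A" by simp
  ultimately have "A = {r_hat N y r}" using A(1) by (auto simp: card_le_Suc0_iff_eq)
  then show ?thesis using True by (simp add: selected_neighborhood_def)
next
  case False
  have "A = {}"
  proof (rule equals0I)
    fix s assume "s \<in> A"
    then have "s \<noteq> r" using A(2) by auto
    moreover from this have "\<eta> \<le> cmod (Z_stat N y r s)" using Z \<open>s \<in> A\<close> by blast
    ultimately show False using False r_hat_maximal(2)[OF assms(1), of s r N y] by linarith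
  qed
  then show ?thesis using False by (simp add: selected_neighborhood_def)
qed

lemma (in filtered_noise) cmod_Z_stat_measurable [measurable]:
  assumes "N \<ge> 1"
  shows "(\<lambda>\<omega>. cmod (Z_stat N (\<lambda>n. x n \<omega>) r s)) \<in> borel_measurable M"
  unfolding Z_stat_eq[OF assms] norm_of_real by measurable

text \<open>The choice among tied maximizers is a function of the set \<open>T\<close> of
  maximizers. The error event is a finite union over the possible \<open>T\<close>, and for fixed
  \<open>T\<close> the chosen index is a constant.\<close>

lemma (in filtered_noise) selection_error_event:
  assumes "N \<ge> 1"
  shows "{\<omega> \<in> space M. \<exists>r. selected_neighborhood N \<eta> (\<lambda>n. x n \<omega>) r \<noteq> nb r} \<in> events"
proof -
  note [measurable] = cmod_Z_stat_measurable[OF assms]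
  define F where "F \<omega> r s = cmod (Z_stat N (\<lambda>n. x n \<omega>) r s)" for \<omega> r s
  have [measurable]: "(\<lambda>\<omega>. F \<omega> r s) \<in> borel_measurable M" for r s by (simp add: F_def)
  define Mx where "Mx \<omega> r = {s. is_arg_max (F \<omega> r) (\<lambda>s. s \<noteq> r) s}" for \<omega> r
  have rh: "r_hat N (\<lambda>n. x n \<omega>) r = (SOME s. s \<in> Mx \<omega> r)" for \<omega> r
    by (simp add: r_hat_def arg_max_def Mx_def F_def[abs_def])
  have "{\<omega> \<in> space M. \<exists>r. selected_neighborhood N \<eta> (\<lambda>n. x n \<omega>) r \<noteq> nb r} =
    {\<omega> \<in> space M. \<exists>r. \<exists>T\<in>UNIV. (\<forall>s. s \<in> T \<longleftrightarrow> s \<noteq> r \<and> (\<forall>t. t \<noteq> r \<longrightarrow> F \<omega> r t \<le> F \<omega> r s)) \<and>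
       (if \<eta> \<le> F \<omega> r (SOME s. s \<in> T) then {SOME s. s \<in> T} else {}) \<noteq> nb r}"
  proof (intro Collect_cong conj_cong refl ex_cong1)
    fix \<omega> r
    have mx: "Mx \<omega> r = T \<longleftrightarrow> (\<forall>s. s \<in> T \<longleftrightarrow> s \<noteq> r \<and> (\<forall>t. t \<noteq> r \<longrightarrow> F \<omega> r t \<le> F \<omega> r s))" for T
      by (auto simp: Mx_def is_arg_max_linorder)
    have sel: "selected_neighborhood N \<eta> (\<lambda>n. x n \<omega>) r =
      (if \<eta> \<le> F \<omega> r (SOME s. s \<in> Mx \<omega> r) then {SOME s. s \<in> Mx \<omega> r} else {})"
      by (simp add: selected_neighborhood_def rh F_def)
    show "selected_neighborhood N \<eta> (\<lambda>n. x n \<omega>) r \<noteq> nb r \<longleftrightarrow>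
      (\<exists>T\<in>UNIV. (\<forall>s. s \<in> T \<longleftrightarrow> s \<noteq> r \<and> (\<forall>t. t \<noteq> r \<longrightarrow> F \<omega> r t \<le> F \<omega> r s)) \<and>
       (if \<eta> \<le> F \<omega> r (SOME s. s \<in> T) then {SOME s. s \<in> T} else {}) \<noteq> nb r)"
      unfolding mx[symmetric] sel by simp
  qed
  also have "\<dots> = (\<Union>r. \<Union>T. {\<omega> \<in> space M. (\<forall>s. s \<in> T \<longleftrightarrow> s \<noteq> r \<and> (\<forall>t. t \<noteq> r \<longrightarrow> F \<omega> r t \<le> F \<omega> r s)) \<and>
       (if \<eta> \<le> F \<omega> r (SOME s. s \<in> T) then {SOME s. s \<in> T} else {}) \<noteq> nb r})"
    by auto
  also have "\<dots> \<in> events"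
  proof (intro sets.finite_UN finite)
    fix r T
    show "{\<omega> \<in> space M. (\<forall>s. s \<in> T \<longleftrightarrow> s \<noteq> r \<and> (\<forall>t. t \<noteq> r \<longrightarrow> F \<omega> r t \<le> F \<omega> r s)) \<and>
       (if \<eta> \<le> F \<omega> r (SOME s. s \<in> T) then {SOME s. s \<in> T} else {}) \<noteq> nb r} \<in> events"
      by measurable
  qed
  finally show ?thesis .
qed

section \<open>Standardized pairs of components and the union bound\<close>

context filtered_class
begin

definition kappa where "kappa r s = sqrt (C $ r $ r * C $ s $ s)"

text \<open>Multiplying the spectral bounds of the two components and taking the root bounds the
  gain by \<open>B / kappa\<close>, which is sharper than \<open>B\<close> and compensates in part
  for the narrower windows at large \<open>kappa\<close>.\<close>

lemma kappa_bounds: "1 \<le> kappa r s" "kappa r s \<le> B"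
  and gain_kappa: "0 \<le> \<theta> \<Longrightarrow> \<theta> < 1 \<Longrightarrow> gain K h \<theta> \<le> B / kappa r s"
proof -
  have "1 * 1 \<le> C $ r $ r * C $ s $ s" "C $ r $ r * C $ s $ s \<le> B * B"
    using C_diag_bounds[of r] C_diag_bounds[of s] B by (intro mult_mono; simp)+
  then have "sqrt 1 \<le> kappa r s" "kappa r s \<le> sqrt (B * B)"
    unfolding kappa_def by (simp_all only: real_sqrt_le_iff mult_1)
  then show "1 \<le> kappa r s" "kappa r s \<le> B" using B by auto
  then have pos: "0 < kappa r s" by simp
  assume t: "0 \<le> \<theta>" "\<theta> < 1"
  have g: "0 \<le> gain K h \<theta>" by (simp add: gain_def)
  have "(gain K h \<theta> * C $ r $ r) * (gain K h \<theta> * C $ s $ s) \<le> B * B"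
    using spectral_bounds[OF t, of r] spectral_bounds[OF t, of s] B by (intro mult_mono) auto
  then have "(gain K h \<theta>)\<^sup>2 * (C $ r $ r * C $ s $ s) \<le> B * B"
    by (simp add: power2_eq_square mult_ac)
  then have "sqrt ((gain K h \<theta>)\<^sup>2 * (C $ r $ r * C $ s $ s)) \<le> sqrt (B * B)"
    by (simp only: real_sqrt_le_iff)
  then have "gain K h \<theta> * kappa r s \<le> B"
    using g B by (simp add: real_sqrt_mult kappa_def)
  then show "gain K h \<theta> \<le> B / kappa r s" using pos by (simp add: le_divide_eq)
qed

definition corr where "corr r s = C $ r $ s / kappa r s"

lemma abs_corr_less_1:
  assumes "r \<noteq> s"
  shows "\<bar>corr r s\<bar> < 1"
proof -
  have "sqrt ((C $ r $ s)\<^sup>2) < kappa r s"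
    unfolding kappa_def using pos_def_quadratic_pair(3)[OF pos_def_C assms] by (simp only: real_sqrt_less_iff)
  then show ?thesis using kappa_bounds(1)[of r s] by (simp add: corr_def abs_divide)
qed

text \<open>Coefficients of the sum (\<sigma> = 1) or difference (\<sigma> = -1) of the standardized
  components. The sum or difference has variance 2 (1 + \<sigma> c), which the leading factor
  normalizes to 1.\<close>

definition direction :: "real \<Rightarrow> 'p \<Rightarrow> 'p \<Rightarrow> real^'p" where
  "direction \<sigma> r s = (1 / sqrt (2 * (1 + \<sigma> * corr r s))) *\<^sub>R
     ((1 / sqrt (C $ r $ r)) *\<^sub>R axis r 1 + (\<sigma> / sqrt (C $ s $ s)) *\<^sub>R axis s 1)"

definition energy :: "nat \<Rightarrow> real \<Rightarrow> 'p \<Rightarrow> 'p \<Rightarrow> 'a \<Rightarrow> real" where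
  "energy N \<sigma> r s \<omega> = (\<Sum>n = 1..int N + 1. end_weight N n * (direction \<sigma> r s \<bullet> x n \<omega>)\<^sup>2)"

lemma direction_unit:
  assumes "r \<noteq> s" "\<sigma>\<^sup>2 = 1"
  shows "direction \<sigma> r s \<bullet> (C *v direction \<sigma> r s) = 1"
proof -
  define a where "a = sqrt (C $ r $ r)"
  define b where "b = sqrt (C $ s $ s)"
  have ab: "0 < a" "0 < b" "C $ r $ r = a\<^sup>2" "C $ s $ s = b\<^sup>2" "kappa r s = a * b"
    using C_diag_bounds(1)[of r] C_diag_bounds(1)[of s] by (auto simp: a_def b_def kappa_def real_sqrt_mult)
  define z where "z = 2 * (1 + \<sigma> * corr r s)"
  have "\<bar>\<sigma>\<bar> = 1" using assms(2) by (simp add: power2_eq_1_iff) auto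
  then have "\<bar>\<sigma> * corr r s\<bar> < 1" using abs_corr_less_1[OF assms(1)] by (simp add: abs_mult)
  then have z: "0 < z" by (auto simp: z_def)
  define v where "v = (1 / a) *\<^sub>R axis r 1 + (\<sigma> / b) *\<^sub>R (axis s 1 :: real^'p)"
  have "v \<bullet> (C *v v) = (1 / a) * (1 / a) * a\<^sup>2 + 2 * (1 / a) * (\<sigma> / b) * C $ r $ s + (\<sigma> / b) * (\<sigma> / b) * b\<^sup>2"
    unfolding v_def matrix_vector_right_distrib matrix_vector_mult_scaleR inner_add_left inner_add_right
        inner_scaleR_left inner_scaleR_right axis_bilinear C_sym[of s r] ab(3,4)
    by (simp add: algebra_simps)
  also have "\<dots> = 1 + 2 * \<sigma> * corr r s + \<sigma>\<^sup>2"
    using ab by (simp add: corr_def power2_eq_square)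
  finally have "v \<bullet> (C *v v) = z" using assms(2) by (simp add: z_def)
  moreover have "direction \<sigma> r s = (1 / sqrt z) *\<^sub>R v"
    by (simp add: direction_def v_def a_def b_def z_def)
  ultimately show ?thesis using z by (simp add: matrix_vector_mult_scaleR)
qed

text \<open>Exchanging the components multiplies the direction by the sign \<sigma>, which the
  square removes. An ordered pair may therefore stand in for its reversal in the union
  bound.\<close>

lemma energy_sym:
  assumes "\<sigma>\<^sup>2 = 1"
  shows "energy N \<sigma> r s \<omega> = energy N \<sigma> s r \<omega>"
proof -
  have "corr r s = corr s r" by (simp add: corr_def kappa_def C_sym[of r s] mult.commute)
  then have "direction \<sigma> s r = \<sigma> *\<^sub>R direction \<sigma> r s"
    using assms by (simp add: direction_def power2_eq_square scaleR_add_right add.commute mult_ac)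
  then show ?thesis using assms by (simp add: energy_def power_mult_distrib)
qed

text \<open>Pointwise polarization of the product of the standardized components. The factors 1 + c
  and 1 - c undo the normalization of the two directions, and \<open>kappa\<close> undoes the
  standardization.\<close>

lemma correlation_energy:
  assumes "r \<noteq> s"
  shows "2 * (\<Sum>n = 1..int N + 1. end_weight N n * x n \<omega> $ r * x n \<omega> $ s)
    = kappa r s * ((1 + corr r s) * energy N 1 r s \<omega> - (1 - corr r s) * energy N (- 1) r s \<omega>)"
proof -
  define a where "a = sqrt (C $ r $ r)"
  define b where "b = sqrt (C $ s $ s)"
  have ab: "0 < a" "0 < b" "kappa r s = a * b"
    using C_diag_bounds(1)[of r] C_diag_bounds(1)[of s] by (auto simp: a_def b_def kappa_def real_sqrt_mult)
  have c: "0 < 1 + corr r s" "0 < 1 - corr r s" using abs_corr_less_1[OF assms] by auto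
  have dir: "(1 + \<sigma> * corr r s) * (direction \<sigma> r s \<bullet> v)\<^sup>2 = (v $ r / a + \<sigma> * v $ s / b)\<^sup>2 / 2" if "0 < 1 + \<sigma> * corr r s" for \<sigma> v
  proof -
    have "direction \<sigma> r s \<bullet> v = (v $ r / a + \<sigma> * v $ s / b) / sqrt (2 * (1 + \<sigma> * corr r s))"
      by (simp add: direction_def inner_add_left inner_axis' a_def b_def)
    moreover have "t * (q / sqrt (2 * t))\<^sup>2 = q\<^sup>2 / 2" if "0 < t" for t q :: real
      using that by (simp add: power_divide)
    ultimately show ?thesis using that by (simp only:)
  qed
  have "2 * (v $ r * v $ s) = kappa r s * ((1 + corr r s) * (direction 1 r s \<bullet> v)\<^sup>2 - (1 - corr r s) * (direction (- 1) r s \<bullet> v)\<^sup>2)" for v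
  proof -
    have "(1 + corr r s) * (direction 1 r s \<bullet> v)\<^sup>2 - (1 - corr r s) * (direction (- 1) r s \<bullet> v)\<^sup>2
      = (v $ r / a + v $ s / b)\<^sup>2 / 2 - (v $ r / a - v $ s / b)\<^sup>2 / 2"
      using dir[of 1 v] dir[of "- 1" v] c by simp
    also have "\<dots> = 2 * (v $ r * v $ s) / (a * b)"
      using ab by (simp add: power2_eq_square field_simps)
    finally show ?thesis using ab by simp
  qed
  note pt = this
  have "2 * (end_weight N n * x n \<omega> $ r * x n \<omega> $ s) = kappa r s * ((1 + corr r s) * (end_weight N n * (direction 1 r s \<bullet> x n \<omega>)\<^sup>2)
     - (1 - corr r s) * (end_weight N n * (direction (- 1) r s \<bullet> x n \<omega>)\<^sup>2))" for n
  proof -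
    have "2 * (end_weight N n * x n \<omega> $ r * x n \<omega> $ s) = end_weight N n * (2 * (x n \<omega> $ r * x n \<omega> $ s))"
      by simp
    then show ?thesis unfolding pt by (simp add: algebra_simps)
  qed
  then show ?thesis
    unfolding energy_def sum_distrib_left sum_subtractf[symmetric] by (intro sum.cong) auto
qed

definition width where "width r s = \<rho> / (4 * B * kappa r s)"

definition in_window :: "nat \<Rightarrow> real \<Rightarrow> 'p \<Rightarrow> 'p \<Rightarrow> 'a \<Rightarrow> bool" where
  "in_window N \<sigma> r s \<omega> \<longleftrightarrow> (1 - width r s)\<^sup>2 * real N < energy N \<sigma> r s \<omega> \<and> energy N \<sigma> r s \<omega> < (1 + width r s)\<^sup>2 * real N"

lemma width_bounds:
  assumes "\<rho> \<le> 1"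
  shows "0 < width r s" "width r s < 1"
proof -
  have "1 * 1 \<le> B * kappa r s" using B kappa_bounds(1)[of r s] by (intro mult_mono) auto
  then show "0 < width r s" "width r s < 1"
    using rho assms by (auto simp: width_def divide_less_eq)
qed

lemma window_tail:
  assumes "N \<ge> 1" "\<rho> \<le> 1" "r \<noteq> s" "\<sigma>\<^sup>2 = 1"
  shows "prob {\<omega> \<in> space M. \<not> in_window N \<sigma> r s \<omega>} \<le> 2 * exp (- (real N * \<rho>\<^sup>2 / (32 * B ^ 4)))"
proof -
  let ?g = "B / kappa r s" and ?k = "width r s"
  have kp: "0 < kappa r s" "kappa r s \<le> B" using kappa_bounds[of r s] by auto
  have g: "0 < ?g" using kp B by simp
  note tails = unit_direction_tails[OF assms(1) direction_unit[OF assms(3,4)] g gain_kappa width_bounds[OF assms(2), of r s],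
      folded energy_def]
  have [measurable]: "energy N \<sigma> r s \<in> borel_measurable M"
    unfolding energy_def[abs_def] by measurable
  \<comment> \<open>Inserting the width and the gain bound gives the denominator 32 B^3
    \<open>kappa\<close>. Bounding \<open>kappa\<close> by \<open>B\<close> makes the exponent
    uniform in the pair.\<close>
  have "real N * \<rho>\<^sup>2 / (32 * B ^ 4) \<le> real N * ?k\<^sup>2 / (2 * ?g)"
  proof -
    have "real N * ?k\<^sup>2 / (2 * ?g) = real N * \<rho>\<^sup>2 / (32 * B ^ 3 * kappa r s)"
      using kp B by (simp add: width_def field_simps power2_eq_square power3_eq_cube)
    moreover have "32 * B ^ 3 * kappa r s \<le> 32 * B ^ 4"
      using kp B by (simp add: power3_eq_cube power4_eq_xxxx)
    ultimately show ?thesis using kp B by (auto intro!: divide_left_mono)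
  qed
  then have e: "exp (- (real N * ?k\<^sup>2 / (2 * ?g))) \<le> exp (- (real N * \<rho>\<^sup>2 / (32 * B ^ 4)))" by simp
  have "{\<omega> \<in> space M. \<not> in_window N \<sigma> r s \<omega>} =
      {\<omega> \<in> space M. (1 + ?k)\<^sup>2 * real N \<le> energy N \<sigma> r s \<omega>} \<union> {\<omega> \<in> space M. energy N \<sigma> r s \<omega> \<le> (1 - ?k)\<^sup>2 * real N}"
    by (auto simp: in_window_def)
  then have "prob {\<omega> \<in> space M. \<not> in_window N \<sigma> r s \<omega>} \<le>
      prob {\<omega> \<in> space M. (1 + ?k)\<^sup>2 * real N \<le> energy N \<sigma> r s \<omega>} + prob {\<omega> \<in> space M. energy N \<sigma> r s \<omega> \<le> (1 - ?k)\<^sup>2 * real N}"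
    by (simp only:) (rule measure_Un_le; measurable)
  then show ?thesis using tails e by linarith
qed

lemma selection_correct:
  assumes "N \<ge> 1" "\<rho> \<le> 1" "CARD('p) \<ge> 2"
    and win: "\<And>s \<sigma>. s \<noteq> r \<Longrightarrow> \<sigma> \<in> {1, - 1} \<Longrightarrow> in_window N \<sigma> r s \<omega>"
  shows "selected_neighborhood N (real N * \<rho> / B) (\<lambda>n. x n \<omega>) r = neighborhood M x r"
proof (rule selected_neighborhood_correct)
  show "CARD('p) \<ge> 2" by fact
  show "card (neighborhood M x r) \<le> 1" using cls by (simp add: process_class_def)
  show "r \<notin> neighborhood M x r" by (auto simp: neighborhood_def cig_edges_def)
next
  fix s assume s: "s \<noteq> r"
  let ?c = "corr r s" and ?k = "width r s"
  define P where "P = energy N 1 r s \<omega>"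
  define Q where "Q = energy N (- 1) r s \<omega>"
  have P: "(1 - ?k)\<^sup>2 * real N < P" "P < (1 + ?k)\<^sup>2 * real N" and Q: "(1 - ?k)\<^sup>2 * real N < Q" "Q < (1 + ?k)\<^sup>2 * real N"
    using win[OF s, of 1] win[OF s, of "- 1"] by (auto simp: in_window_def P_def Q_def)
  have Z: "cmod (Z_stat N (\<lambda>n. x n \<omega>) r s) = \<bar>kappa r s * ((1 + ?c) * P - (1 - ?c) * Q)\<bar>"
    unfolding Z_stat_eq[OF assms(1)] norm_of_real correlation_energy[OF s[symmetric]] P_def Q_def ..
  have kp: "1 \<le> kappa r s" by (rule kappa_bounds)
  have N: "0 < real N" using assms(1) by simp
  have c: "\<bar>?c\<bar> < 1" using s by (intro abs_corr_less_1) auto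
  show "real N * \<rho> / B \<le> cmod (Z_stat N (\<lambda>n. x n \<omega>) r s) \<longleftrightarrow> s \<in> neighborhood M x r"
  proof (cases "(r, s) \<in> cig_edges M x")
    case True
    then have "\<rho> \<le> \<bar>C $ r $ s\<bar> / kappa r s"
      using cig_edge_correlation[OF True] kp by (simp add: kappa_def le_divide_eq)
    then have "\<rho> \<le> \<bar>?c\<bar>" using kp by (simp add: corr_def abs_divide)
    then consider "\<rho> \<le> ?c" | "\<rho> \<le> - ?c" by linarith
    then have "real N * \<rho> / B \<le> \<bar>kappa r s * ((1 + ?c) * P - (1 - ?c) * Q)\<bar>"
    proof cases
      case 1
      then have "real N * \<rho> / B \<le> kappa r s * ((1 + ?c) * P - (1 - ?c) * Q)"
        using c width_bounds(2)[OF assms(2)] by (intro correlation_window_pos[OF kp B rho N width_def _ _ _ P(1) Q(2)]) auto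
      then show ?thesis by linarith
    next
      case 2
      \<comment> \<open>A negative correlation is the positive case with the energies exchanged and
        c replaced by -c; the statistic only changes its sign.\<close>
      then have "real N * \<rho> / B \<le> kappa r s * ((1 + - ?c) * Q - (1 - - ?c) * P)"
        using c width_bounds(2)[OF assms(2)] by (intro correlation_window_pos[OF kp B rho N width_def _ _ _ Q(1) P(2)]) auto
      also have "\<dots> = - (kappa r s * ((1 + ?c) * P - (1 - ?c) * Q))" by (simp add: algebra_simps)
      finally show ?thesis by linarith
    qed
    then show ?thesis using True by (simp only: Z neighborhood_def mem_Collect_eq)
  next
    case False
    then have "matrix_inv C $ r $ s = 0" using precision_nonzero_edge[OF s[symmetric]] by blast
    then have "C $ r $ s = 0" by (rule sparse_precision_blocks(1)[OF pos_def_C sparse s[symmetric]])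
    then have "?c = 0" by (simp add: corr_def)
    then have "cmod (Z_stat N (\<lambda>n. x n \<omega>) r s) = \<bar>kappa r s * (P - Q)\<bar>" by (simp add: Z)
    also have "\<dots> < real N * \<rho> / B"
      by (rule correlation_window_zero[OF kp B width_def P Q])
    finally show ?thesis using False by (simp add: neighborhood_def)
  qed
qed

text \<open>Each unordered pair contributes two energies. Assigning one of them to each of the two
  orders, by means of an injection into the naturals, avoids a factor 2 in the union bound.\<close>

lemma selection_error_probability:
  assumes N: "N \<ge> 1" and rho1: "\<rho> \<le> 1" and p: "CARD('p) \<ge> 2"
  shows "prob {\<omega> \<in> space M. \<exists>r. selected_neighborhood N (real N * \<rho> / B) (\<lambda>n. x n \<omega>) r \<noteq> neighborhood M x r}
    \<le> 2 * (real CARD('p))\<^sup>2 * exp (- (real N * \<rho>\<^sup>2 / (32 * B ^ 4)))"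
proof -
  obtain f :: "'p \<Rightarrow> nat" where f: "inj f"
    using finite_imp_inj_to_nat_seg[of "UNIV :: 'p set"] by auto
  define sg where "sg r s = (if f r < f s then 1 else - 1 :: real)" for r s
  have sg: "(sg r s)\<^sup>2 = 1" for r s by (simp add: sg_def)
  define bad where "bad = (\<lambda>(r, s). if r = s then {} else {\<omega> \<in> space M. \<not> in_window N (sg r s) r s \<omega>})"
  have [measurable]: "energy N \<sigma> r s \<in> borel_measurable M" for \<sigma> r s
    unfolding energy_def[abs_def] by measurable
  have bad_event: "bad z \<in> events" for z
    by (cases z) (auto simp: bad_def in_window_def)
  have sub: "{\<omega> \<in> space M. \<exists>r. selected_neighborhood N (real N * \<rho> / B) (\<lambda>n. x n \<omega>) r \<noteq> neighborhood M x r} \<subseteq> (\<Union>z. bad z)"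
  proof
    fix \<omega> assume "\<omega> \<in> {\<omega> \<in> space M. \<exists>r. selected_neighborhood N (real N * \<rho> / B) (\<lambda>n. x n \<omega>) r \<noteq> neighborhood M x r}"
    then obtain r where w: "\<omega> \<in> space M" and r: "selected_neighborhood N (real N * \<rho> / B) (\<lambda>n. x n \<omega>) r \<noteq> neighborhood M x r" by auto
    then obtain s \<sigma> where s: "s \<noteq> r" "\<sigma> \<in> {1, - 1}" and out: "\<not> in_window N \<sigma> r s \<omega>"
      using selection_correct[OF N rho1 p, of r \<omega>] by blast
    have k: "kappa r s = kappa s r" by (simp add: kappa_def mult.commute)
    have "in_window N \<sigma> r s \<omega> = in_window N \<sigma> s r \<omega>"
      using s(2) energy_sym[of \<sigma> N r s \<omega>] k by (auto simp: in_window_def width_def)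
    moreover have "\<sigma> = sg r s \<or> \<sigma> = sg s r"
      using s inj_eq[OF f, of r s] by (auto simp: sg_def)
    ultimately have "\<omega> \<in> bad (r, s) \<or> \<omega> \<in> bad (s, r)"
      using out w s(1) by (auto simp: bad_def)
    then show "\<omega> \<in> (\<Union>z. bad z)" by blast
  qed
  have "prob {\<omega> \<in> space M. \<exists>r. selected_neighborhood N (real N * \<rho> / B) (\<lambda>n. x n \<omega>) r \<noteq> neighborhood M x r} \<le> prob (\<Union>z. bad z)"
    using sub bad_event by (intro finite_measure_mono) auto
  also have "\<dots> \<le> (\<Sum>z\<in>UNIV. prob (bad z))"
    using bad_event by (intro finite_measure_subadditive_finite) auto
  also have "\<dots> \<le> (\<Sum>z\<in>(UNIV :: ('p \<times> 'p) set). 2 * exp (- (real N * \<rho>\<^sup>2 / (32 * B ^ 4))))"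
  proof (rule sum_mono)
    fix z :: "'p \<times> 'p"
    obtain r s where z: "z = (r, s)" by (cases z)
    show "prob (bad z) \<le> 2 * exp (- (real N * \<rho>\<^sup>2 / (32 * B ^ 4)))"
    proof (cases "r = s")
      case True
      then show ?thesis by (simp add: z bad_def)
    next
      case False
      then show ?thesis using window_tail[OF N rho1 False sg] by (simp add: z bad_def)
    qed
  qed
  also have "\<dots> = 2 * (real CARD('p))\<^sup>2 * exp (- (real N * \<rho>\<^sup>2 / (32 * B ^ 4)))"
    by (simp add: power2_eq_square)
  finally show ?thesis .
qed

end

theorem theorem3p2:
  fixes M :: "'a measure"
    and x w :: "int \<Rightarrow> 'a \<Rightarrow> real^'p"
    and C :: "real^'p^'p"
    and h :: "nat \<Rightarrow> real"
    and N K :: nat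
    and \<rho>_min \<delta> B :: real
  assumes "prob_space M"
    and "CARD('p) \<ge> 2" and "N \<ge> 1"
    and "0 < \<rho>_min" and "\<rho>_min \<le> 1"
    and "0 < \<delta>" and "\<delta> < 1"
    and "B \<ge> 1"
    and "process_class M 1 \<rho>_min B x"
    and "\<And>n \<omega>. \<omega> \<in> space M \<Longrightarrow> x n \<omega> = (\<Sum>m<K. h m *\<^sub>R w (n - int m) \<omega>)"
    and "real K < real N / 4"
    and "(\<Sum>m<K. (h m)\<^sup>2) = 1"
    and "prob_space.indep_vars M (\<lambda>_. borel) w UNIV"
    and "\<And>n. mv_normal M (w n) 0 C"
    and "\<And>r. card {s. s \<noteq> r \<and> matrix_inv C $ r $ s \<noteq> 0} \<le> 1"
    and "real N > 32 * B ^ 4 / \<rho>_min\<^sup>2 * ln (2 * (real CARD('p))\<^sup>2 / \<delta>)"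
  shows "{\<omega> \<in> space M. \<exists>r. selected_neighborhood N (real N * \<rho>_min / B) (\<lambda>n. x n \<omega>) r
             \<noteq> neighborhood M x r} \<in> sets M
       \<and> \<P>(\<omega> in M. \<exists>r. selected_neighborhood N (real N * \<rho>_min / B) (\<lambda>n. x n \<omega>) r
             \<noteq> neighborhood M x r) \<le> \<delta>"
proof -
  interpret prob_space M by fact
  interpret filtered_class M x w C h K B \<rho>_min
    using assms by unfold_locales (auto simp: process_class_def)
  define p where "p = real CARD('p)"
  have p: "0 < p" using assms(2) by (simp add: p_def)
  have B4: "0 < B ^ 4" using assms(8) by simp
  \<comment> \<open>The sample size condition solved for the exponent of the tail bound.\<close>
  have "ln (2 * p\<^sup>2 / \<delta>) < real N * \<rho>_min\<^sup>2 / (32 * B ^ 4)"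
    using assms(4,16) B4 by (simp add: p_def field_simps)
  then have "exp (- (real N * \<rho>_min\<^sup>2 / (32 * B ^ 4))) \<le> exp (- ln (2 * p\<^sup>2 / \<delta>))" by simp
  also have "\<dots> = \<delta> / (2 * p\<^sup>2)" using p assms(6) by (simp add: exp_minus)
  finally have "2 * p\<^sup>2 * exp (- (real N * \<rho>_min\<^sup>2 / (32 * B ^ 4))) \<le> \<delta>"
    using p by (simp add: field_simps)
  then show ?thesis
    using selection_error_event[OF assms(3)] selection_error_probability[OF assms(3,5,2)]
    by (simp add: p_def)
qed

end
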